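(* Let $G:(0,\infty)\times S^{n-1}\to(0,\infty)$ be continuous and such that $G_t=\partial G/\partial t$ is continuous and negative on $(0,\infty)\times S^{n-1}$. Let $0<\varepsilon_0<1$ and suppose that for every $v\in S^{n-1}$, $$\lim_{t\to0+}\int_{\Sigma_{\varepsilon_0}(v)}G(t,u)\,du=\infty,$$ where $\Sigma_{\varepsilon_0}(v)=\{u\in S^{n-1}:\langle u,v\rangle\ge\varepsilon_0\}$. Suppose that $\psi:(0,\infty)\to(0,\infty)$ is continuous, that $\int_1^\infty\frac{\psi(s)}{s}\,ds=\infty$, and that $\varphi(t)=\int_0^t\frac{\psi(s)}{s}\,ds$ is finite for all $t>0$. Let $\mu$ be a finite Borel measure on $S^{n-1}$. Then the following are equivalent: (i) $\mu$ is not concentrated on any closed hemisphere. (ii) There exist $K\in\mathcal{K}_{(o)}^n$ and $\tau<0$ such that $$\mu=\tau\,\widetilde{C}_{G,\psi}(K,\cdot),\quad\text{where}\quad \tau=\frac{\mu(S^{n-1})}{\widetilde{C}_{G,\psi}(K,S^{n-1})}.$$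
   Context: Let $n\ge2$, let $o$ be the origin of $\mathbb{R}^n$ and $S^{n-1}$ the unit sphere; $du$ denotes integration with respect to $(n-1)$-dimensional Hausdorff measure $\mathcal{H}^{n-1}$. $\mathcal{K}_{(o)}^n$ is the class of compact convex subsets of $\mathbb{R}^n$ containing $o$ in their interiors. A finite Borel measure $\mu$ on $S^{n-1}$ is not concentrated on any closed hemisphere if $\int_{S^{n-1}}\langle u,v\rangle_+\,d\mu(u)>0$ for all $v\in S^{n-1}$, where $a_+=\max\{a,0\}$. For $K\in\mathcal{K}_{(o)}^n$ and $u\in S^{n-1}$, $h_K(u)=\max\{\langle u,x\rangle:x\in K\}$ and $\rho_K(u)=\max\{\lambda\ge0:\lambda u\in K\}$. For $K\in\mathcal{K}_{(o)}^n$ and a Borel set $E\subset S^{n-1}$, let $\boldsymbol{\alpha}_K^*(E)$ be the set of $u\in S^{n-1}$ such that some $v\in E$ is an outer unit normal vector of $K$ at the boundary point $\rho_K(u)u$, i.e. $\langle v,\rho_K(u)u\rangle=h_K(v)$. For $\mathcal{H}^{n-1}$-almost all $u\in S^{n-1}$ there is exactly one outer unit normal vector of $K$ at $\rho_K(u)u$, denoted by $\alpha_K(u)$. The general dual Orlicz curvature measure is the finite signed Borel measure $$\widetilde{C}_{G,\psi}(K,E)=\frac1n\int_{\boldsymbol{\alpha}_K^*(E)}\frac{\rho_K(u)\,G_t(\rho_K(u),u)}{\psi(h_K(\alpha_K(u)))}\,du,\qquad E\subset S^{n-1}\text{ Borel}.$$ *)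

theory Defs
  imports "HOL-Analysis.Analysis"
begin

section \<open>Hausdorff measure\<close>

text \<open>The factor \<open>unit_ball_vol d / 2 ^ d\<close> is the normalization for which the
  \<open>d\<close>-dimensional Hausdorff measure on \<open>d\<close>-dimensional Euclidean space is Lebesgue measure.
  The covering sets are arbitrary bounded sets. The empty set is given weight \<open>0\<close> explicitly
  because of \<open>0 ^ 0 = 1\<close>.\<close>

definition hausdorff_weight :: "nat \<Rightarrow> 'a::metric_space set \<Rightarrow> ennreal" where
  "hausdorff_weight d X =
     (if X = {} then 0 else ennreal (unit_ball_vol (real d) * (diameter X / 2) ^ d))"

definition hausdorff_content :: "nat \<Rightarrow> real \<Rightarrow> 'a::metric_space set \<Rightarrow> ennreal" where
  "hausdorff_content d \<delta> A =
     (INF X \<in> {X :: nat \<Rightarrow> 'a set. (\<forall>i. bounded (X i) \<and> diameter (X i) \<le> \<delta>) \<and> A \<subseteq> (\<Union>i. X i)}.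
        \<Sum>i. hausdorff_weight d (X i))"

definition hausdorff_outer :: "nat \<Rightarrow> 'a::metric_space set \<Rightarrow> ennreal" where
  "hausdorff_outer d A = (SUP \<delta> \<in> {0<..}. hausdorff_content d \<delta> A)"

text \<open>The measure lives on all Caratheodory-measurable sets, so it is complete. This matters
  below: the reverse radial Gauss image of a Borel set need not be Borel, but differs from a Borel
  set only by a subset of a null set.\<close>

definition hausdorff_measure :: "nat \<Rightarrow> 'a::metric_space measure" where
  "hausdorff_measure d =
     measure_of UNIV (lambda_system UNIV UNIV (hausdorff_outer d)) (hausdorff_outer d)"

lemma hausdorff_content_empty:
  assumes "\<delta> > 0"
  shows "hausdorff_content d \<delta> {} = 0"
proof -
  have "hausdorff_content d \<delta> ({} :: 'a set) \<le> (\<Sum>i::nat. hausdorff_weight d ({} :: 'a set))"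
    unfolding hausdorff_content_def
    by (rule INF_lower2[of "\<lambda>i. {}"]) (use assms in auto)
  then show ?thesis by (simp add: hausdorff_weight_def)
qed

lemma hausdorff_content_mono:
  assumes "A \<subseteq> B"
  shows "hausdorff_content d \<delta> A \<le> hausdorff_content d \<delta> B"
  unfolding hausdorff_content_def by (rule INF_superset_mono) (use assms in auto)

lemma hausdorff_content_countably_subadditive:
  fixes A :: "nat \<Rightarrow> 'a::metric_space set"
  shows "hausdorff_content d \<delta> (\<Union>i. A i) \<le> (\<Sum>i. hausdorff_content d \<delta> (A i))"
proof (rule ennreal_le_epsilon)
  fix e :: real
  assume e: "0 < e" and fin: "(\<Sum>i. hausdorff_content d \<delta> (A i)) < top"
  have fin': "hausdorff_content d \<delta> (A i) < top" for i
    using ennreal_suminf_lessD[OF fin] .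
  have "\<exists>X. (\<forall>j. bounded (X j) \<and> diameter (X j) \<le> \<delta>) \<and> A i \<subseteq> (\<Union>j. X j) \<and>
      (\<Sum>j. hausdorff_weight d (X j)) \<le> hausdorff_content d \<delta> (A i) + ennreal (e * (1/2) ^ Suc i)"
    for i
  proof -
    have "hausdorff_content d \<delta> (A i) < hausdorff_content d \<delta> (A i) + ennreal (e * (1/2) ^ Suc i)"
      using fin'[of i] e by (auto simp: less_top)
    then obtain X where "X \<in> {X :: nat \<Rightarrow> 'a set. (\<forall>j. bounded (X j) \<and> diameter (X j) \<le> \<delta>) \<and> A i \<subseteq> (\<Union>j. X j)}"
      and "(\<Sum>j. hausdorff_weight d (X j)) < hausdorff_content d \<delta> (A i) + ennreal (e * (1/2) ^ Suc i)"
      unfolding hausdorff_content_def[of d \<delta> "A i"] INF_less_iff by blast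
    then show ?thesis by (intro exI[of _ X]) (simp add: less_imp_le)
  qed
  then have "\<exists>X. \<forall>i. (\<forall>j. bounded (X i j) \<and> diameter (X i j) \<le> \<delta>) \<and> A i \<subseteq> (\<Union>j. X i j) \<and>
      (\<Sum>j. hausdorff_weight d (X i j)) \<le> hausdorff_content d \<delta> (A i) + ennreal (e * (1/2) ^ Suc i)"
    by (intro choice allI)
  then obtain X where "\<forall>i. (\<forall>j. bounded (X i j) \<and> diameter (X i j) \<le> \<delta>) \<and> A i \<subseteq> (\<Union>j. X i j) \<and>
      (\<Sum>j. hausdorff_weight d (X i j)) \<le> hausdorff_content d \<delta> (A i) + ennreal (e * (1/2) ^ Suc i)"
    by (rule exE)
  then have X: "\<And>i j. bounded (X i j)" "\<And>i j. diameter (X i j) \<le> \<delta>"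
      "\<And>i. A i \<subseteq> (\<Union>j. X i j)"
      "\<And>i. (\<Sum>j. hausdorff_weight d (X i j)) \<le> hausdorff_content d \<delta> (A i) + ennreal (e * (1/2) ^ Suc i)"
    by blast+
  let ?Y = "\<lambda>k. case_prod X (prod_decode k)"
  have "(\<Union>i. A i) \<subseteq> (\<Union>k. ?Y k)"
  proof
    fix x assume "x \<in> (\<Union>i. A i)"
    then obtain i j where "x \<in> X i j" using X(3) by blast
    then have "x \<in> ?Y (prod_encode (i, j))" by simp
    then show "x \<in> (\<Union>k. ?Y k)" by (rule UN_I[OF UNIV_I])
  qed
  then have "hausdorff_content d \<delta> (\<Union>i. A i) \<le> (\<Sum>k. hausdorff_weight d (?Y k))"
    unfolding hausdorff_content_def
    by (intro INF_lower CollectI conjI allI) (simp_all only: split_beta X)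
  also have "\<dots> = (\<Sum>i. \<Sum>j. hausdorff_weight d (X i j))"
    using suminf_ennreal_2dimen[of "\<lambda>i. \<Sum>j. hausdorff_weight d (X i j)"
        "\<lambda>p. hausdorff_weight d (case_prod X p)", unfolded prod.case, OF refl] .
  also have "\<dots> \<le> (\<Sum>i. hausdorff_content d \<delta> (A i) + ennreal (e * (1/2) ^ Suc i))"
    by (intro suminf_le X summableI)
  also have "\<dots> = (\<Sum>i. hausdorff_content d \<delta> (A i)) + (\<Sum>i. ennreal (e * (1/2) ^ Suc i))"
    by (intro suminf_add[symmetric] summableI)
  also have "(\<Sum>i. ennreal (e * (1/2) ^ Suc i)) = ennreal e"
    using e sums_mult[OF power_half_series, of e]
    by (subst suminf_ennreal_eq[where x = e]) auto
  finally show "hausdorff_content d \<delta> (\<Union>i. A i) \<le> (\<Sum>i. hausdorff_content d \<delta> (A i)) + ennreal e" .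
qed

lemma outer_measure_space_hausdorff_outer: "outer_measure_space UNIV (hausdorff_outer d)"
  unfolding outer_measure_space_def positive_def increasing_def countably_subadditive_def
proof (intro conjI ballI allI impI)
  show "hausdorff_outer d {} = 0"
    by (simp add: hausdorff_outer_def hausdorff_content_empty)
  show "hausdorff_outer d A \<le> hausdorff_outer d B" if "A \<subseteq> B" for A B :: "'a set"
    unfolding hausdorff_outer_def using that
    by (intro SUP_mono') (auto intro: hausdorff_content_mono)
  show "hausdorff_outer d (\<Union>i. A i) \<le> (\<Sum>i. hausdorff_outer d (A i))" for A :: "nat \<Rightarrow> 'a set"
    unfolding hausdorff_outer_def
  proof (rule SUP_least)
    fix \<delta> :: real assume \<delta>: "\<delta> \<in> {0<..}"
    have "hausdorff_content d \<delta> (\<Union>i. A i) \<le> (\<Sum>i. hausdorff_content d \<delta> (A i))"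
      by (rule hausdorff_content_countably_subadditive)
    also have "\<dots> \<le> (\<Sum>i. SUP \<delta> \<in> {0<..}. hausdorff_content d \<delta> (A i))"
      by (intro suminf_le summableI SUP_upper \<delta>)
    finally show "hausdorff_content d \<delta> (\<Union>i. A i) \<le> \<dots>" .
  qed
qed

lemma measure_space_hausdorff:
  "measure_space UNIV (lambda_system UNIV UNIV (hausdorff_outer d)) (hausdorff_outer d)"
  using sigma_algebra.caratheodory_lemma[OF sigma_algebra_Pow[of UNIV], unfolded Pow_UNIV]
    outer_measure_space_hausdorff_outer by blast

lemma sets_hausdorff_measure:
  "sets (hausdorff_measure d) = lambda_system UNIV UNIV (hausdorff_outer d)"
  unfolding hausdorff_measure_def
  by (rule sigma_algebra.sets_measure_of_eq[OF measure_space_hausdorff[unfolded measure_space_def, THEN conjunct1]])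

lemma emeasure_hausdorff_measure:
  "A \<in> sets (hausdorff_measure d) \<Longrightarrow> emeasure (hausdorff_measure d) A = hausdorff_outer d A"
  unfolding sets_hausdorff_measure unfolding hausdorff_measure_def
  by (intro emeasure_measure_of_sigma measure_space_hausdorff[unfolded measure_space_def, THEN conjunct1]
      measure_space_hausdorff[unfolded measure_space_def, THEN conjunct2, THEN conjunct1]
      measure_space_hausdorff[unfolded measure_space_def, THEN conjunct2, THEN conjunct2])


section \<open>Convex bodies and the general dual Orlicz curvature measure\<close>

definition convex_bodies_o :: "(real ^ 'n) set set" where
  "convex_bodies_o = {K. compact K \<and> convex K \<and> 0 \<in> interior K}"

text \<open>The suprema below are attained for the bodies in \<open>convex_bodies_o\<close>.\<close>

definition support_function :: "(real ^ 'n) set \<Rightarrow> real ^ 'n \<Rightarrow> real" where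
  "support_function K u = (SUP x \<in> K. u \<bullet> x)"

definition radial_function :: "(real ^ 'n) set \<Rightarrow> real ^ 'n \<Rightarrow> real" where
  "radial_function K u = Sup {l. l \<ge> 0 \<and> l *\<^sub>R u \<in> K}"

definition outer_normal :: "(real ^ 'n) set \<Rightarrow> real ^ 'n \<Rightarrow> real ^ 'n \<Rightarrow> bool" where
  "outer_normal K x v \<longleftrightarrow> v \<in> sphere 0 1 \<and> v \<bullet> x = support_function K v"

definition reverse_radial_gauss_image ::
    "(real ^ 'n) set \<Rightarrow> (real ^ 'n) set \<Rightarrow> (real ^ 'n) set" where
  "reverse_radial_gauss_image K E =
     {u \<in> sphere 0 1. \<exists>v\<in>E. outer_normal K (radial_function K u *\<^sub>R u) v}"

text \<open>Meaningful only where the normal is unique, that is for almost all \<open>u\<close>.\<close>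

definition radial_gauss_map :: "(real ^ 'n) set \<Rightarrow> real ^ 'n \<Rightarrow> real ^ 'n" where
  "radial_gauss_map K u = (THE v. outer_normal K (radial_function K u *\<^sub>R u) v)"

definition G_t :: "(real \<Rightarrow> real ^ 'n \<Rightarrow> real) \<Rightarrow> real \<Rightarrow> real ^ 'n \<Rightarrow> real" where
  "G_t G t u = deriv (\<lambda>s. G s u) t"

definition dual_orlicz_curvature ::
    "(real \<Rightarrow> real ^ 'n \<Rightarrow> real) \<Rightarrow> (real \<Rightarrow> real) \<Rightarrow> (real ^ 'n) set \<Rightarrow> (real ^ 'n) set \<Rightarrow> real" where
  "dual_orlicz_curvature G \<psi> K E =
     1 / real CARD('n) *
     (LINT u : reverse_radial_gauss_image K E | hausdorff_measure (CARD('n) - 1).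
        radial_function K u * G_t G (radial_function K u) u
          / \<psi> (support_function K (radial_gauss_map K u)))"

definition not_concentrated_on_closed_hemisphere :: "(real ^ 'n) measure \<Rightarrow> bool" where
  "not_concentrated_on_closed_hemisphere \<mu> \<longleftrightarrow>
     (\<forall>v \<in> sphere 0 1. (LINT u|\<mu>. max (u \<bullet> v) 0) > 0)"

end

theory Submission
  imports Defs "HOL-Complex_Analysis.Great_Picard"
begin

text \<open>Write \<open>S\<close> for the unit sphere and \<open>\<omega>\<close> for the Hausdorff measure \<open>\<H>\<^sup>n\<^sup>-\<^sup>1\<close> restricted to it.
  The measure is found as the Euler--Lagrange equation of an unconstrained variational
  problem. Let \<open>\<phi>\<close> be a nonnegative antiderivative of \<open>\<psi>(s) / s\<close> on \<open>(0, \<infinity>)\<close>; it is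
  increasing and unbounded. Minimize \<open>J(K) = \<integral> \<phi>(h\<^sub>K) d\<mu> + \<integral> G(\<rho>\<^sub>K(u), u) d\<omega>(u)\<close> over
  the convex bodies \<open>K\<close> with the origin in the interior. Both terms are nonnegative and they
  pull in opposite directions. If \<open>\<mu>\<close> is not concentrated on a closed hemisphere, a bound on
  the first term bounds \<open>K\<close> from outside (\<open>bounded_energy_imp_bounded_body\<close>). The blow-up of
  \<open>\<integral>G(t, u) du\<close> over caps as \<open>t \<rightarrow> 0\<close> shows that a bound on the second term keeps the
  origin away from the boundary (\<open>limit_of_bounded_energy_positive\<close>). By the Arzela--Ascoli
  theorem a minimizer exists (\<open>energy_minimizer_exists\<close>). No constraint is imposed, hence no
  Lagrange multiplier appears, and the constant obtained is \<open>\<tau> = -n\<close>.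

  To differentiate, the functional is extended to all positive continuous functions \<open>f\<close> on
  \<open>S\<close>: \<open>h\<^sub>K\<close> is replaced by \<open>f\<close>, and \<open>\<rho>\<^sub>K\<close> by the radial function of the Wulff shape
  \<open>{x. \<forall>v\<in>S. x \<bullet> v \<le> f v}\<close>, whose reciprocal is the gauge
  \<open>max {(u \<bullet> v) / f v | v \<in> S}\<close>. Passing from \<open>f\<close> to the support function of its
  Wulff shape keeps the gauge and does not increase \<open>f\<close>, so a minimizer among bodies is a
  minimizer among all such \<open>f\<close>. The outer normals of \<open>K\<close> at \<open>\<rho>\<^sub>K(u) u\<close> are exactly the \<open>v\<close> at
  which the maximum defining the gauge is attained for \<open>f = h\<^sub>K\<close>. Along
  \<open>f\<^sub>t = h exp (t g)\<close> the derivative of \<open>log \<rho>\<close> at \<open>t = 0\<close> is \<open>g(\<alpha>\<^sub>K(u))\<close> wherever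
  that normal is unique (\<open>wulff_gauge_log_derivative\<close>), and dominated convergence turns
  minimality into \<open>\<integral> \<psi>(h) g d\<mu> = - \<integral> \<rho> G\<^sub>t(\<rho>, u) g(\<alpha>\<^sub>K(u)) d\<omega>(u)\<close> for all
  continuous \<open>g\<close> (\<open>euler_lagrange\<close>). Replacing \<open>g\<close> by \<open>g / \<psi>(h)\<close> identifies \<open>\<mu>\<close> with \<open>-n\<close>
  times the curvature measure.

  That the normal is unique for \<open>\<omega>\<close>-almost every \<open>u\<close> (\<open>AE_unique_contact_normal\<close>) is proved on
  the sphere itself, from the rotation invariance of \<open>\<omega>\<close>. Two normals at \<open>u\<close> give two linear
  minorants of the gauge that touch it at \<open>u\<close>, so the gauge has a kink at \<open>u\<close> along a rotation
  of some coordinate plane. The set of points whose kink contains a fixed rational interval of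
  slopes is disjoint from its images under all small rotations in that plane. It therefore has
  infinitely many disjoint copies of the same measure in a sphere of finite measure, and so it
  is null. The finiteness and positivity of \<open>\<omega>(S)\<close> are read off from the blow-up hypothesis on
  \<open>G\<close>: a Bochner integral that is nonzero is the integral of an integrable function, and for
  fixed \<open>t\<close> the function \<open>G\<close> is bounded below on \<open>S\<close> by a positive constant.

  Conversely, if \<open>\<mu>\<close> is a multiple of the curvature measure of \<open>K\<close> and \<open>\<integral>(u \<bullet> v)\<^sub>+ d\<mu>\<close>
  vanishes, then \<open>\<omega>\<close>-almost no \<open>u\<close> has a normal with positive inner product with \<open>v\<close>. But
  every normal at a direction \<open>u\<close> close to \<open>v\<close> has this property, because the angle between a
  direction and its normal is bounded away from \<open>\<pi>/2\<close>, and caps have positive measure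
  (\<open>curvature_measure_not_concentrated\<close>).\<close>

section \<open>Measurability and invariance of Hausdorff measure\<close>

lemma hausdorff_outer_le:
  assumes "A \<subseteq> B" shows "hausdorff_outer d A \<le> hausdorff_outer d B"
  using outer_measure_space_hausdorff_outer[of d] assms
  unfolding outer_measure_space_def increasing_def by auto

lemma hausdorff_content_antimono:
  assumes "\<delta> \<le> \<delta>'" shows "hausdorff_content d \<delta>' A \<le> hausdorff_content d \<delta> A"
  unfolding hausdorff_content_def by (rule INF_superset_mono) (auto intro: order_trans[OF _ assms])

lemma hausdorff_content_separated:
  assumes "\<delta> < e" and sep: "\<And>a b. a \<in> A \<Longrightarrow> b \<in> B \<Longrightarrow> e \<le> dist a b"
  shows "hausdorff_content d \<delta> A + hausdorff_content d \<delta> B \<le> hausdorff_content d \<delta> (A \<union> B)"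
  unfolding hausdorff_content_def[of d \<delta> "A \<union> B"]
proof (rule INF_greatest)
  fix X :: "nat \<Rightarrow> 'a set"
  assume "X \<in> {X. (\<forall>i. bounded (X i) \<and> diameter (X i) \<le> \<delta>) \<and> A \<union> B \<subseteq> (\<Union>i. X i)}"
  then have X: "\<And>i. bounded (X i)" "\<And>i. diameter (X i) \<le> \<delta>" "A \<union> B \<subseteq> (\<Union>i. X i)" by auto
  define Y where "Y i = (if X i \<inter> A = {} then {} else X i)" for i
  define Z where "Z i = (if X i \<inter> A = {} then X i else {})" for i
  \<comment> \<open>A covering set that meets \<open>A\<close> is too small to reach \<open>B\<close>.\<close>
  have far: "X i \<inter> B = {}" if "X i \<inter> A \<noteq> {}" for i
  proof (rule ccontr)
    assume "X i \<inter> B \<noteq> {}"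
    with that obtain a b where ab: "a \<in> X i" "a \<in> A" "b \<in> X i" "b \<in> B" by auto
    have "dist a b \<le> diameter (X i)" using diameter_bounded_bound[OF X(1)] ab by auto
    with X(2)[of i] sep[OF ab(2,4)] \<open>\<delta> < e\<close> show False by linarith
  qed
  have "A \<subseteq> (\<Union>i. Y i)" using X(3) by (fastforce simp: Y_def)
  moreover have "B \<subseteq> (\<Union>i. Z i)"
  proof
    fix b assume b: "b \<in> B"
    then obtain i where i: "b \<in> X i" using X(3) by auto
    with far[of i] b have "X i \<inter> A = {}" by auto
    with i show "b \<in> (\<Union>i. Z i)" by (auto simp: Z_def)
  qed
  moreover have "bounded (Y i)" "bounded (Z i)" "diameter (Y i) \<le> \<delta>" "diameter (Z i) \<le> \<delta>" for i
    using X(1,2)[of i] diameter_ge_0[OF X(1), of i] by (auto simp: Y_def Z_def)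
  ultimately have "hausdorff_content d \<delta> A + hausdorff_content d \<delta> B
      \<le> (\<Sum>i. hausdorff_weight d (Y i)) + (\<Sum>i. hausdorff_weight d (Z i))"
    unfolding hausdorff_content_def by (intro add_mono INF_lower) auto
  also have "\<dots> = (\<Sum>i. hausdorff_weight d (Y i) + hausdorff_weight d (Z i))"
    by (intro suminf_add summableI)
  also have "\<dots> = (\<Sum>i. hausdorff_weight d (X i))"
    by (intro suminf_cong) (auto simp: Y_def Z_def hausdorff_weight_def)
  finally show "hausdorff_content d \<delta> A + hausdorff_content d \<delta> B \<le> (\<Sum>i. hausdorff_weight d (X i))" .
qed

lemma hausdorff_outer_separated:
  assumes "0 < e" and sep: "\<And>a b. a \<in> A \<Longrightarrow> b \<in> B \<Longrightarrow> e \<le> dist a b"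
  shows "hausdorff_outer d A + hausdorff_outer d B \<le> hausdorff_outer d (A \<union> B)"
proof -
  have *: "hausdorff_content d \<delta>1 A + hausdorff_content d \<delta>2 B \<le> hausdorff_outer d (A \<union> B)"
    if "0 < \<delta>1" "0 < \<delta>2" for \<delta>1 \<delta>2
  proof -
    define \<delta> where "\<delta> = min (min \<delta>1 \<delta>2) (e / 2)"
    have \<delta>: "0 < \<delta>" "\<delta> \<le> \<delta>1" "\<delta> \<le> \<delta>2" "\<delta> < e" using that \<open>0 < e\<close> by (auto simp: \<delta>_def)
    have "hausdorff_content d \<delta>1 A + hausdorff_content d \<delta>2 B
        \<le> hausdorff_content d \<delta> A + hausdorff_content d \<delta> B"
      by (intro add_mono hausdorff_content_antimono \<delta>)
    also have "\<dots> \<le> hausdorff_content d \<delta> (A \<union> B)"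
      by (rule hausdorff_content_separated[OF \<delta>(4) sep])
    also have "\<dots> \<le> hausdorff_outer d (A \<union> B)"
      unfolding hausdorff_outer_def by (rule SUP_upper) (use \<delta> in auto)
    finally show ?thesis .
  qed
  have "hausdorff_outer d A + hausdorff_content d \<delta>2 B \<le> hausdorff_outer d (A \<union> B)"
    if "0 < \<delta>2" for \<delta>2
    unfolding hausdorff_outer_def[of d A]
    by (subst ennreal_SUP_add_left[symmetric]) (use * that in \<open>auto intro!: SUP_least\<close>)
  then have "(SUP \<delta>\<in>{0<..}. hausdorff_outer d A + hausdorff_content d \<delta> B) \<le> hausdorff_outer d (A \<union> B)"
    by (auto intro!: SUP_least)
  then show ?thesis
    unfolding hausdorff_outer_def[of d B]
    using ennreal_SUP_add_right[of "{0<..} :: real set" "hausdorff_outer d A" "\<lambda>\<delta>. hausdorff_content d \<delta> B"]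
    by auto
qed

lemma outer_measure_space_Un:
  assumes m: "outer_measure_space UNIV m" shows "m (A \<union> B) \<le> m A + m B"
proof -
  have mono: "A \<subseteq> B \<Longrightarrow> m A \<le> m B" for A B
    using m by (auto simp: outer_measure_space_def increasing_def)
  have m0: "m {} = 0" using m by (auto simp: outer_measure_space_def positive_def)
  have sub: "m (\<Union>i. X i) \<le> (\<Sum>i. m (X i))" if "disjoint_family X" for X :: "nat \<Rightarrow> 'a set"
    using m that by (auto simp: outer_measure_space_def countably_subadditive_def)
  let ?X = "\<lambda>i::nat. if i = 0 then A else if i = Suc 0 then B - A else {}"
  have "m (A \<union> B) \<le> (\<Sum>i. m (?X i))"
    by (rule order_trans[OF mono sub]) (auto simp: disjoint_family_on_def split: if_splits)
  also have "\<dots> = (\<Sum>i\<in>{0, Suc 0}. m (?X i))"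
    by (rule suminf_finite) (auto simp: m0)
  also have "\<dots> \<le> m A + m B" using mono[of "B - A" B] by (auto intro: add_left_mono)
  finally show ?thesis .
qed

text \<open>Caratheodory's criterion for metric outer measures. The part of \<open>A\<close> outside \<open>F\<close> is exhausted
  by the sets \<open>I k\<close> of points at distance at least \<open>1 / (k + 1)\<close> from \<open>F\<close>, which are
  separated from \<open>F\<close>. What is missing is a tail of the shells \<open>D j\<close>. Shells whose indices
  differ by two are separated from each other, so the measures of the shells have a finite sum
  and the tail is small.\<close>

lemma closed_in_lambda_system:
  fixes m :: "'a::metric_space set \<Rightarrow> ennreal"
  assumes m: "outer_measure_space UNIV m"
    and sep: "\<And>e A B. 0 < e \<Longrightarrow> (\<And>a b. a \<in> A \<Longrightarrow> b \<in> B \<Longrightarrow> e \<le> dist a b)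
                \<Longrightarrow> m A + m B \<le> m (A \<union> B)"
    and F: "closed F"
  shows "F \<in> lambda_system UNIV UNIV m"
proof (cases "F = {}")
  case True
  then show ?thesis using m by (auto simp: lambda_system_def outer_measure_space_def positive_def)
next
  case False
  have mono: "A \<subseteq> B \<Longrightarrow> m A \<le> m B" for A B
    using m by (auto simp: outer_measure_space_def increasing_def)
  have m0: "m {} = 0" using m by (auto simp: outer_measure_space_def positive_def)
  have sub: "m (\<Union>i. A i) \<le> (\<Sum>i. m (A i))" if "disjoint_family A" for A :: "nat \<Rightarrow> 'a set"
    using m that by (auto simp: outer_measure_space_def countably_subadditive_def)
  note sub2 = outer_measure_space_Un[OF m]
  have main: "m (F \<inter> A) + m (A - F) \<le> m A" for A
  proof (cases "m A = \<infinity>")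
    case True then show ?thesis by simp
  next
    case fin: False
    define g where "g x = infdist x F" for x
    define I where "I k = {x\<in>A. 1 / (real k + 1) \<le> g x}" for k
    define D where "D k = {x\<in>A. 1 / (real k + 2) \<le> g x \<and> g x < 1 / (real k + 1)}" for k
    have gpos: "g x > 0" if "x \<notin> F" for x
      using infdist_pos_not_in_closed[OF F False that] by (simp add: g_def)
    have gzero: "g x = 0" if "x \<in> F" for x using that by (simp add: g_def)
    have gdist: "g x - g y \<le> dist x y" for x y
      using infdist_triangle[of x F y] by (simp add: g_def)
    have *: "m (F \<inter> A) + m (I k) \<le> m A" for k
    proof -
      have "m (F \<inter> A) + m (I k) \<le> m ((F \<inter> A) \<union> I k)"
      proof (rule sep)
        fix a b assume "a \<in> F \<inter> A" "b \<in> I k"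
        with gdist[of b a] gzero[of a] show "1 / (real k + 1) \<le> dist a b"
          by (simp add: I_def dist_commute)
      qed simp
      also have "\<dots> \<le> m A" by (rule mono) (auto simp: I_def)
      finally show ?thesis .
    qed
    have cover: "A - F \<subseteq> I k \<union> (\<Union>j. D (j + k))" for k
    proof
      fix x assume x: "x \<in> A - F"
      show "x \<in> I k \<union> (\<Union>j. D (j + k))"
      proof (cases "1 / (real k + 1) \<le> g x")
        case True then show ?thesis using x by (auto simp: I_def)
      next
        case far: False
        define P where "P l \<longleftrightarrow> 1 / (real l + 1) \<le> g x" for l :: nat
        obtain l0 where "inverse (real (Suc l0)) < g x"
          using reals_Archimedean[of "g x"] gpos x by auto
        then have "P l0" by (simp add: P_def field_simps)
        define l where "l = (LEAST l. P l)"
        have l: "P l" unfolding l_def using \<open>P l0\<close> by (rule LeastI)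
        have lk: "l > k"
        proof (rule ccontr)
          assume "\<not> k < l"
          then have "1 / (real k + 1) \<le> 1 / (real l + 1)" by (intro divide_left_mono) auto
          with l far show False by (simp add: P_def)
        qed
        then obtain j where j: "l = Suc (j + k)" using less_imp_Suc_add by (metis add.commute)
        have "\<not> P (j + k)" unfolding l_def using j not_less_Least[of "j+k" P] l_def by auto
        with l j x have "x \<in> D (j + k)" by (simp add: D_def P_def add.assoc add.commute)
        then show ?thesis by blast
      qed
    qed
    have disjD: "disjoint_family D"
    proof -
      have "D i \<inter> D j = {}" if "i < j" for i j
      proof -
        have "1 / (real j + 1) \<le> 1 / (real i + 2)" using that by (intro divide_left_mono) auto
        then show ?thesis by (force simp: D_def)
      qed
      then show ?thesis unfolding disjoint_family_on_def by (metis Int_commute linorder_neqE_nat)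
    qed
    have sepD: "(\<Sum>j<N. m (D (2 * j + r))) \<le> m (\<Union>j<N. D (2 * j + r))" for N r
    proof (induction N)
      case 0 show ?case by (simp add: m0)
    next
      case (Suc N)
      let ?s = "real (2 * N + r)"
      \<comment> \<open>For \<open>N = 0\<close> the union is empty and any positive distance will do.\<close>
      define e where "e = (if N > 0 then 1 / ?s - 1 / (?s + 1) else 1)"
      have "1 / (?s + 1) < 1 / ?s" if "N > 0"
        using that by (intro divide_strict_left_mono) auto
      then have e: "e > 0" by (auto simp: e_def)
      have sep': "e \<le> dist a b" if a: "a \<in> (\<Union>j<N. D (2 * j + r))" and b: "b \<in> D (2 * N + r)" for a b
      proof -
        from a obtain j where j: "j < N" "a \<in> D (2 * j + r)" by auto
        have "1 / ?s \<le> 1 / (real (2 * j + r) + 2)"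
          using j(1) by (intro divide_left_mono) auto
        with j(2) have "1 / ?s \<le> g a" by (auto simp: D_def)
        moreover have "g b < 1 / (?s + 1)" using b by (auto simp: D_def)
        ultimately show ?thesis using gdist[of a b] j(1) by (auto simp: e_def)
      qed
      have "(\<Sum>j<Suc N. m (D (2 * j + r))) \<le> m (\<Union>j<N. D (2 * j + r)) + m (D (2 * N + r))"
        using Suc by (simp add: add_right_mono)
      also have "\<dots> \<le> m ((\<Union>j<N. D (2 * j + r)) \<union> D (2 * N + r))"
        by (rule sep[OF e sep'])
      also have "(\<Union>j<N. D (2 * j + r)) \<union> D (2 * N + r) = (\<Union>j<Suc N. D (2 * j + r))"
        by (auto simp: lessThan_Suc)
      finally show ?case .
    qed
    \<comment> \<open>With \<open>r = 0\<close> and \<open>r = 1\<close> this bounds the sums over the even and the odd shells.\<close>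
    have half: "(\<Sum>j. m (D (2 * j + r))) \<le> m A" for r
    proof (rule suminf_le_const[OF summableI])
      fix N
      have "(\<Sum>j<N. m (D (2 * j + r))) \<le> m (\<Union>j<N. D (2 * j + r))" by (rule sepD)
      also have "\<dots> \<le> m A" by (rule mono) (auto simp: D_def)
      finally show "(\<Sum>j<N. m (D (2 * j + r))) \<le> m A" .
    qed
    have sumle: "(\<Sum>j. m (D j)) \<le> m A + m A"
    proof (rule suminf_le_const[OF summableI])
      fix N
      have "(\<Sum>j<N. m (D j)) \<le> (\<Sum>j<2*N. m (D j))" by (intro sum_mono2) auto
      also have "\<dots> = (\<Sum>j<N. m (D (2 * j)) + m (D (2 * j + 1)))"
        by (induction N) (auto simp: add.assoc)
      also have "\<dots> = (\<Sum>j<N. m (D (2 * j + 0))) + (\<Sum>j<N. m (D (2 * j + 1)))"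
        by (simp add: sum.distrib)
      also have "\<dots> \<le> (\<Sum>j. m (D (2 * j + 0))) + (\<Sum>j. m (D (2 * j + 1)))"
        by (intro add_mono sum_le_suminf summableI) auto
      also have "\<dots> \<le> m A + m A" by (intro add_mono half)
      finally show "(\<Sum>j<N. m (D j)) \<le> m A + m A" .
    qed
    show ?thesis
    proof (rule ennreal_le_epsilon)
      fix \<epsilon> :: real assume \<epsilon>: "0 < \<epsilon>"
      have T: "(\<Sum>j. m (D j)) \<noteq> top"
        using sumle fin by (auto simp: top_unique)
      have "\<exists>k. (\<Sum>j. m (D j)) \<le> (\<Sum>j<k. m (D j)) + ennreal \<epsilon>"
      proof (cases "(\<Sum>j. m (D j)) = 0")
        case False
        have "(\<Sum>j. m (D j)) - ennreal \<epsilon> < (\<Sum>j. m (D j))"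
          using T False \<epsilon> by (intro ennreal_between) (auto simp: zero_less_iff_neq_zero less_top)
        then have "(\<Sum>j. m (D j)) - ennreal \<epsilon> < (SUP k. \<Sum>j<k. m (D j))"
          by (simp add: suminf_eq_SUP)
        then obtain k where "(\<Sum>j. m (D j)) - ennreal \<epsilon> < (\<Sum>j<k. m (D j))"
          by (auto simp: less_SUP_iff)
        then show ?thesis
          by (intro exI[of _ k]) (metis T add.commute ennreal_minus_le_iff less_imp_le)
      qed auto
      then obtain k where k: "(\<Sum>j. m (D j)) \<le> (\<Sum>j<k. m (D j)) + ennreal \<epsilon>" by blast
      have "(\<Sum>j. m (D j)) = (\<Sum>j. m (D (j + k))) + (\<Sum>j<k. m (D j))"
        by (rule suminf_offset[OF summableI])
      with k have "(\<Sum>j<k. m (D j)) + (\<Sum>j. m (D (j + k))) \<le> (\<Sum>j<k. m (D j)) + ennreal \<epsilon>"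
        by (simp add: add.commute)
      moreover have "(\<Sum>j<k. m (D j)) \<noteq> top"
        by (rule neq_top_trans[OF T sum_le_suminf[OF summableI]]) auto
      ultimately have tail: "(\<Sum>j. m (D (j + k))) \<le> ennreal \<epsilon>"
        by (simp add: ennreal_add_left_cancel_le)
      have "disjoint_family (\<lambda>j. D (j + k))" using disjD by (auto simp: disjoint_family_on_def)
      then have "m (F \<inter> A) + m (A - F) \<le> m (F \<inter> A) + (m (I k) + (\<Sum>j. m (D (j + k))))"
        by (intro add_left_mono order_trans[OF mono[OF cover[of k]]] order_trans[OF sub2] sub)
      also have "\<dots> \<le> m A + ennreal \<epsilon>"
        using add_mono[OF *[of k] tail] by (simp add: add.assoc)
      finally show "m (F \<inter> A) + m (A - F) \<le> m A + ennreal \<epsilon>" .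
    qed
  qed
  show ?thesis
    unfolding lambda_system_def
  proof (safe intro!: CollectI)
    fix A
    have "m A \<le> m (F \<inter> A) + m (A - F)"
      by (rule order_trans[OF mono sub2]) auto
    with main[of A] have "m (F \<inter> A) + m (A - F) = m A" by (rule antisym)
    moreover have "(UNIV - F) \<inter> A = A - F" by auto
    ultimately show "m (F \<inter> A) + m ((UNIV - F) \<inter> A) = m A" by simp
  qed simp
qed

lemma space_hausdorff_measure [simp]: "space (hausdorff_measure d) = UNIV"
  unfolding hausdorff_measure_def by simp

lemma borel_sets_hausdorff_measure: "sets borel \<subseteq> sets (hausdorff_measure d)"
proof -
  have "F \<in> sets (hausdorff_measure d)" if "closed F" for F :: "'a set"
    unfolding sets_hausdorff_measure
    by (rule closed_in_lambda_system[OF outer_measure_space_hausdorff_outer _ that])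
      (rule hausdorff_outer_separated)
  then show ?thesis
    unfolding borel_eq_closed
    using sets.sigma_sets_subset[of "Collect closed" "hausdorff_measure d"]
    by (auto simp: sets_measure_of)
qed

text \<open>Completeness: the measure is defined on all sets measurable in the sense of Caratheodory.\<close>

lemma hausdorff_outer_null_sets:
  assumes "hausdorff_outer d A = 0" shows "A \<in> null_sets (hausdorff_measure d)"
proof -
  have "A \<in> lambda_system UNIV UNIV (hausdorff_outer d)"
    unfolding lambda_system_def
  proof (safe intro!: CollectI)
    fix B
    have A0: "hausdorff_outer d (A \<inter> B) = 0"
      using hausdorff_outer_le[of "A \<inter> B" A d] assms by auto
    have "hausdorff_outer d B \<le> hausdorff_outer d (A \<union> ((UNIV - A) \<inter> B))"
      by (rule hausdorff_outer_le) auto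
    also have "\<dots> \<le> hausdorff_outer d A + hausdorff_outer d ((UNIV - A) \<inter> B)"
      by (rule outer_measure_space_Un[OF outer_measure_space_hausdorff_outer])
    finally have "hausdorff_outer d B \<le> hausdorff_outer d ((UNIV - A) \<inter> B)" using assms by simp
    moreover have "hausdorff_outer d ((UNIV - A) \<inter> B) \<le> hausdorff_outer d B"
      by (rule hausdorff_outer_le) auto
    ultimately show "hausdorff_outer d (A \<inter> B) + hausdorff_outer d ((UNIV - A) \<inter> B) = hausdorff_outer d B"
      using A0 by auto
  qed simp
  then have "A \<in> sets (hausdorff_measure d)" by (simp add: sets_hausdorff_measure)
  then show ?thesis using assms by (auto simp: emeasure_hausdorff_measure)
qed

lemma hausdorff_outer_nonexpansive_image:
  fixes T :: "'a::metric_space \<Rightarrow> 'b::metric_space"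
  assumes T: "\<And>x y. dist (T x) (T y) \<le> dist x y"
  shows "hausdorff_outer d (T ` A) \<le> hausdorff_outer d A"
proof -
  have diam: "bounded (T ` X) \<and> diameter (T ` X) \<le> diameter X" if X: "bounded X" for X
  proof
    have "dist x y \<le> diameter X" if "x \<in> T ` X" "y \<in> T ` X" for x y
    proof -
      from that obtain x' y' where "x' \<in> X" "y' \<in> X" "x = T x'" "y = T y'" by auto
      then show ?thesis using diameter_bounded_bound[OF X] T order_trans by metis
    qed
    note * = this
    show "bounded (T ` X)" unfolding bounded_two_points using * by blast
    show "diameter (T ` X) \<le> diameter X"
      unfolding diameter_def[of "T ` X"] using diameter_ge_0[OF X] *
      by (auto intro!: cSUP_least)
  qed
  have w: "hausdorff_weight d (T ` X) \<le> hausdorff_weight d X" if "bounded X" for X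
    using diam[OF that] that
    by (auto simp: hausdorff_weight_def diameter_ge_0
        intro!: ennreal_leI mult_left_mono power_mono divide_right_mono)
  have "hausdorff_content d \<delta> (T ` A) \<le> hausdorff_content d \<delta> A" for \<delta>
    unfolding hausdorff_content_def[of d \<delta> A]
  proof (rule INF_greatest)
    fix X :: "nat \<Rightarrow> 'a set"
    assume "X \<in> {X. (\<forall>i. bounded (X i) \<and> diameter (X i) \<le> \<delta>) \<and> A \<subseteq> (\<Union>i. X i)}"
    then have X: "\<And>i. bounded (X i)" "\<And>i. diameter (X i) \<le> \<delta>" "A \<subseteq> (\<Union>i. X i)" by auto
    have "hausdorff_content d \<delta> (T ` A) \<le> (\<Sum>i. hausdorff_weight d (T ` X i))"
      unfolding hausdorff_content_def
    proof (rule INF_lower, intro CollectI conjI allI)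
      fix i show "bounded (T ` X i)" using diam[OF X(1)] by blast
      show "diameter (T ` X i) \<le> \<delta>" using diam[OF X(1)] X(2) order_trans by blast
    next
      show "T ` A \<subseteq> (\<Union>i. T ` X i)" using image_mono[OF X(3), of T] by (simp only: image_UN)
    qed
    also have "\<dots> \<le> (\<Sum>i. hausdorff_weight d (X i))"
      by (intro suminf_le w X summableI)
    finally show "hausdorff_content d \<delta> (T ` A) \<le> (\<Sum>i. hausdorff_weight d (X i))" .
  qed
  then show ?thesis unfolding hausdorff_outer_def by (rule SUP_mono')
qed

text \<open>An orthogonal map and its inverse are both nonexpansive.\<close>

lemma hausdorff_outer_orthogonal_image:
  fixes T :: "'a::euclidean_space \<Rightarrow> 'a"
  assumes T: "orthogonal_transformation T"
  shows "hausdorff_outer d (T ` A) = hausdorff_outer d A"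
proof (rule antisym)
  have iso: "dist (S x) (S y) \<le> dist x y" if "orthogonal_transformation S" for S :: "'a \<Rightarrow> 'a" and x y
    using that by (simp add: dist_norm orthogonal_transformation flip: linear_diff)
  show "hausdorff_outer d (T ` A) \<le> hausdorff_outer d A"
    by (rule hausdorff_outer_nonexpansive_image[OF iso[OF T]])
  have "A = inv T ` (T ` A)"
    using orthogonal_transformation_inj[OF T] by (simp add: image_comp)
  then show "hausdorff_outer d A \<le> hausdorff_outer d (T ` A)"
    using hausdorff_outer_nonexpansive_image[OF iso[OF orthogonal_transformation_inv[OF T]], of d "T ` A"]
    by simp
qed

section \<open>Gauges of Wulff shapes\<close>

definition positive_on_sphere :: "(real ^ 'n \<Rightarrow> real) \<Rightarrow> bool" where
  "positive_on_sphere f \<longleftrightarrow> continuous_on (sphere 0 1) f \<and> (\<forall>v\<in>sphere 0 1. 0 < f v)"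

text \<open>The Minkowski gauge of the Wulff shape of \<open>f\<close>, that is, the reciprocal of its radial
  function. Being a supremum of linear functions of \<open>u\<close>, it is convex, and \<open>v / f v\<close> is a
  subgradient at \<open>u\<close> whenever \<open>v\<close> attains the supremum.\<close>

definition wulff_gauge :: "(real ^ 'n \<Rightarrow> real) \<Rightarrow> real ^ 'n \<Rightarrow> real" where
  "wulff_gauge f u = (SUP v\<in>sphere 0 1. (u \<bullet> v) / f v)"

definition wulff_shape :: "(real ^ 'n \<Rightarrow> real) \<Rightarrow> (real ^ 'n) set" where
  "wulff_shape f = {x. \<forall>v\<in>sphere 0 1. x \<bullet> v \<le> f v}"

text \<open>The vectors that attain the supremum in the gauge. The product form avoids divisions in
  later computations.\<close>

definition contact_normals :: "(real ^ 'n \<Rightarrow> real) \<Rightarrow> real ^ 'n \<Rightarrow> (real ^ 'n) set" where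
  "contact_normals f u = {v\<in>sphere 0 1. u \<bullet> v = wulff_gauge f u * f v}"

lemma sphere_nonempty [simp]: "sphere (0 :: real ^ 'n) 1 \<noteq> {}"
  by simp

lemma abs_inner_unit_le:
  assumes "v \<in> sphere 0 1" shows "\<bar>x \<bullet> v\<bar> \<le> norm x"
  using Cauchy_Schwarz_ineq2[of x v] assms by simp

lemma inner_unit_le:
  assumes "v \<in> sphere 0 1" shows "x \<bullet> v \<le> norm x"
  using abs_inner_unit_le[OF assms, of x] by linarith

lemma positive_on_sphereD:
  assumes "positive_on_sphere f"
  shows "continuous_on (sphere 0 1) f" "v \<in> sphere 0 1 \<Longrightarrow> 0 < f v"
  using assms by (auto simp: positive_on_sphere_def)

lemma positive_on_sphere_bounds:
  fixes f :: "real ^ 'n \<Rightarrow> real"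
  assumes f: "positive_on_sphere f"
  obtains a b where "0 < a" "a \<le> b" "\<And>v. v \<in> sphere 0 1 \<Longrightarrow> a \<le> f v" "\<And>v. v \<in> sphere 0 1 \<Longrightarrow> f v \<le> b"
proof -
  note c = positive_on_sphereD(1)[OF f]
  obtain v1 where v1: "v1 \<in> sphere 0 1" "\<And>v. v \<in> sphere 0 1 \<Longrightarrow> f v1 \<le> f v"
    using continuous_attains_inf[OF compact_sphere sphere_nonempty c] by auto
  obtain v2 where v2: "v2 \<in> sphere 0 1" "\<And>v. v \<in> sphere 0 1 \<Longrightarrow> f v \<le> f v2"
    using continuous_attains_sup[OF compact_sphere sphere_nonempty c] by auto
  show thesis using that[of "f v1" "f v2"] v1 v2 positive_on_sphereD(2)[OF f] by auto
qed

lemma wulff_gauge_attained: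
  assumes f: "positive_on_sphere f"
  shows "\<exists>v\<in>sphere 0 1. u \<bullet> v = wulff_gauge f u * f v"
    and "v \<in> sphere 0 1 \<Longrightarrow> u \<bullet> v \<le> wulff_gauge f u * f v"
proof -
  have "continuous_on (sphere 0 1) (\<lambda>v. (u \<bullet> v) / f v)"
    using positive_on_sphereD[OF f] by (intro continuous_intros) force+
  then obtain w where w: "w \<in> sphere 0 1" "\<And>v. v \<in> sphere 0 1 \<Longrightarrow> (u \<bullet> v) / f v \<le> (u \<bullet> w) / f w"
    using continuous_attains_sup[OF compact_sphere sphere_nonempty] by blast
  have eq: "wulff_gauge f u = (u \<bullet> w) / f w"
    unfolding wulff_gauge_def using w by (intro cSup_eq_maximum) auto
  have "0 < f v" if "v \<in> sphere 0 1" for v using positive_on_sphereD(2)[OF f that] .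
  then show "\<exists>v\<in>sphere 0 1. u \<bullet> v = wulff_gauge f u * f v"
    using w(1) eq by (intro bexI[of _ w]) (auto simp: less_le)
  show "u \<bullet> v \<le> wulff_gauge f u * f v" if "v \<in> sphere 0 1"
    using w(2)[OF that] positive_on_sphereD(2)[OF f that] eq by (simp add: pos_divide_le_eq)
qed

lemma contact_normals_nonempty:
  assumes "positive_on_sphere f" shows "contact_normals f u \<noteq> {}"
  using wulff_gauge_attained(1)[OF assms, of u] by (auto simp: contact_normals_def)

lemma wulff_gauge_bounds:
  fixes f :: "real ^ 'n \<Rightarrow> real"
  assumes f: "positive_on_sphere f" and u: "u \<in> sphere 0 1"
    and a: "0 < a" "\<And>v. v \<in> sphere 0 1 \<Longrightarrow> a \<le> f v" and b: "\<And>v. v \<in> sphere 0 1 \<Longrightarrow> f v \<le> b"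
  shows "1 / b \<le> wulff_gauge f u" "wulff_gauge f u \<le> 1 / a"
proof -
  have "0 < f u" using positive_on_sphereD(2)[OF f u] .
  then have "0 < b" using b[OF u] by linarith
  have "1 \<le> wulff_gauge f u * f u"
    using wulff_gauge_attained(2)[OF f u, of u] u by (simp add: dot_square_norm)
  moreover have pos: "0 < wulff_gauge f u"
    using zero_less_mult_pos2[OF _ \<open>0 < f u\<close>, of "wulff_gauge f u"] calculation by linarith
  ultimately have "1 \<le> wulff_gauge f u * b"
    using mult_left_mono[OF b[OF u], of "wulff_gauge f u"] by linarith
  then show "1 / b \<le> wulff_gauge f u" using \<open>0 < b\<close> by (simp add: pos_divide_le_eq)
  obtain v where v: "v \<in> sphere 0 1" "u \<bullet> v = wulff_gauge f u * f v"
    using wulff_gauge_attained(1)[OF f] by blast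
  have "wulff_gauge f u * a \<le> wulff_gauge f u * f v"
    using pos a(2)[OF v(1)] by (intro mult_left_mono) auto
  also have "\<dots> \<le> 1" using inner_unit_le[OF v(1), of u] u v(2) by simp
  finally show "wulff_gauge f u \<le> 1 / a" using \<open>0 < a\<close> by (simp add: pos_le_divide_eq)
qed

lemma wulff_gauge_pos:
  assumes f: "positive_on_sphere f" and u: "u \<in> sphere 0 1"
  shows "0 < wulff_gauge f u"
proof -
  obtain a b where "0 < a" "a \<le> b" "\<And>v. v \<in> sphere 0 1 \<Longrightarrow> a \<le> f v" "\<And>v. v \<in> sphere 0 1 \<Longrightarrow> f v \<le> b"
    using positive_on_sphere_bounds[OF f] by metis
  note ab = this
  have "1 / b \<le> wulff_gauge f u" by (rule wulff_gauge_bounds(1)[OF f u ab(1,3,4)])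
  with ab(1,2) show ?thesis
    using less_le_trans[of 0 "1 / b" "wulff_gauge f u"] by fastforce
qed

text \<open>The comparison principle behind all estimates of the gauge: a vector that attains the
  supremum for \<open>g\<close> is a competitor for \<open>f\<close>.\<close>

lemma wulff_gauge_mono:
  assumes f: "positive_on_sphere f" and g: "positive_on_sphere g"
    and u: "u \<in> sphere 0 1" and le: "\<And>v. v \<in> sphere 0 1 \<Longrightarrow> f v \<le> c * g v"
  shows "wulff_gauge g u \<le> c * wulff_gauge f u"
proof -
  obtain v where v: "v \<in> sphere 0 1" "u \<bullet> v = wulff_gauge g u * g v"
    using wulff_gauge_attained(1)[OF g] by blast
  have "wulff_gauge g u * g v \<le> wulff_gauge f u * f v"
    using wulff_gauge_attained(2)[OF f v(1), of u] v(2) by simp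
  also have "\<dots> \<le> wulff_gauge f u * (c * g v)"
    using wulff_gauge_pos[OF f u] le[OF v(1)] by (intro mult_left_mono) auto
  also have "\<dots> = (c * wulff_gauge f u) * g v" by simp
  finally show ?thesis using positive_on_sphereD(2)[OF g v(1)] by (simp add: mult_le_cancel_right)
qed

lemma wulff_gauge_lipschitz:
  assumes f: "positive_on_sphere f" and a: "0 < a" "\<And>v. v \<in> sphere 0 1 \<Longrightarrow> a \<le> f v"
  shows "\<bar>wulff_gauge f u - wulff_gauge f u'\<bar> \<le> norm (u - u') / a"
proof -
  have *: "wulff_gauge f u - wulff_gauge f u' \<le> norm (u - u') / a" for u u'
  proof -
    obtain v where v: "v \<in> sphere 0 1" "u \<bullet> v = wulff_gauge f u * f v"
      using wulff_gauge_attained(1)[OF f] by blast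
    have "(wulff_gauge f u - wulff_gauge f u') * f v \<le> (u - u') \<bullet> v"
      using wulff_gauge_attained(2)[OF f v(1), of u'] v(2) by (simp add: algebra_simps)
    also have "\<dots> \<le> norm (u - u')" by (rule inner_unit_le[OF v(1)])
    finally have "wulff_gauge f u - wulff_gauge f u' \<le> norm (u - u') / f v"
      using positive_on_sphereD(2)[OF f v(1)] by (simp add: pos_le_divide_eq)
    also have "\<dots> \<le> norm (u - u') / a" using a v(1) by (intro divide_left_mono) (auto intro!: mult_pos_pos positive_on_sphereD(2)[OF f])
    finally show ?thesis .
  qed
  show ?thesis using *[of u u'] *[of u' u] by (simp add: norm_minus_commute abs_le_iff)
qed

lemma continuous_on_wulff_gauge:
  assumes f: "positive_on_sphere f" shows "continuous_on S (wulff_gauge f)"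
proof -
  obtain a b where ab: "0 < a" "\<And>v. v \<in> sphere 0 1 \<Longrightarrow> a \<le> f v"
    using positive_on_sphere_bounds[OF f] by metis
  have "(1/a)-lipschitz_on S (wulff_gauge f)"
    using wulff_gauge_lipschitz[OF f ab] \<open>0 < a\<close>
    by (intro lipschitz_onI) (auto simp: dist_norm)
  then show ?thesis by (rule lipschitz_on_continuous_on)
qed

lemma mem_wulff_shape_ray:
  assumes f: "positive_on_sphere f" and l: "0 \<le> l"
  shows "l *\<^sub>R u \<in> wulff_shape f \<longleftrightarrow> l * wulff_gauge f u \<le> 1"
proof
  assume H: "l *\<^sub>R u \<in> wulff_shape f"
  obtain v where v: "v \<in> sphere 0 1" "u \<bullet> v = wulff_gauge f u * f v"
    using wulff_gauge_attained(1)[OF f] by blast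
  have "l * (u \<bullet> v) \<le> f v" using H v(1) by (simp add: wulff_shape_def)
  then have "l * wulff_gauge f u * f v \<le> 1 * f v" using v(2) by (simp add: mult.assoc)
  then show "l * wulff_gauge f u \<le> 1" using positive_on_sphereD(2)[OF f v(1)] by (simp only: mult_le_cancel_right_pos)
next
  assume *: "l * wulff_gauge f u \<le> 1"
  show "l *\<^sub>R u \<in> wulff_shape f"
    unfolding wulff_shape_def
  proof (intro CollectI ballI)
    fix v :: "real ^ 'a" assume v: "v \<in> sphere 0 1"
    have "l *\<^sub>R u \<bullet> v \<le> l * (wulff_gauge f u * f v)"
      using wulff_gauge_attained(2)[OF f v, of u] l by (auto intro: mult_left_mono)
    also have "\<dots> \<le> 1 * f v"
      using * positive_on_sphereD(2)[OF f v] by (simp only: mult.assoc[symmetric]) (intro mult_right_mono; simp)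
    finally show "l *\<^sub>R u \<bullet> v \<le> f v" by simp
  qed
qed

lemma radial_function_wulff_shape:
  assumes f: "positive_on_sphere f" and u: "u \<in> sphere 0 1"
  shows "radial_function (wulff_shape f) u = 1 / wulff_gauge f u"
  unfolding radial_function_def
  using wulff_gauge_pos[OF f u] mem_wulff_shape_ray[OF f, of _ u]
  by (intro cSup_eq_maximum) (auto simp: field_simps)

lemma wulff_shape_convex_body:
  assumes f: "positive_on_sphere f" shows "wulff_shape f \<in> convex_bodies_o"
proof -
  obtain a b where ab: "0 < a" "\<And>v. v \<in> sphere 0 1 \<Longrightarrow> a \<le> f v" "\<And>v. v \<in> sphere 0 1 \<Longrightarrow> f v \<le> b"
    using positive_on_sphere_bounds[OF f] by metis
  have eq: "wulff_shape f = (\<Inter>v\<in>sphere 0 1. {x. v \<bullet> x \<le> f v})"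
    by (auto simp: wulff_shape_def inner_commute)
  have "closed (wulff_shape f)" unfolding eq by (intro closed_INT ballI closed_halfspace_le)
  moreover have "wulff_shape f \<subseteq> cball 0 b"
  proof
    fix x assume x: "x \<in> wulff_shape f"
    show "x \<in> cball 0 b"
    proof (cases "x = 0")
      case True
      obtain v :: "real ^ 'a" where "v \<in> sphere 0 1" using sphere_nonempty by blast
      with ab(1) ab(2)[of v] ab(3)[of v] True show ?thesis by simp
    next
      case False
      then have v: "(1 / norm x) *\<^sub>R x \<in> sphere 0 1" by simp
      have "x \<bullet> ((1 / norm x) *\<^sub>R x) \<le> f ((1 / norm x) *\<^sub>R x)"
        using x v unfolding wulff_shape_def by blast
      with ab(3)[OF v] have "x \<bullet> ((1 / norm x) *\<^sub>R x) \<le> b" by linarith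
      then show ?thesis using False by (simp add: dot_square_norm power2_eq_square)
    qed
  qed
  then have "bounded (wulff_shape f)" using bounded_subset bounded_cball by blast
  moreover have "convex (wulff_shape f)" unfolding eq by (intro convex_INT convex_halfspace_le)
  moreover have "ball 0 a \<subseteq> wulff_shape f"
  proof
    fix x :: "real ^ 'a" assume "x \<in> ball 0 a"
    then have "x \<bullet> v \<le> f v" if "v \<in> sphere 0 1" for v
      using inner_unit_le[OF that, of x] ab(2)[OF that] by auto
    then show "x \<in> wulff_shape f" by (simp add: wulff_shape_def)
  qed
  then have "0 \<in> interior (wulff_shape f)" using \<open>0 < a\<close> by (intro interiorI[of "ball 0 a"]) auto
  ultimately show ?thesis by (simp add: convex_bodies_o_def compact_eq_bounded_closed)
qed

lemma inner_le_support_function: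
  assumes "compact K" "x \<in> K" shows "v \<bullet> x \<le> support_function K v"
proof -
  have "bdd_above ((\<lambda>x. v \<bullet> x) ` K)"
    using assms(1) by (intro bounded_imp_bdd_above compact_imp_bounded compact_continuous_image continuous_intros)
  then show ?thesis unfolding support_function_def using assms(2) by (intro cSUP_upper)
qed

lemma support_function_le:
  assumes "K \<noteq> {}" "\<And>x. x \<in> K \<Longrightarrow> v \<bullet> x \<le> c" shows "support_function K v \<le> c"
  unfolding support_function_def using assms by (intro cSUP_least)

lemma convex_body_nonempty: "K \<in> convex_bodies_o \<Longrightarrow> K \<noteq> {}"
  using interior_subset by (fastforce simp: convex_bodies_o_def)

lemma support_function_wulff_shape_le:
  assumes f: "positive_on_sphere f" and v: "v \<in> sphere 0 1"
  shows "support_function (wulff_shape f) v \<le> f v"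
  using convex_body_nonempty[OF wulff_shape_convex_body[OF f]] v
  by (intro support_function_le) (auto simp: wulff_shape_def inner_commute)

lemma support_function_lipschitz:
  assumes K: "compact K" "K \<noteq> {}" "K \<subseteq> cball 0 R"
  shows "\<bar>support_function K u - support_function K v\<bar> \<le> R * norm (u - v)"
proof -
  have *: "support_function K u \<le> support_function K v + R * norm (u - v)" for u v
  proof (rule support_function_le[OF K(2)])
    fix x assume x: "x \<in> K"
    have "u \<bullet> x = v \<bullet> x + (u - v) \<bullet> x" by (simp add: inner_diff_left)
    also have "(u - v) \<bullet> x \<le> norm (u - v) * norm x" by (rule norm_cauchy_schwarz)
    also have "\<dots> \<le> norm (u - v) * R" using K(3) x by (intro mult_left_mono) auto
    finally show "u \<bullet> x \<le> support_function K v + R * norm (u - v)"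
      using inner_le_support_function[OF K(1) x, of v] by (simp add: mult.commute)
  qed
  show ?thesis using *[of u v] *[of v u] by (simp add: norm_minus_commute abs_le_iff)
qed

lemma positive_on_sphere_support_function:
  assumes K: "K \<in> convex_bodies_o" shows "positive_on_sphere (support_function K)"
proof -
  have cK: "compact K" and i: "0 \<in> interior K" using K by (auto simp: convex_bodies_o_def)
  obtain R where R: "K \<subseteq> cball 0 R"
    using compact_imp_bounded[OF cK] bounded_subset_ballD[of K 0] ball_subset_cball by blast
  have "0 \<le> R" using i R interior_subset by fastforce
  have "R-lipschitz_on (sphere 0 1) (support_function K)"
    using support_function_lipschitz[OF cK convex_body_nonempty[OF K] R] \<open>0 \<le> R\<close>
    by (intro lipschitz_onI) (auto simp: dist_norm)
  moreover obtain r where r: "0 < r" "cball 0 r \<subseteq> K"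
    using i by (meson mem_interior_cball)
  have "0 < support_function K v" if v: "v \<in> sphere 0 1" for v
  proof -
    have "r *\<^sub>R v \<in> K" using r v by (intro subsetD[OF r(2)]) auto
    then have "v \<bullet> (r *\<^sub>R v) \<le> support_function K v" by (rule inner_le_support_function[OF cK])
    with r(1) v show ?thesis by (simp add: dot_square_norm)
  qed
  ultimately show ?thesis by (auto simp: positive_on_sphere_def lipschitz_on_continuous_on)
qed

text \<open>A convex body is the intersection of its supporting halfspaces: a point outside is strictly
  separated from it by a hyperplane.\<close>

lemma wulff_shape_support_function:
  assumes K: "K \<in> convex_bodies_o" shows "wulff_shape (support_function K) = K"
proof
  have cK: "compact K" "convex K" using K by (auto simp: convex_bodies_o_def)
  show "K \<subseteq> wulff_shape (support_function K)"
    using inner_le_support_function[OF cK(1)] by (auto simp: wulff_shape_def inner_commute)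
  show "wulff_shape (support_function K) \<subseteq> K"
  proof
    fix x assume x: "x \<in> wulff_shape (support_function K)"
    show "x \<in> K"
    proof (rule ccontr)
      assume "x \<notin> K"
      then obtain a b where ab: "a \<bullet> x < b" "\<And>y. y \<in> K \<Longrightarrow> b < a \<bullet> y"
        using separating_hyperplane_closed_point[OF cK(2) compact_imp_closed[OF cK(1)]] by blast
      have "a \<noteq> 0" using ab convex_body_nonempty[OF K] by fastforce
      define v where "v = - (1 / norm a) *\<^sub>R a"
      have v: "v \<in> sphere 0 1" using \<open>a \<noteq> 0\<close> by (simp add: v_def)
      have "support_function K v \<le> - b / norm a"
        using ab(2) \<open>a \<noteq> 0\<close> convex_body_nonempty[OF K]
        by (intro support_function_le) (auto simp: v_def field_simps intro: less_imp_le)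
      also have "\<dots> < x \<bullet> v" using ab(1) \<open>a \<noteq> 0\<close> by (simp add: v_def field_simps inner_commute)
      also have "\<dots> \<le> support_function K v" using x v by (simp add: wulff_shape_def)
      finally show False by simp
    qed
  qed
qed

text \<open>Both functions have the same Wulff shape, and the gauge depends only on the Wulff shape.
  Together with \<open>support_function_wulff_shape_le\<close> this lets minimality among convex bodies be
  tested on arbitrary positive continuous functions.\<close>

lemma wulff_gauge_support_function_wulff_shape:
  assumes f: "positive_on_sphere f" and u: "u \<in> sphere 0 1"
  shows "wulff_gauge (support_function (wulff_shape f)) u = wulff_gauge f u"
proof -
  note K = wulff_shape_convex_body[OF f]
  note h = positive_on_sphere_support_function[OF K]
  have "1 / wulff_gauge (support_function (wulff_shape f)) u = 1 / wulff_gauge f u"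
    using radial_function_wulff_shape[OF h u] radial_function_wulff_shape[OF f u]
    by (simp add: wulff_shape_support_function[OF K])
  then show ?thesis by simp
qed

lemma radial_function_eq:
  assumes K: "K \<in> convex_bodies_o" and u: "u \<in> sphere 0 1"
  shows "radial_function K u = 1 / wulff_gauge (support_function K) u"
  using radial_function_wulff_shape[OF positive_on_sphere_support_function[OF K] u]
  by (simp add: wulff_shape_support_function[OF K])

text \<open>The geometric normals of a body become maximizers in the gauge, which make sense for every
  \<open>f\<close>.\<close>

lemma outer_normal_iff_contact:
  assumes K: "K \<in> convex_bodies_o" and u: "u \<in> sphere 0 1"
  shows "outer_normal K (radial_function K u *\<^sub>R u) v \<longleftrightarrow> v \<in> contact_normals (support_function K) u"
  using wulff_gauge_pos[OF positive_on_sphere_support_function[OF K] u]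
  by (auto simp: outer_normal_def contact_normals_def radial_function_eq[OF K u] inner_commute field_simps)

text \<open>A projection of a compact set of pairs. Both uses need this form: the kink sets below, and
  the preimages of closed sets under the normal map.\<close>

lemma closed_contact_incidence:
  fixes f :: "real ^ 'n \<Rightarrow> real"
  assumes f: "positive_on_sphere f" and \<Phi>: "continuous_on (sphere 0 1 \<times> sphere 0 1) \<Phi>"
  shows "closed {u\<in>sphere 0 1. \<exists>v\<in>contact_normals f u. \<Phi> (u, v) \<le> (0::real)}"
proof -
  let ?P = "sphere 0 1 \<times> sphere 0 1 :: ((real ^ 'n) \<times> (real ^ 'n)) set"
  have c: "continuous_on ?P (\<lambda>p. fst p \<bullet> snd p - wulff_gauge f (fst p) * f (snd p))"
    using continuous_on_wulff_gauge[OF f, of "sphere 0 1"] positive_on_sphereD(1)[OF f]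
    by (intro continuous_intros continuous_on_compose2[of "sphere 0 1" "wulff_gauge f" ?P fst]
        continuous_on_compose2[of "sphere 0 1" f ?P snd]) auto
  have cP: "compact ?P" by (intro compact_Times compact_sphere)
  define A where "A = ?P \<inter> (\<lambda>p. fst p \<bullet> snd p - wulff_gauge f (fst p) * f (snd p)) -` {0}"
  define B where "B = ?P \<inter> \<Phi> -` {..0}"
  have "closed A"
    unfolding A_def using c cP compact_imp_closed by (intro continuous_closed_preimage) auto
  moreover have "closed B"
    unfolding B_def using \<Phi> cP compact_imp_closed by (intro continuous_closed_preimage) auto
  ultimately have "compact (?P \<inter> (A \<inter> B))" using cP by (intro compact_Int_closed closed_Int)
  then have "compact (fst ` (?P \<inter> (A \<inter> B)))"
    by (intro compact_continuous_image continuous_intros)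
  also have "fst ` (?P \<inter> (A \<inter> B)) = {u\<in>sphere 0 1. \<exists>v\<in>contact_normals f u. \<Phi> (u, v) \<le> 0}"
    by (force simp: contact_normals_def A_def B_def)
  finally show ?thesis by (rule compact_imp_closed)
qed

section \<open>Hausdorff measure on the sphere\<close>

definition sphere_measure :: "(real ^ 'n) measure" where
  "sphere_measure = restrict_space (hausdorff_measure (CARD('n) - 1)) (sphere 0 1)"

lemma sphere_in_hausdorff_sets: "sphere 0 1 \<in> sets (hausdorff_measure d :: (real ^ 'n) measure)"
  using borel_sets_hausdorff_measure[of d] by (auto intro: borel_closed)

lemma space_sphere_measure [simp]: "space sphere_measure = sphere 0 1"
  by (simp add: sphere_measure_def space_restrict_space)

lemma sets_sphere_measureI:
  assumes "A \<in> sets borel" "A \<subseteq> sphere 0 1" shows "A \<in> sets sphere_measure"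
  using assms borel_sets_hausdorff_measure
  unfolding sphere_measure_def sets_restrict_space by (auto intro!: image_eqI[of _ _ A])

lemma emeasure_sphere_measure:
  fixes A :: "(real ^ 'n) set"
  assumes "A \<in> sets sphere_measure"
  shows "emeasure sphere_measure A = hausdorff_outer (CARD('n) - 1) A"
proof -
  have A: "A \<in> sets (hausdorff_measure (CARD('n) - 1))" "A \<subseteq> sphere 0 1"
    using assms sphere_in_hausdorff_sets by (auto simp: sphere_measure_def sets_restrict_space)
  have "emeasure sphere_measure A = emeasure (hausdorff_measure (CARD('n) - 1)) A"
    unfolding sphere_measure_def
    by (rule emeasure_restrict_space) (use A sphere_in_hausdorff_sets in auto)
  with A(1) show ?thesis by (simp only: emeasure_hausdorff_measure)
qed

lemma borel_measurable_sphere_measure: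
  fixes f :: "real ^ 'n \<Rightarrow> 'b::topological_space"
  assumes "f \<in> borel_measurable (restrict_space borel (sphere 0 1))"
  shows "f \<in> borel_measurable sphere_measure"
proof (rule borel_measurableI)
  fix U :: "'b set" assume "open U"
  then have "f -` U \<inter> space (restrict_space borel (sphere 0 1)) \<in> sets (restrict_space borel (sphere 0 1))"
    using measurable_sets[OF assms] by auto
  then show "f -` U \<inter> space sphere_measure \<in> sets sphere_measure"
    by (auto simp: sets_restrict_space space_restrict_space intro!: sets_sphere_measureI)
qed

lemma continuous_on_measurable_sphere_measure:
  fixes f :: "real ^ 'n \<Rightarrow> real"
  assumes "continuous_on (sphere 0 1) f" shows "f \<in> borel_measurable sphere_measure"
  using assms by (intro borel_measurable_sphere_measure borel_measurable_continuous_on_restrict)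

lemma null_sets_sphere_measure_subset:
  assumes "N \<in> null_sets sphere_measure" "A \<subseteq> N"
  shows "A \<in> null_sets sphere_measure"
proof -
  have N: "N \<in> sets sphere_measure" using assms(1) by auto
  then have A: "A \<subseteq> sphere 0 1" using assms(2) sets.sets_into_space by fastforce
  have "hausdorff_outer (CARD('a) - 1) N = 0" using assms(1) emeasure_sphere_measure[OF N] by auto
  then have "hausdorff_outer (CARD('a) - 1) A = 0"
    using hausdorff_outer_le[OF assms(2), of "CARD('a) - 1"] by simp
  then have *: "A \<in> null_sets (hausdorff_measure (CARD('a) - 1))" by (rule hausdorff_outer_null_sets)
  with A show ?thesis
    using null_sets_restrict_space[OF sphere_in_hausdorff_sets] by (auto simp: sphere_measure_def)
qed

text \<open>Completeness in the form in which it is used: sets that are described through the normal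
  need only be understood where the normal is unique.\<close>

lemma sets_sphere_measure_AE_cong:
  assumes ae: "AE u in sphere_measure. u \<in> A \<longleftrightarrow> u \<in> B"
    and B: "B \<in> sets sphere_measure" and A: "A \<subseteq> sphere 0 1"
  shows "A \<in> sets sphere_measure"
proof -
  obtain N where N: "N \<in> null_sets sphere_measure" "{u \<in> space sphere_measure. \<not> (u \<in> A \<longleftrightarrow> u \<in> B)} \<subseteq> N"
    using ae by (auto simp: eventually_ae_filter)
  have "A \<inter> N \<in> sets sphere_measure"
    using null_sets_sphere_measure_subset[OF N(1), of "A \<inter> N"] by auto
  moreover have "A = (B - N) \<union> (A \<inter> N)"
    using N(2) A sets.sets_into_space[OF B] unfolding space_sphere_measure by blast
  ultimately show ?thesis using B N(1) by (metis null_setsD2 sets.Diff sets.Un)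
qed

lemma emeasure_sphere_measure_orthogonal_image:
  fixes T :: "real ^ 'n \<Rightarrow> real ^ 'n"
  assumes T: "orthogonal_transformation T" and A: "compact A" "A \<subseteq> sphere 0 1"
  shows "T ` A \<in> sets sphere_measure" "emeasure sphere_measure (T ` A) = emeasure sphere_measure A"
proof -
  have "compact (T ` A)"
    using T A(1) by (intro compact_continuous_image linear_continuous_on)
      (auto simp: orthogonal_transformation_linear linear_conv_bounded_linear[symmetric])
  moreover have "T ` A \<subseteq> sphere 0 1" using A(2) T by (auto simp: orthogonal_transformation)
  ultimately show 1: "T ` A \<in> sets sphere_measure"
    by (intro sets_sphere_measureI borel_closed compact_imp_closed)
  have "A \<in> sets sphere_measure"
    using A by (intro sets_sphere_measureI borel_closed compact_imp_closed)
  with 1 show "emeasure sphere_measure (T ` A) = emeasure sphere_measure A"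
    by (simp add: emeasure_sphere_measure hausdorff_outer_orthogonal_image[OF T])
qed

lemma compact_cap: "compact {u\<in>sphere 0 1. u \<bullet> v \<ge> (c::real)}" for v :: "real ^ 'n"
proof -
  have "{u\<in>sphere 0 1. u \<bullet> v \<ge> c} = sphere 0 1 \<inter> {u. v \<bullet> u \<ge> c}" by (auto simp: inner_commute)
  then show ?thesis using compact_Int_closed[OF compact_sphere closed_halfspace_ge] by metis
qed

lemma cap_in_sets: "{u\<in>sphere 0 1. u \<bullet> v \<ge> (c::real)} \<in> sets (sphere_measure :: (real ^ 'n) measure)"
  by (intro sets_sphere_measureI borel_closed compact_imp_closed compact_cap) auto

lemma sphere_covered_by_caps:
  assumes "c < (1::real)"
  obtains V :: "(real ^ 'n) set" where "finite V" "V \<subseteq> sphere 0 1"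
    "sphere 0 1 \<subseteq> (\<Union>v\<in>V. {u\<in>sphere 0 1. u \<bullet> v \<ge> c})"
proof -
  have "sphere 0 1 \<subseteq> (\<Union>v\<in>sphere 0 1. {u :: real ^ 'n. v \<bullet> u > c})"
  proof
    fix u :: "real ^ 'n" assume u: "u \<in> sphere 0 1"
    then have "u \<bullet> u > c" using assms by (simp add: dot_square_norm)
    with u show "u \<in> (\<Union>v\<in>sphere 0 1. {u. v \<bullet> u > c})" by blast
  qed
  then obtain V where "V \<subseteq> sphere 0 1" "finite V" "sphere 0 1 \<subseteq> (\<Union>v\<in>V. {u :: real ^ 'n. v \<bullet> u > c})"
    by (rule compactE_image[OF compact_sphere, rotated]) (auto intro: open_halfspace_gt)
  then show thesis by (intro that[of V]) (force simp: inner_commute)+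
qed

text \<open>If one cap were null, all its rotated copies would be, and finitely many of these cover the
  sphere.\<close>

lemma cap_measure_nonzero:
  fixes v :: "real ^ 'n"
  assumes S: "emeasure (sphere_measure :: (real ^ 'n) measure) (sphere 0 1) \<noteq> 0"
    and c: "c < 1" and v: "v \<in> sphere 0 1"
  shows "emeasure sphere_measure {u\<in>sphere 0 1. u \<bullet> v \<ge> c} \<noteq> 0"
proof
  assume null: "emeasure sphere_measure {u\<in>sphere 0 1. u \<bullet> v \<ge> c} = 0"
  obtain V :: "(real ^ 'n) set" where V: "finite V" "V \<subseteq> sphere 0 1"
    "sphere 0 1 \<subseteq> (\<Union>v\<in>V. {u\<in>sphere 0 1. u \<bullet> v \<ge> c})"
    using sphere_covered_by_caps[OF c] by blast
  have "emeasure sphere_measure {u\<in>sphere 0 1. u \<bullet> w \<ge> c} = 0" if w: "w \<in> V" for w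
  proof -
    obtain T where T: "orthogonal_transformation T" "T v = w"
    proof (rule orthogonal_transformation_exists_1[of v w])
      show "norm v = 1" "norm w = 1" using v w V(2) by auto
    qed
    have "{u\<in>sphere 0 1. u \<bullet> w \<ge> c} \<subseteq> T ` {u\<in>sphere 0 1. u \<bullet> v \<ge> c}"
    proof
      fix u assume u: "u \<in> {u\<in>sphere 0 1. u \<bullet> w \<ge> c}"
      obtain u' where u': "u = T u'" using orthogonal_transformation_surj[OF T(1)] by (metis surjD)
      have "u' \<bullet> v = u \<bullet> w" "norm u' = norm u"
        using T by (auto simp: u' orthogonal_transformation_def orthogonal_transformation norm_eq_sqrt_inner)
      with u u' show "u \<in> T ` {u\<in>sphere 0 1. u \<bullet> v \<ge> c}" by auto
    qed
    then have "emeasure sphere_measure {u\<in>sphere 0 1. u \<bullet> w \<ge> c}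
        \<le> emeasure sphere_measure (T ` {u\<in>sphere 0 1. u \<bullet> v \<ge> c})"
      by (intro emeasure_mono emeasure_sphere_measure_orthogonal_image T compact_cap) auto
    also have "\<dots> = 0"
      using null by (subst emeasure_sphere_measure_orthogonal_image[OF T(1) compact_cap]) auto
    finally show ?thesis by simp
  qed
  then have "(\<Union>w\<in>V. {u\<in>sphere 0 1. u \<bullet> w \<ge> c}) \<in> null_sets sphere_measure"
    using V(1) cap_in_sets by (intro null_sets.finite_UN) (auto simp: null_sets_def)
  then have "sphere 0 1 \<in> null_sets (sphere_measure :: (real ^ 'n) measure)"
    by (rule null_sets_sphere_measure_subset) (rule V(3))
  with S show False by auto
qed

section \<open>Almost everywhere uniqueness of the normal\<close>

definition plane_rotation :: "'n \<Rightarrow> 'n \<Rightarrow> real \<Rightarrow> real ^ 'n \<Rightarrow> real ^ 'n" where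
  "plane_rotation i j \<theta> x = (\<chi> k. if k = i then cos \<theta> * x $ i - sin \<theta> * x $ j
     else if k = j then sin \<theta> * x $ i + cos \<theta> * x $ j else x $ k)"

lemma sum_two_indices:
  fixes g :: "'n::finite \<Rightarrow> real"
  assumes "i \<noteq> j" "\<And>k. k \<noteq> i \<Longrightarrow> k \<noteq> j \<Longrightarrow> g k = 0"
  shows "(\<Sum>k\<in>UNIV. g k) = g i + g j"
proof -
  have "(\<Sum>k\<in>UNIV. g k) = (\<Sum>k\<in>{i, j}. g k)"
    by (rule sum.mono_neutral_right) (use assms in auto)
  with assms(1) show ?thesis by simp
qed

lemma inner_plane_rotation_diff:
  assumes "i \<noteq> j"
  shows "p \<bullet> (plane_rotation i j \<theta> x - x) =
    sin \<theta> * (x $ i * p $ j - x $ j * p $ i) - (1 - cos \<theta>) * (x $ i * p $ i + x $ j * p $ j)"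
  unfolding inner_vec_def
  by (subst sum_two_indices[OF assms]) (use assms in \<open>auto simp: plane_rotation_def algebra_simps\<close>)

lemma plane_rotation_add:
  assumes "i \<noteq> j"
  shows "plane_rotation i j \<theta> (plane_rotation i j \<eta> x) = plane_rotation i j (\<theta> + \<eta>) x"
  using assms by (simp add: plane_rotation_def vec_eq_iff cos_add sin_add algebra_simps)

lemma plane_rotation_0 [simp]: "plane_rotation i j 0 x = x"
  by (simp add: plane_rotation_def vec_eq_iff)

lemma orthogonal_plane_rotation:
  assumes "i \<noteq> j" shows "orthogonal_transformation (plane_rotation i j \<theta>)"
  unfolding orthogonal_transformation
proof (intro conjI allI)
  show "linear (plane_rotation i j \<theta>)"
    by (intro linearI) (auto simp: plane_rotation_def vec_eq_iff algebra_simps)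
  fix x
  let ?y = "plane_rotation i j \<theta> x"
  have "?y \<bullet> ?y - x \<bullet> x = (\<Sum>k\<in>UNIV. ?y $ k * ?y $ k - x $ k * x $ k)"
    by (simp add: inner_vec_def sum_subtractf)
  also have "\<dots> = (?y $ i * ?y $ i - x $ i * x $ i) + (?y $ j * ?y $ j - x $ j * x $ j)"
    by (rule sum_two_indices[OF assms]) (auto simp: plane_rotation_def)
  also have "\<dots> = ((cos \<theta>)\<^sup>2 + (sin \<theta>)\<^sup>2) * ((x $ i)\<^sup>2 + (x $ j)\<^sup>2) - ((x $ i)\<^sup>2 + (x $ j)\<^sup>2)"
    using assms by (simp add: plane_rotation_def del: sin_cos_squared_add sin_cos_squared_add2)
      (simp only: power2_eq_square distrib_left distrib_right left_diff_distrib right_diff_distrib; simp add: algebra_simps)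
  also have "\<dots> = 0" by simp
  finally show "norm ?y = norm x" by (simp add: norm_eq_sqrt_inner)
qed

text \<open>The images of \<open>M\<close> under rotation by the angles \<open>\<theta>\<^sub>0 / (k + 2)\<close> are pairwise disjoint,
  because the difference of two such angles is again in \<open>(0, \<theta>\<^sub>0)\<close>. They all have the measure
  of \<open>M\<close>.\<close>

lemma null_if_rotations_disjoint:
  fixes M :: "(real ^ 'n) set"
  assumes fin: "emeasure (sphere_measure :: (real ^ 'n) measure) (sphere 0 1) \<noteq> \<infinity>"
    and M: "compact M" "M \<subseteq> sphere 0 1" and ij: "i \<noteq> j" and \<theta>\<^sub>0: "0 < \<theta>\<^sub>0"
    and disj: "\<And>\<theta>. 0 < \<theta> \<Longrightarrow> \<theta> < \<theta>\<^sub>0 \<Longrightarrow> plane_rotation i j \<theta> ` M \<inter> M = {}"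
  shows "M \<in> null_sets sphere_measure"
proof -
  interpret finite_measure "sphere_measure :: (real ^ 'n) measure"
    by (rule finite_measureI) (use fin in simp)
  let ?R = "plane_rotation i j"
  define t where "t k = \<theta>\<^sub>0 / real (k + 2)" for k
  have img: "?R (t k) ` M \<in> sets sphere_measure" "measure sphere_measure (?R (t k) ` M) = measure sphere_measure M" for k
    using emeasure_sphere_measure_orthogonal_image[OF orthogonal_plane_rotation[OF ij] M]
    by (auto simp: measure_def)
  have dj: "?R (t k) ` M \<inter> ?R (t l) ` M = {}" if "k < l" for k l
  proof (rule ccontr)
    assume "?R (t k) ` M \<inter> ?R (t l) ` M \<noteq> {}"
    then obtain x y where xy: "x \<in> M" "y \<in> M" "?R (t k) x = ?R (t l) y" by auto
    then have "?R (- t l) (?R (t k) x) = ?R (- t l) (?R (t l) y)" by simp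
    then have "?R (t k - t l) x = y" by (simp add: plane_rotation_add[OF ij] algebra_simps)
    moreover have "t l < t k" unfolding t_def using \<theta>\<^sub>0 that by (intro divide_strict_left_mono) auto
    moreover have "t k < \<theta>\<^sub>0" "0 < t l" using \<theta>\<^sub>0 by (auto simp: t_def field_simps intro: add_pos_nonneg)
    ultimately show False using disj[of "t k - t l"] xy by auto
  qed
  have bound: "real n * measure sphere_measure M \<le> measure (sphere_measure :: (real ^ 'n) measure) (sphere 0 1)" for n
  proof -
    have "real n * measure sphere_measure M = (\<Sum>k<n. measure sphere_measure (?R (t k) ` M))"
      by (simp add: img)
    also have "\<dots> = measure sphere_measure (\<Union>k<n. ?R (t k) ` M)"
    proof (rule finite_measure_finite_Union[symmetric])
      show "disjoint_family_on (\<lambda>k. ?R (t k) ` M) {..<n}"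
        unfolding disjoint_family_on_def using dj by (metis Int_commute linorder_neqE_nat)
    qed (use img in auto)
    also have "\<dots> \<le> measure (sphere_measure :: (real ^ 'n) measure) (sphere 0 1)"
      using bounded_measure[of "\<Union>k<n. ?R (t k) ` M"] by simp
    finally show ?thesis .
  qed
  have "measure sphere_measure M = 0"
  proof (rule ccontr)
    assume "measure sphere_measure M \<noteq> 0"
    then have "0 < measure sphere_measure M" by (simp add: zero_less_measure_iff)
    then obtain n where "measure (sphere_measure :: (real ^ 'n) measure) (sphere 0 1) < real n * measure sphere_measure M"
      using reals_Archimedean3 by blast
    with bound[of n] show False by simp
  qed
  moreover have "M \<in> sets sphere_measure"
    using M by (intro sets_sphere_measureI borel_closed compact_imp_closed)
  ultimately show ?thesis by (simp add: emeasure_eq_measure null_sets_def)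
qed

text \<open>The velocity at \<open>u\<close> of the rotation in the plane \<open>(i, j)\<close> is \<open>u\<^sub>i e\<^sub>j - u\<^sub>j e\<^sub>i\<close>. The
  quotient below is its inner product with the subgradient \<open>v / f v\<close>. For \<open>q < r\<close> the set
  collects the points at which the slopes of the gauge along this rotation include all of
  \<open>[q, r]\<close>.\<close>

definition kink_set :: "(real ^ 'n \<Rightarrow> real) \<Rightarrow> 'n \<Rightarrow> 'n \<Rightarrow> real \<Rightarrow> real \<Rightarrow> (real ^ 'n) set" where
  "kink_set f i j q r =
     {u\<in>sphere 0 1. \<exists>v\<in>contact_normals f u. (u $ i * v $ j - u $ j * v $ i) / f v \<le> q} \<inter>
     {u\<in>sphere 0 1. \<exists>v\<in>contact_normals f u. r \<le> (u $ i * v $ j - u $ j * v $ i) / f v}"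

lemma compact_kink_set:
  fixes f :: "real ^ 'n \<Rightarrow> real"
  assumes f: "positive_on_sphere f" shows "compact (kink_set f i j q r)"
proof -
  have c: "continuous_on (sphere 0 1 \<times> sphere 0 1)
      (\<lambda>p :: (real ^ 'n) \<times> (real ^ 'n). (fst p $ i * snd p $ j - fst p $ j * snd p $ i) / f (snd p))"
    using positive_on_sphereD[OF f]
    by (intro continuous_intros continuous_on_compose2[of "sphere 0 1" f _ snd]) force+
  have "closed {u\<in>sphere 0 1. \<exists>v\<in>contact_normals f u. (u $ i * v $ j - u $ j * v $ i) / f v \<le> q}"
    using closed_contact_incidence[OF f continuous_on_diff[OF c continuous_on_const[of _ q]]] by simp
  moreover have "closed {u\<in>sphere 0 1. \<exists>v\<in>contact_normals f u. r \<le> (u $ i * v $ j - u $ j * v $ i) / f v}"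
    using closed_contact_incidence[OF f continuous_on_diff[OF continuous_on_const[of _ r] c]] by simp
  ultimately have "closed (kink_set f i j q r)" unfolding kink_set_def by (rule closed_Int)
  then have "compact (sphere 0 1 \<inter> kink_set f i j q r)" by (intro compact_Int_closed compact_sphere)
  moreover have "sphere 0 1 \<inter> kink_set f i j q r = kink_set f i j q r" by (auto simp: kink_set_def)
  ultimately show ?thesis by simp
qed

text \<open>Suppose \<open>x\<close> and \<open>y\<close>, its image under rotation by a small \<open>\<theta> > 0\<close>, both have a kink
  containing the slopes from \<open>q\<close> to \<open>r\<close>. The gauge increases from \<open>x\<close> to \<open>y\<close> by at least
  \<open>r sin \<theta>\<close>, by a subgradient at \<open>x\<close>, and by at most \<open>q sin \<theta>\<close>, by a subgradient at \<open>y\<close>,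
  both up to an error of order \<open>1 - cos \<theta>\<close>. For small \<open>\<theta>\<close> this contradicts \<open>q < r\<close>. The
  function \<open>D\<close> in the proof is the resulting gap.\<close>

lemma kink_set_null:
  fixes f :: "real ^ 'n \<Rightarrow> real"
  assumes fin: "emeasure (sphere_measure :: (real ^ 'n) measure) (sphere 0 1) \<noteq> \<infinity>"
    and f: "positive_on_sphere f" and ij: "i \<noteq> j" and qr: "q < r"
  shows "kink_set f i j q r \<in> null_sets sphere_measure"
proof -
  obtain a where a: "0 < a" "\<And>v. v \<in> sphere 0 1 \<Longrightarrow> a \<le> f v"
    using positive_on_sphere_bounds[OF f] by metis
  define D where "D \<theta> = sin \<theta> * (r - q) - 4 / a * (1 - cos \<theta>)" for \<theta>
  have "(D has_real_derivative (r - q)) (at 0)"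
    unfolding D_def using a(1) by (auto intro!: derivative_eq_intros)
  then obtain \<theta>\<^sub>1 where \<theta>\<^sub>1: "0 < \<theta>\<^sub>1" "\<And>\<theta>. 0 < \<theta> \<Longrightarrow> \<theta> < \<theta>\<^sub>1 \<Longrightarrow> D 0 < D (0 + \<theta>)"
    using DERIV_pos_inc_right[of D "r - q" 0] qr by auto
  define \<theta>\<^sub>0 where "\<theta>\<^sub>0 = min \<theta>\<^sub>1 pi"
  have \<theta>\<^sub>0: "0 < \<theta>\<^sub>0" using \<theta>\<^sub>1 by (simp add: \<theta>\<^sub>0_def)
  \<comment> \<open>The second-order term of the rotation, paired with a subgradient.\<close>
  have small: "(x $ i * v $ i + x $ j * v $ j) / f v \<le> 2 / a"
    if "x \<in> sphere 0 1" "v \<in> sphere 0 1" for x v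
  proof -
    have 1: "\<bar>x $ k * v $ k\<bar> \<le> 1" for k
      using component_le_norm_cart[of x k] component_le_norm_cart[of v k] that
      by (simp add: abs_mult mult_le_one)
    have "\<bar>x $ i * v $ i + x $ j * v $ j\<bar> \<le> 2" using 1[of i] 1[of j] by linarith
    moreover have "0 < f v" "a \<le> f v" using a(2)[OF that(2)] a(1) by auto
    ultimately show ?thesis using a(1) by (intro frac_le) auto
  qed
  show ?thesis
  proof (rule null_if_rotations_disjoint[OF fin compact_kink_set[OF f] _ ij \<theta>\<^sub>0])
    show "kink_set f i j q r \<subseteq> sphere 0 1" by (auto simp: kink_set_def)
  next
    fix \<theta> assume \<theta>: "0 < \<theta>" "\<theta> < \<theta>\<^sub>0"
    have s: "0 < sin \<theta>" using \<theta> by (intro sin_gt_zero) (auto simp: \<theta>\<^sub>0_def)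
    show "plane_rotation i j \<theta> ` kink_set f i j q r \<inter> kink_set f i j q r = {}"
    proof (rule ccontr)
      assume "\<not> ?thesis"
      then obtain x y where x: "x \<in> kink_set f i j q r" and y: "y \<in> kink_set f i j q r"
        and yx: "y = plane_rotation i j \<theta> x" by auto
      have xy: "x = plane_rotation i j (- \<theta>) y" by (simp add: yx plane_rotation_add[OF ij])
      obtain v where v: "v \<in> contact_normals f x" "r \<le> (x $ i * v $ j - x $ j * v $ i) / f v"
        using x by (auto simp: kink_set_def)
      obtain w where w: "w \<in> contact_normals f y" "(y $ i * w $ j - y $ j * w $ i) / f w \<le> q"
        using y by (auto simp: kink_set_def)
      have S: "x \<in> sphere 0 1" "y \<in> sphere 0 1" "v \<in> sphere 0 1" "w \<in> sphere 0 1"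
        using x y v w by (auto simp: kink_set_def contact_normals_def)
      have fv: "0 < f v" "0 < f w" using positive_on_sphereD(2)[OF f] S by auto
      have c: "0 \<le> 1 - cos \<theta>" by simp
      have "sin \<theta> * r - (1 - cos \<theta>) * (2 / a)
          \<le> sin \<theta> * ((x $ i * v $ j - x $ j * v $ i) / f v) - (1 - cos \<theta>) * ((x $ i * v $ i + x $ j * v $ j) / f v)"
        using v(2) s small[OF S(1,3)] by (intro diff_mono mult_left_mono) auto
      also have "\<dots> = v \<bullet> (y - x) / f v"
        unfolding yx inner_plane_rotation_diff[OF ij] using fv by (simp add: field_simps)
      also have "\<dots> \<le> wulff_gauge f y - wulff_gauge f x"
      proof -
        have "v \<bullet> (y - x) \<le> wulff_gauge f y * f v - wulff_gauge f x * f v"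
          using wulff_gauge_attained(2)[OF f S(3), of y] v(1)
          by (simp add: contact_normals_def inner_diff_right inner_commute[of v])
        then show ?thesis using fv by (simp add: pos_divide_le_eq left_diff_distrib)
      qed
      also have "\<dots> \<le> - (w \<bullet> (x - y) / f w)"
      proof -
        have "wulff_gauge f y * f w - wulff_gauge f x * f w \<le> - (w \<bullet> (x - y))"
          using wulff_gauge_attained(2)[OF f S(4), of x] w(1)
          by (simp add: contact_normals_def inner_diff_right inner_commute[of w])
        then have "wulff_gauge f y - wulff_gauge f x \<le> (- (w \<bullet> (x - y))) / f w"
          using fv by (simp only: pos_le_divide_eq left_diff_distrib)
        then show ?thesis by simp
      qed
      also have "w \<bullet> (x - y) = - sin \<theta> * (y $ i * w $ j - y $ j * w $ i) - (1 - cos \<theta>) * (y $ i * w $ i + y $ j * w $ j)"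
        using inner_plane_rotation_diff[OF ij, of w "- \<theta>" y] unfolding xy[symmetric] by simp
      also have "- ((- sin \<theta> * (y $ i * w $ j - y $ j * w $ i) - (1 - cos \<theta>) * (y $ i * w $ i + y $ j * w $ j)) / f w)
        = sin \<theta> * ((y $ i * w $ j - y $ j * w $ i) / f w) + (1 - cos \<theta>) * ((y $ i * w $ i + y $ j * w $ j) / f w)"
        using fv by (simp add: field_simps)
      also have "\<dots> \<le> sin \<theta> * q + (1 - cos \<theta>) * (2 / a)"
        using w(2) s small[OF S(2,4)] by (intro add_mono mult_left_mono) auto
      finally have "D \<theta> \<le> 0" by (simp add: D_def algebra_simps)
      moreover have "D 0 = 0" by (simp add: D_def)
      ultimately show False using \<theta>\<^sub>1(2)[of \<theta>] \<theta> by (simp add: \<theta>\<^sub>0_def)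
    qed
  qed
qed

text \<open>The tangent vectors \<open>u\<^sub>i e\<^sub>j - u\<^sub>j e\<^sub>i\<close> of the coordinate rotations span the orthogonal
  complement of \<open>u\<close>.\<close>

lemma parallel_if_minors_vanish:
  fixes u d :: "real ^ 'n"
  assumes "\<And>i j. u $ i * d $ j - u $ j * d $ i = 0" "u \<bullet> d = 0" "u \<noteq> 0"
  shows "d = 0"
proof -
  have "(u \<bullet> u) * d $ j = 0" for j
  proof -
    have "(u \<bullet> u) * d $ j - u $ j * (u \<bullet> d) = (\<Sum>i\<in>UNIV. u $ i * (u $ i * d $ j - u $ j * d $ i))"
      by (simp add: inner_vec_def sum_distrib_left sum_distrib_right sum_subtractf algebra_simps)
    with assms(1,2) show ?thesis by simp
  qed
  with assms(3) have "d $ j = 0" for j by simp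
  then show ?thesis by (simp add: vec_eq_iff)
qed

text \<open>Two contact normals at \<open>u\<close> yield distinct subgradients, both with inner product
  \<open>wulff_gauge f u\<close> with \<open>u\<close>. Their difference is orthogonal to \<open>u\<close>, hence is detected by
  some coordinate rotation, and rational numbers fit between the two slopes. So \<open>u\<close> lies in
  one of countably many null sets.\<close>

theorem AE_unique_contact_normal:
  fixes f :: "real ^ 'n \<Rightarrow> real"
  assumes fin: "emeasure (sphere_measure :: (real ^ 'n) measure) (sphere 0 1) \<noteq> \<infinity>"
    and f: "positive_on_sphere f"
  shows "AE u in sphere_measure. \<exists>!v. v \<in> contact_normals f u"
proof (rule AE_I')
  let ?I = "{(i, j, q, r). i \<noteq> j \<and> q \<in> \<rat> \<and> r \<in> \<rat> \<and> q < r} :: ('n \<times> 'n \<times> real \<times> real) set"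
  have "?I \<subseteq> UNIV \<times> UNIV \<times> \<rat> \<times> \<rat>" by auto
  then have "countable ?I"
    by (rule countable_subset) (intro countable_SIGMA countable_rat countable_finite finite)
  then show "(\<Union>(i, j, q, r)\<in>?I. kink_set f i j q r) \<in> null_sets sphere_measure"
    using kink_set_null[OF fin f] by (intro null_sets_UN') auto
  show "{u \<in> space sphere_measure. \<not> (\<exists>!v. v \<in> contact_normals f u)} \<subseteq> (\<Union>(i, j, q, r)\<in>?I. kink_set f i j q r)"
  proof
    fix u assume "u \<in> {u \<in> space sphere_measure. \<not> (\<exists>!v. v \<in> contact_normals f u)}"
    then have u: "u \<in> sphere 0 1" and "\<not> (\<exists>!v. v \<in> contact_normals f u)" by auto
    then obtain v w where vw: "v \<in> contact_normals f u" "w \<in> contact_normals f u" "v \<noteq> w"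
      using contact_normals_nonempty[OF f, of u] by blast
    have vs: "norm v = 1" "norm w = 1" "0 < f v" "0 < f w"
      using vw positive_on_sphereD(2)[OF f] by (auto simp: contact_normals_def)
    define d where "d = (1 / f v) *\<^sub>R v - (1 / f w) *\<^sub>R w"
    have "d \<noteq> 0"
    proof
      assume "d = 0"
      then have eq: "(1 / f v) *\<^sub>R v = (1 / f w) *\<^sub>R w" by (simp add: d_def)
      then have "norm ((1 / f v) *\<^sub>R v) = norm ((1 / f w) *\<^sub>R w)" by simp
      then have "1 / f v = 1 / f w" using vs by simp
      with eq vs vw(3) show False by simp
    qed
    moreover have "u \<bullet> d = 0"
      using vw vs by (simp add: d_def inner_diff_right contact_normals_def)
    moreover have "u \<noteq> 0" using u by auto
    ultimately obtain i j where ij: "u $ i * d $ j - u $ j * d $ i \<noteq> 0"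
      using parallel_if_minors_vanish by blast
    define A where "A z = (u $ i * z $ j - u $ j * z $ i) / f z" for z
    have "u $ i * d $ j - u $ j * d $ i = A v - A w"
      using vs by (simp add: d_def A_def diff_divide_distrib algebra_simps)
    with ij have "A v \<noteq> A w" by simp
    moreover have "u \<in> (\<Union>(i, j, q, r)\<in>?I. kink_set f i j q r)"
      if vw': "v' \<in> contact_normals f u" "w' \<in> contact_normals f u" "A v' < A w'" for v' w'
    proof -
      obtain q where q: "q \<in> \<rat>" "A v' < q" "q < A w'" using Rats_dense_in_real[OF vw'(3)] by blast
      obtain r where r: "r \<in> \<rat>" "q < r" "r < A w'" using Rats_dense_in_real[OF q(3)] by blast
      have "i \<noteq> j" using ij by auto
      moreover have "u \<in> kink_set f i j q r"
        using u vw' q r unfolding kink_set_def A_def by (auto intro: less_imp_le)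
      ultimately show ?thesis using q r by blast
    qed
    ultimately show "u \<in> (\<Union>(i, j, q, r)\<in>?I. kink_set f i j q r)"
      using vw by (metis linorder_neqE_linordered_idom)
  qed
qed

definition contact_map :: "(real ^ 'n \<Rightarrow> real) \<Rightarrow> real ^ 'n \<Rightarrow> real ^ 'n" where
  "contact_map f u = (THE v. v \<in> contact_normals f u)"

lemma contact_map_eq:
  assumes "\<exists>!v. v \<in> contact_normals f u"
  shows "v \<in> contact_normals f u \<longleftrightarrow> v = contact_map f u" "contact_map f u \<in> sphere 0 1"
proof -
  have "contact_map f u \<in> contact_normals f u" unfolding contact_map_def using assms by (rule theI')
  with assms show "v \<in> contact_normals f u \<longleftrightarrow> v = contact_map f u" "contact_map f u \<in> sphere 0 1"
    by (auto simp: contact_normals_def)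
qed

text \<open>Where the contact normal is unique, it lies in a closed set \<open>C\<close> exactly if some contact
  normal does, and the latter condition is closed in \<open>u\<close>.\<close>

lemma measurable_contact_map:
  fixes f :: "real ^ 'n \<Rightarrow> real"
  assumes fin: "emeasure (sphere_measure :: (real ^ 'n) measure) (sphere 0 1) \<noteq> \<infinity>"
    and f: "positive_on_sphere f"
  shows "contact_map f \<in> measurable sphere_measure borel"
proof (rule borel_measurableI)
  fix U :: "(real ^ 'n) set" assume "open U"
  let ?C = "- U"
  show "contact_map f -` U \<inter> space sphere_measure \<in> sets sphere_measure"
  proof (cases "?C = {}")
    case True
    then have "U = UNIV" by auto
    then show ?thesis using sets.top[of sphere_measure] by (simp del: sets.top)
  next
    case False
    let ?A = "{u\<in>sphere 0 1. \<exists>v\<in>contact_normals f u. infdist v ?C \<le> 0}"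
    have "closed ?A"
      using closed_contact_incidence[OF f, of "\<lambda>p. infdist (snd p) ?C"]
      by (simp add: continuous_on_infdist continuous_on_snd)
    then have A: "?A \<in> sets sphere_measure" by (intro sets_sphere_measureI borel_closed) auto
    have inf: "infdist v ?C \<le> 0 \<longleftrightarrow> v \<in> ?C" for v
      using in_closed_iff_infdist_zero[of ?C v] \<open>open U\<close> False infdist_nonneg[of v ?C] by auto
    have "AE u in sphere_measure. u \<in> contact_map f -` U \<inter> space sphere_measure \<longleftrightarrow> u \<in> space sphere_measure - ?A"
      using AE_unique_contact_normal[OF fin f] AE_space
    proof eventually_elim
      case (elim u)
      then show ?case using contact_map_eq[OF elim(1)] unfolding inf by auto
    qed
    then show ?thesis
      by (rule sets_sphere_measure_AE_cong) (use sets.compl_sets[OF A] in simp_all)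
  qed
qed

section \<open>The variational problem\<close>

text \<open>Integrability of \<open>\<psi> s / s\<close> near \<open>0\<close> bounds every antiderivative from below, so that one
  of them can be shifted to be nonnegative; divergence of the integral at \<open>\<infinity>\<close> makes it
  unbounded.\<close>

lemma antiderivative_of_quotient:
  fixes \<psi> :: "real \<Rightarrow> real"
  assumes psi_pos: "\<And>s. s > 0 \<Longrightarrow> \<psi> s > 0"
    and psi_cont: "continuous_on {0<..} \<psi>"
    and psi_inf: "(\<integral>\<^sup>+ s \<in> {1..}. ennreal (\<psi> s / s) \<partial>lborel) = \<infinity>"
    and phi_finite: "(\<integral>\<^sup>+ s \<in> {0<..1}. ennreal (\<psi> s / s) \<partial>lborel) < \<infinity>"
  obtains \<phi> :: "real \<Rightarrow> real" where "\<And>t. t > 0 \<Longrightarrow> (\<phi> has_real_derivative \<psi> t / t) (at t)"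
    "\<And>t. t > 0 \<Longrightarrow> 0 \<le> \<phi> t" "\<And>C. \<exists>t>0. C < \<phi> t"
proof -
  define k where "k s = indicator {0<..} s * (\<psi> s / s)" for s
  have kc: "continuous_on {0<..} (\<lambda>s. \<psi> s / s)" using psi_cont by (intro continuous_intros) auto
  have [measurable]: "k \<in> borel_measurable borel"
    using borel_measurable_continuous_on_indicator[OF _ kc] by (simp add: k_def[abs_def])
  have kpos: "k s = \<psi> s / s" "0 < k s" if "s > 0" for s
    using that psi_pos[OF that] by (auto simp: k_def)
  have "isCont (\<lambda>s. \<psi> s / s) s" if "s > 0" for s
    using kc that by (simp add: continuous_on_eq_continuous_at)
  then obtain F where F': "\<And>t. t > 0 \<Longrightarrow> (F has_vector_derivative \<psi> t / t) (at t)"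
    using einterval_antiderivative[of 0 \<infinity> "\<lambda>s. \<psi> s / s"] by auto
  have F: "(F has_real_derivative k t) (at t)" if "t > 0" for t
    using F'[OF that] that by (simp add: k_def has_real_derivative_iff_has_vector_derivative)
  have FTC: "(\<integral>\<^sup>+ s. ennreal (k s) * indicator {a..b} s \<partial>lborel) = ennreal (F b - F a)" if "0 < a" "a \<le> b" for a b
    using that F kpos by (intro nn_integral_FTC_Icc) (auto intro: less_imp_le)
  have mono: "F a \<le> F b" if "0 < a" "a \<le> b" for a b
  proof (rule DERIV_nonneg_imp_nondecreasing[OF that(2)])
    fix x assume "a \<le> x" "x \<le> b"
    with that have x: "0 < x" by simp
    show "\<exists>y. (F has_real_derivative y) (at x) \<and> 0 \<le> y"
      using F[OF x] kpos(2)[OF x] by (auto intro: less_imp_le)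
  qed
  define c where "c = enn2real (\<integral>\<^sup>+ s \<in> {0<..1}. ennreal (\<psi> s / s) \<partial>lborel)"
  have lower: "F 1 - c \<le> F t" if t: "t > 0" for t
  proof (cases "t \<le> 1")
    case True
    have "ennreal (F 1 - F t) = (\<integral>\<^sup>+ s. ennreal (k s) * indicator {t..1} s \<partial>lborel)"
      using FTC t True by simp
    also have "\<dots> \<le> (\<integral>\<^sup>+ s \<in> {0<..1}. ennreal (\<psi> s / s) \<partial>lborel)"
      using t by (intro nn_integral_mono) (auto simp: k_def split: split_indicator)
    also have "\<dots> = ennreal c" using phi_finite by (simp add: c_def)
    finally have "F 1 - F t \<le> c" by (subst (asm) ennreal_le_iff) (auto simp: c_def)
    then show ?thesis by simp
  next
    case False
    then have "F 1 \<le> F t" using mono[of 1 t] by simp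
    moreover have "0 \<le> c" by (simp add: c_def)
    ultimately show ?thesis by linarith
  qed
  have unbounded: "\<exists>t>0. C < F t" for C
  proof (rule ccontr)
    assume "\<not> ?thesis"
    then have C: "F t \<le> C" if "t > 0" for t using that by force
    have "(\<integral>\<^sup>+ s \<in> {1..}. ennreal (\<psi> s / s) \<partial>lborel)
        = (\<integral>\<^sup>+ s. (SUP n::nat. ennreal (k s) * indicator {1..1 + real n} s) \<partial>lborel)"
    proof (rule nn_integral_cong)
      fix s :: real
      show "ennreal (\<psi> s / s) * indicator {1..} s = (SUP n::nat. ennreal (k s) * indicator {1..1 + real n} s)"
      proof (cases "1 \<le> s")
        case True
        obtain n :: nat where n: "s \<le> real n" using real_arch_simple by blast
        have "(SUP n::nat. ennreal (k s) * indicator {1..1 + real n} s) = ennreal (k s)"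
        proof (rule antisym)
          show "(SUP n::nat. ennreal (k s) * indicator {1..1 + real n} s) \<le> ennreal (k s)"
            by (auto intro!: SUP_least split: split_indicator)
          show "ennreal (k s) \<le> (SUP n::nat. ennreal (k s) * indicator {1..1 + real n} s)"
            using True n by (intro SUP_upper2[of n]) auto
        qed
        then show ?thesis using True by (simp add: k_def)
      next
        case False then show ?thesis by simp
      qed
    qed
    also have "\<dots> = (SUP n::nat. \<integral>\<^sup>+ s. ennreal (k s) * indicator {1..1 + real n} s \<partial>lborel)"
      by (intro nn_integral_monotone_convergence_SUP incseq_SucI le_funI)
        (auto split: split_indicator)
    also have "\<dots> \<le> ennreal (C - F 1)"
    proof (rule SUP_least)
      fix n :: nat
      have "(\<integral>\<^sup>+ s. ennreal (k s) * indicator {1..1 + real n} s \<partial>lborel) = ennreal (F (1 + real n) - F 1)"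
        by (rule FTC) auto
      also have "\<dots> \<le> ennreal (C - F 1)" by (intro ennreal_leI diff_right_mono C) auto
      finally show "(\<integral>\<^sup>+ s. ennreal (k s) * indicator {1..1 + real n} s \<partial>lborel) \<le> ennreal (C - F 1)" .
    qed
    finally show False using psi_inf by (simp add: top_unique)
  qed
  show thesis
  proof (rule that[of "\<lambda>t. F t - (F 1 - c)"])
    fix t :: real assume t: "t > 0"
    show "((\<lambda>t. F t - (F 1 - c)) has_real_derivative \<psi> t / t) (at t)"
      using F[OF t] t by (auto intro!: derivative_eq_intros simp: k_def)
    show "0 \<le> F t - (F 1 - c)" using lower[OF t] by simp
  next
    fix C show "\<exists>t>0. C < F t - (F 1 - c)" using unbounded[of "C + (F 1 - c)"] by (auto simp: less_diff_eq)
  qed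
qed

text \<open>The data of the problem, with \<open>\<phi>\<close> described only through the properties that the variational
  argument uses.\<close>

locale orlicz_minkowski_problem =
  fixes G :: "real \<Rightarrow> real ^ 'n \<Rightarrow> real" and \<psi> \<phi> :: "real \<Rightarrow> real"
    and \<epsilon>\<^sub>0 :: real and \<mu> :: "(real ^ 'n) measure"
  assumes G_pos: "\<And>t u. t > 0 \<Longrightarrow> u \<in> sphere 0 1 \<Longrightarrow> G t u > 0"
    and G_cont: "continuous_on ({0<..} \<times> sphere 0 1) (\<lambda>(t, u). G t u)"
    and G_diff: "\<And>t u. t > 0 \<Longrightarrow> u \<in> sphere 0 1 \<Longrightarrow> (\<lambda>s. G s u) differentiable (at t)"
    and G_t_cont: "continuous_on ({0<..} \<times> sphere 0 1) (\<lambda>(t, u). G_t G t u)"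
    and G_t_neg: "\<And>t u. t > 0 \<Longrightarrow> u \<in> sphere 0 1 \<Longrightarrow> G_t G t u < 0"
    and eps: "0 < \<epsilon>\<^sub>0" "\<epsilon>\<^sub>0 < 1"
    and G_lim: "\<And>v. v \<in> sphere 0 1 \<Longrightarrow>
          filterlim
            (\<lambda>t. LINT u : {u \<in> sphere 0 1. u \<bullet> v \<ge> \<epsilon>\<^sub>0} | hausdorff_measure (CARD('n) - 1). G t u)
            at_top (at_right 0)"
    and psi_pos: "\<And>s. s > 0 \<Longrightarrow> \<psi> s > 0"
    and psi_cont: "continuous_on {0<..} \<psi>"
    and phi_deriv: "\<And>t. t > 0 \<Longrightarrow> (\<phi> has_real_derivative \<psi> t / t) (at t)"
    and phi_nonneg: "\<And>t. t > 0 \<Longrightarrow> 0 \<le> \<phi> t"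
    and phi_unbounded: "\<And>C. \<exists>t>0. C < \<phi> t"
    and mu_sets: "sets \<mu> = sets (restrict_space borel (sphere 0 1))"
    and mu_finite: "finite_measure \<mu>"
begin

abbreviation \<omega> :: "(real ^ 'n) measure" where "\<omega> \<equiv> sphere_measure"

lemma space_mu: "space \<mu> = sphere 0 1"
  using sets_eq_imp_space_eq[OF mu_sets] by (simp add: space_restrict_space)

lemma continuous_on_measurable_mu:
  fixes f :: "real ^ 'n \<Rightarrow> real"
  assumes "continuous_on (sphere 0 1) f" shows "f \<in> borel_measurable \<mu>"
  using borel_measurable_continuous_on_restrict[OF assms]
  by (subst measurable_cong_sets[OF mu_sets refl])

lemma G_deriv:
  assumes "t > 0" "u \<in> sphere 0 1"
  shows "((\<lambda>s. G s u) has_real_derivative G_t G t u) (at t)"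
  using G_diff[OF assms] by (simp add: G_t_def DERIV_deriv_iff_real_differentiable)

lemma G_antimono:
  assumes "0 < s" "s \<le> t" "u \<in> sphere 0 1" shows "G t u \<le> G s u"
proof (rule DERIV_nonpos_imp_nonincreasing[OF assms(2)])
  fix x assume "s \<le> x" "x \<le> t"
  with assms have x: "0 < x" by simp
  show "\<exists>y. ((\<lambda>s. G s u) has_real_derivative y) (at x) \<and> y \<le> 0"
    using G_deriv[OF x assms(3)] G_t_neg[OF x assms(3)] by (auto intro: less_imp_le)
qed

lemma phi_mono:
  assumes "0 < s" "s \<le> t" shows "\<phi> s \<le> \<phi> t"
proof (rule DERIV_nonneg_imp_nondecreasing[OF assms(2)])
  fix x assume "s \<le> x" "x \<le> t"
  with assms have x: "0 < x" by simp
  show "\<exists>y. (\<phi> has_real_derivative y) (at x) \<and> 0 \<le> y"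
    using phi_deriv[OF x] psi_pos[OF x] x by (auto intro: less_imp_le)
qed

lemma continuous_on_G:
  assumes "continuous_on (sphere 0 1) r" "\<And>u. u \<in> sphere 0 1 \<Longrightarrow> 0 < r u"
  shows "continuous_on (sphere 0 1) (\<lambda>u. G (r u) u)" "continuous_on (sphere 0 1) (\<lambda>u. G_t G (r u) u)"
proof -
  have p: "continuous_on (sphere 0 1) (\<lambda>u. (r u, u))" using assms(1) by (intro continuous_intros)
  show "continuous_on (sphere 0 1) (\<lambda>u. G (r u) u)"
    by (rule continuous_on_compose2[OF G_cont p, unfolded prod.case]) (use assms(2) in auto)
  show "continuous_on (sphere 0 1) (\<lambda>u. G_t G (r u) u)"
    by (rule continuous_on_compose2[OF G_t_cont p, unfolded prod.case]) (use assms(2) in auto)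
qed

lemma continuous_on_phi: "continuous_on {0<..} \<phi>"
  by (intro continuous_at_imp_continuous_on ballI) (use phi_deriv DERIV_isCont in auto)

lemma set_integral_hausdorff_eq:
  assumes "A \<subseteq> sphere 0 1"
  shows "(LINT u : A | hausdorff_measure (CARD('n) - 1). f u) = (\<integral>u. indicator A u * (f u :: real) \<partial>\<omega>)"
proof -
  have "(\<integral>u. indicator A u * f u \<partial>\<omega>)
      = (\<integral>u. indicator (sphere 0 1) u *\<^sub>R (indicator A u * f u) \<partial>hausdorff_measure (CARD('n) - 1))"
    unfolding sphere_measure_def using sphere_in_hausdorff_sets by (intro integral_restrict_space) simp
  also have "\<dots> = (\<integral>u. indicator A u * f u \<partial>hausdorff_measure (CARD('n) - 1))"
    using assms by (intro Bochner_Integration.integral_cong) (auto split: split_indicator)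
  finally show ?thesis by (simp add: set_lebesgue_integral_def)
qed

text \<open>In the convention that the Bochner integral of a non-integrable function is \<open>0\<close>, the growth
  hypothesis yields integrability of \<open>G t\<close> on the cap, and thereby the finiteness of \<open>\<omega>\<close>, as
  well as the positivity of the total mass.\<close>

lemma cap_integral_positive:
  assumes v: "v \<in> sphere 0 1"
  obtains t where "0 < t" "0 < (\<integral>u. indicator {u \<in> sphere 0 1. u \<bullet> v \<ge> \<epsilon>\<^sub>0} u * G t u \<partial>\<omega>)"
proof -
  let ?A = "{u \<in> sphere 0 1. u \<bullet> v \<ge> \<epsilon>\<^sub>0}"
  have "eventually (\<lambda>t. 0 < (LINT u : ?A | hausdorff_measure (CARD('n) - 1). G t u)) (at_right 0)"
    using G_lim[OF v] by (simp add: filterlim_at_top_dense)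
  then obtain t :: real where "0 < t" "0 < (LINT u : ?A | hausdorff_measure (CARD('n) - 1). G t u)"
    using eventually_happens[OF eventually_conj[OF eventually_at_right_less]] trivial_limit_at_right_real by blast
  moreover have "(LINT u : ?A | hausdorff_measure (CARD('n) - 1). G t u) = (\<integral>u. indicator ?A u * G t u \<partial>\<omega>)"
    by (rule set_integral_hausdorff_eq) auto
  ultimately show thesis by (intro that[of t]) (simp_all only:)
qed

lemma sphere_measure_finite: "emeasure \<omega> (sphere 0 1) \<noteq> \<infinity>"
proof -
  have cap: "emeasure \<omega> {u \<in> sphere 0 1. u \<bullet> v \<ge> \<epsilon>\<^sub>0} < \<infinity>" if v: "v \<in> sphere 0 1" for v
  proof -
    let ?A = "{u \<in> sphere 0 1. u \<bullet> v \<ge> \<epsilon>\<^sub>0}"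
    obtain t where t: "0 < t" "0 < (\<integral>u. indicator ?A u * G t u \<partial>\<omega>)"
      using cap_integral_positive[OF v] .
    have int: "integrable \<omega> (\<lambda>u. indicator ?A u * G t u)"
      using not_integrable_integral_eq t(2) by force
    have c: "continuous_on (sphere 0 1) (\<lambda>u. G t u)"
      using continuous_on_G(1)[of "\<lambda>_. t"] t(1) by simp
    obtain w where w: "w \<in> sphere 0 1" "\<And>u. u \<in> sphere 0 1 \<Longrightarrow> G t w \<le> G t u"
      using continuous_attains_inf[OF compact_sphere sphere_nonempty c] by auto
    have pos: "0 < G t w" using G_pos t(1) w(1) by blast
    have A: "?A \<in> sets \<omega>" by (rule cap_in_sets)
    have "integrable \<omega> (\<lambda>u. indicator ?A u * G t w)"
    proof (rule Bochner_Integration.integrable_bound[OF int])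
      have "norm (indicator ?A u * G t w) \<le> norm (indicator ?A u * G t u)" if "u \<in> space \<omega>" for u
        using w(2)[of u] pos that by (cases "u \<in> ?A") auto
      then show "AE u in \<omega>. norm (indicator ?A u * G t w) \<le> norm (indicator ?A u * G t u)"
        by (rule AE_I2)
      show "(\<lambda>u. indicator ?A u * G t w) \<in> borel_measurable \<omega>"
        by (intro borel_measurable_times borel_measurable_indicator A borel_measurable_const)
    qed
    then have "integrable \<omega> (\<lambda>u. indicator ?A u :: real)" using pos by simp
    then have "emeasure \<omega> (?A \<inter> space \<omega>) < \<infinity>"
      by (subst (asm) integrable_indicator_iff) auto
    moreover have "?A \<inter> space \<omega> = ?A" by auto
    ultimately show ?thesis by (simp only:)
  qed
  obtain V :: "(real ^ 'n) set" where V: "finite V" "V \<subseteq> sphere 0 1"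
    "sphere 0 1 \<subseteq> (\<Union>v\<in>V. {u\<in>sphere 0 1. u \<bullet> v \<ge> \<epsilon>\<^sub>0})"
    using sphere_covered_by_caps[OF eps(2)] by blast
  have "emeasure \<omega> (sphere 0 1) \<le> emeasure \<omega> (\<Union>v\<in>V. {u\<in>sphere 0 1. u \<bullet> v \<ge> \<epsilon>\<^sub>0})"
    by (rule emeasure_mono[OF V(3)]) (use V(1) cap_in_sets in auto)
  also have "\<dots> \<le> (\<Sum>v\<in>V. emeasure \<omega> {u\<in>sphere 0 1. u \<bullet> v \<ge> \<epsilon>\<^sub>0})"
    by (rule emeasure_subadditive_finite) (use V(1) cap_in_sets in auto)
  also have "\<dots> < \<infinity>" using V cap by (simp add: subset_iff)
  finally show ?thesis by simp
qed

sublocale omega: finite_measure \<omega>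
  by (rule finite_measureI) (use sphere_measure_finite in simp)

sublocale mu: finite_measure \<mu> by (rule mu_finite)

lemma sphere_measure_nonzero: "emeasure \<omega> (sphere 0 1) \<noteq> 0"
proof
  assume 0: "emeasure \<omega> (sphere 0 1) = 0"
  obtain v :: "real ^ 'n" where v: "v \<in> sphere 0 1" using sphere_nonempty by blast
  obtain t where t: "0 < t" "0 < (\<integral>u. indicator {u \<in> sphere 0 1. u \<bullet> v \<ge> \<epsilon>\<^sub>0} u * G t u \<partial>\<omega>)"
    using cap_integral_positive[OF v] .
  have "AE u in \<omega>. False"
    using 0 sets.top[of \<omega>] by (intro AE_I[of _ _ "sphere 0 1"]) auto
  then have "(\<integral>u. indicator {u \<in> sphere 0 1. u \<bullet> v \<ge> \<epsilon>\<^sub>0} u * G t u \<partial>\<omega>) = 0"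
    by (intro integral_eq_zero_AE) auto
  with t show False by simp
qed

lemma continuous_on_integrable:
  fixes f :: "real ^ 'n \<Rightarrow> real"
  assumes f: "continuous_on (sphere 0 1) f" shows "integrable \<mu> f" "integrable \<omega> f"
proof -
  have "bounded (f ` sphere 0 1)"
    by (intro compact_imp_bounded compact_continuous_image f compact_sphere)
  then obtain B where "\<forall>y\<in>f ` sphere 0 1. norm y \<le> B" unfolding bounded_iff by blast
  then have B: "\<And>u. u \<in> sphere 0 1 \<Longrightarrow> norm (f u) \<le> B" by blast
  show "integrable \<mu> f"
    by (rule mu.integrable_const_bound[of _ B])
      (use B continuous_on_measurable_mu[OF f] in \<open>auto intro!: AE_I2 simp: space_mu\<close>)
  show "integrable \<omega> f"
    by (rule omega.integrable_const_bound[of _ B])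
      (use B continuous_on_measurable_sphere_measure[OF f] in \<open>auto intro!: AE_I2\<close>)
qed

definition energy :: "(real ^ 'n \<Rightarrow> real) \<Rightarrow> real" where
  "energy f = (\<integral>u. \<phi> (f u) \<partial>\<mu>) + (\<integral>u. G (1 / wulff_gauge f u) u \<partial>\<omega>)"

lemma continuous_on_energy_integrands:
  assumes f: "positive_on_sphere f"
  shows "continuous_on (sphere 0 1) (\<lambda>u. \<phi> (f u))"
    "continuous_on (sphere 0 1) (\<lambda>u. G (1 / wulff_gauge f u) u)"
    "continuous_on (sphere 0 1) (\<lambda>u. 1 / wulff_gauge f u)"
proof -
  show "continuous_on (sphere 0 1) (\<lambda>u. \<phi> (f u))"
    using positive_on_sphereD[OF f] by (intro continuous_on_compose2[OF continuous_on_phi]) auto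
  show *: "continuous_on (sphere 0 1) (\<lambda>u. 1 / wulff_gauge f u)"
    using continuous_on_wulff_gauge[OF f] wulff_gauge_pos[OF f]
    by (intro continuous_intros) (auto simp: less_imp_neq[THEN not_sym])
  show "continuous_on (sphere 0 1) (\<lambda>u. G (1 / wulff_gauge f u) u)"
    using wulff_gauge_pos[OF f] by (intro continuous_on_G *) auto
qed

lemmas energy_integrable =
  continuous_on_integrable(1)[OF continuous_on_energy_integrands(1)]
  continuous_on_integrable(2)[OF continuous_on_energy_integrands(2)]

lemma energy_parts_nonneg:
  assumes f: "positive_on_sphere f"
  shows "0 \<le> (\<integral>u. \<phi> (f u) \<partial>\<mu>)" "0 \<le> (\<integral>u. G (1 / wulff_gauge f u) u \<partial>\<omega>)"
proof -
  show "0 \<le> (\<integral>u. \<phi> (f u) \<partial>\<mu>)"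
    by (rule Bochner_Integration.integral_nonneg)
      (use positive_on_sphereD(2)[OF f] in \<open>auto simp: space_mu intro!: phi_nonneg\<close>)
  show "0 \<le> (\<integral>u. G (1 / wulff_gauge f u) u \<partial>\<omega>)"
    by (rule Bochner_Integration.integral_nonneg)
      (use wulff_gauge_pos[OF f] in \<open>auto intro!: less_imp_le[OF G_pos]\<close>)
qed

lemma energy_support_function_wulff_shape_le:
  assumes f: "positive_on_sphere f"
  shows "energy (support_function (wulff_shape f)) \<le> energy f"
proof -
  let ?h = "support_function (wulff_shape f)"
  have h: "positive_on_sphere ?h"
    by (intro positive_on_sphere_support_function wulff_shape_convex_body f)
  have "(\<integral>u. \<phi> (?h u) \<partial>\<mu>) \<le> (\<integral>u. \<phi> (f u) \<partial>\<mu>)"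
    using support_function_wulff_shape_le[OF f] positive_on_sphereD(2)[OF h]
    by (intro integral_mono energy_integrable f h phi_mono) (auto simp: space_mu)
  moreover have "(\<integral>u. G (1 / wulff_gauge ?h u) u \<partial>\<omega>) = (\<integral>u. G (1 / wulff_gauge f u) u \<partial>\<omega>)"
    using wulff_gauge_support_function_wulff_shape[OF f]
    by (intro Bochner_Integration.integral_cong) auto
  ultimately show ?thesis by (simp add: energy_def)
qed

text \<open>The integral of \<open>(u \<bullet> v)\<^sub>+\<close> is a continuous positive function of \<open>v\<close>, so it has a positive
  minimum \<open>I w\<close> on the sphere. At most half of that minimum can come from the region
  \<open>u \<bullet> v < a\<close>, by the choice of \<open>a\<close>; the rest bounds the mass of the cap because
  \<open>u \<bullet> v \<le> 1\<close>.\<close>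

lemma hemisphere_mass_lower_bound:
  assumes nc: "not_concentrated_on_closed_hemisphere \<mu>"
  obtains a m where "0 < a" "0 < m" "\<And>v. v \<in> sphere 0 1 \<Longrightarrow> m \<le> measure \<mu> {u \<in> sphere 0 1. u \<bullet> v \<ge> a}"
proof -
  define I where "I v = (\<integral>u. max (u \<bullet> v) 0 \<partial>\<mu>)" for v
  have int: "integrable \<mu> (\<lambda>u. max (u \<bullet> v) 0)" for v
    by (intro continuous_on_integrable continuous_intros)
  have lip: "\<bar>I v - I w\<bar> \<le> measure \<mu> (space \<mu>) * norm (v - w)" for v w
  proof -
    have *: "I v - I w \<le> measure \<mu> (space \<mu>) * norm (v - w)" for v w
    proof -
      have "I v - I w = (\<integral>u. max (u \<bullet> v) 0 - max (u \<bullet> w) 0 \<partial>\<mu>)" by (simp add: I_def int)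
      also have "\<dots> \<le> (\<integral>u. norm (v - w) \<partial>\<mu>)"
      proof (rule integral_mono)
        fix u assume "u \<in> space \<mu>"
        then have "(v - w) \<bullet> u \<le> norm (v - w)" by (intro inner_unit_le) (simp add: space_mu)
        then have "u \<bullet> v - u \<bullet> w \<le> norm (v - w)" by (simp add: inner_diff_left inner_commute[of u])
        then show "max (u \<bullet> v) 0 - max (u \<bullet> w) 0 \<le> norm (v - w)"
          using norm_ge_zero[of "v - w"] unfolding max_def by (cases "u \<bullet> v \<le> 0"; cases "u \<bullet> w \<le> 0"; simp; linarith)
      qed (auto intro!: int Bochner_Integration.integrable_diff)
      finally show ?thesis by simp
    qed
    show ?thesis using *[of v w] *[of w v] by (simp add: norm_minus_commute abs_le_iff)
  qed
  have "(measure \<mu> (space \<mu>))-lipschitz_on (sphere 0 1) I"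
    using lip by (intro lipschitz_onI) (auto simp: dist_norm)
  then have "continuous_on (sphere 0 1) I" by (rule lipschitz_on_continuous_on)
  then obtain w where w: "w \<in> sphere 0 1" "\<And>v. v \<in> sphere 0 1 \<Longrightarrow> I w \<le> I v"
    using continuous_attains_inf[OF compact_sphere sphere_nonempty] by blast
  have Iw: "0 < I w" using nc w(1) by (simp add: not_concentrated_on_closed_hemisphere_def I_def)
  define T where "T = measure \<mu> (space \<mu>)"
  have T: "0 \<le> T" by (simp add: T_def)
  define a where "a = I w / (2 * (T + 1))"
  have a: "0 < a" "a * T \<le> I w / 2" using Iw T by (auto simp: a_def field_simps)
  have "I w / 2 \<le> measure \<mu> {u \<in> sphere 0 1. u \<bullet> v \<ge> a}" if v: "v \<in> sphere 0 1" for v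
  proof -
    let ?A = "{u \<in> sphere 0 1. u \<bullet> v \<ge> a}"
    have A: "?A \<in> sets \<mu>"
      unfolding mu_sets sets_restrict_space
      by (intro image_eqI[of _ _ ?A] borel_closed compact_imp_closed compact_cap) auto
    have "I w \<le> I v" by (rule w(2)[OF v])
    also have "\<dots> \<le> (\<integral>u. a + indicator ?A u \<partial>\<mu>)"
      unfolding I_def
    proof (rule integral_mono)
      fix u assume u: "u \<in> space \<mu>"
      then have "u \<bullet> v \<le> 1" using inner_unit_le[OF v, of u] by (simp add: space_mu)
      with u a(1) show "max (u \<bullet> v) 0 \<le> a + indicator ?A u"
        by (auto simp: space_mu split: split_indicator)
    qed (use A int in \<open>auto intro!: Bochner_Integration.integrable_add simp: mu.emeasure_finite less_top[symmetric]\<close>)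
    also have "\<dots> = a * T + measure \<mu> ?A"
      using A by (subst Bochner_Integration.integral_add)
        (auto simp: T_def mu.emeasure_finite less_top[symmetric] Int_absorb2 sets.sets_into_space)
    finally show ?thesis using a(2) by linarith
  qed
  with a(1) Iw show thesis by (intro that[of a "I w / 2"]) auto
qed

text \<open>If \<open>x \<in> K\<close>, the support function is at least \<open>a \<bar>x\<bar>\<close> on the cap around \<open>x / \<bar>x\<bar>\<close>, whose
  mass is at least \<open>m\<close>. So the energy is at least \<open>m \<phi>(a \<bar>x\<bar>)\<close>, which is unbounded in \<open>\<bar>x\<bar>\<close>.\<close>

lemma bounded_energy_imp_bounded_body:
  assumes nc: "not_concentrated_on_closed_hemisphere \<mu>"
  obtains R where "\<And>K. K \<in> convex_bodies_o \<Longrightarrow> energy (support_function K) \<le> C \<Longrightarrow> K \<subseteq> cball 0 R"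
proof -
  obtain a m where a: "0 < a" and m: "0 < m"
    and am: "\<And>v. v \<in> sphere 0 1 \<Longrightarrow> m \<le> measure \<mu> {u \<in> sphere 0 1. u \<bullet> v \<ge> a}"
    using hemisphere_mass_lower_bound[OF nc] by blast
  obtain T where T: "0 < T" "C / m < \<phi> T" using phi_unbounded by blast
  have "K \<subseteq> cball 0 (T / a)" if K: "K \<in> convex_bodies_o" and E: "energy (support_function K) \<le> C" for K
  proof
    fix x assume x: "x \<in> K"
    show "x \<in> cball 0 (T / a)"
    proof (rule ccontr)
      assume "x \<notin> cball 0 (T / a)"
      then have big: "T / a < norm x" by simp
      then have x0: "x \<noteq> 0" using divide_pos_pos[OF T(1) a] by auto
      define v where "v = (1 / norm x) *\<^sub>R x"
      have v: "v \<in> sphere 0 1" using x0 by (simp add: v_def)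
      let ?A = "{u \<in> sphere 0 1. u \<bullet> v \<ge> a}" and ?h = "support_function K"
      have A: "?A \<in> sets \<mu>"
        unfolding mu_sets sets_restrict_space
        by (intro image_eqI[of _ _ ?A] borel_closed compact_imp_closed compact_cap) auto
      note h = positive_on_sphere_support_function[OF K]
      have hT: "T \<le> ?h u" if "u \<in> ?A" for u
      proof -
        have "T < a * norm x" using big a by (simp add: pos_divide_less_eq mult.commute)
        also have "\<dots> \<le> (u \<bullet> v) * norm x" using that by (intro mult_right_mono) auto
        also have "\<dots> = u \<bullet> x" using x0 by (simp add: v_def)
        also have "\<dots> \<le> ?h u" using K x by (intro inner_le_support_function) (auto simp: convex_bodies_o_def)
        finally show ?thesis by simp
      qed
      have "C < m * \<phi> T" using T(2) m by (simp add: pos_divide_less_eq mult.commute)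
      also have "\<dots> \<le> measure \<mu> ?A * \<phi> T" using am[OF v] phi_nonneg[OF T(1)] by (intro mult_right_mono)
      also have "\<dots> = (\<integral>u. indicator ?A u * \<phi> T \<partial>\<mu>)"
        using A by (simp add: Int_absorb2 sets.sets_into_space)
      also have "\<dots> \<le> (\<integral>u. \<phi> (?h u) \<partial>\<mu>)"
      proof (rule integral_mono)
        fix u assume "u \<in> space \<mu>"
        then have "0 < ?h u" using positive_on_sphereD(2)[OF h] by (simp add: space_mu)
        then show "indicator ?A u * \<phi> T \<le> \<phi> (?h u)"
          using hT[of u] phi_mono[OF T(1)] phi_nonneg by (auto split: split_indicator)
      qed (use A energy_integrable(1)[OF h] in \<open>auto simp: mu.emeasure_finite less_top[symmetric]\<close>)
      also have "\<dots> \<le> energy ?h" using energy_parts_nonneg(2)[OF h] by (simp add: energy_def)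
      finally show False using E by simp
    qed
  qed
  then show thesis by (rule that)
qed

lemma wulff_gauge_diff_le:
  assumes f: "positive_on_sphere f" and g: "positive_on_sphere g" and u: "u \<in> sphere 0 1"
    and a: "0 < a" "\<And>v. v \<in> sphere 0 1 \<Longrightarrow> a \<le> f v" "\<And>v. v \<in> sphere 0 1 \<Longrightarrow> a \<le> g v"
    and d: "0 \<le> d" "\<And>v. v \<in> sphere 0 1 \<Longrightarrow> \<bar>f v - g v\<bar> \<le> d"
  shows "\<bar>wulff_gauge f u - wulff_gauge g u\<bar> \<le> d / a\<^sup>2"
proof -
  have *: "wulff_gauge g u - wulff_gauge f u \<le> d / a\<^sup>2"
    if f: "positive_on_sphere f" and g: "positive_on_sphere g"
      and af: "\<And>v. v \<in> sphere 0 1 \<Longrightarrow> a \<le> f v" and ag: "\<And>v. v \<in> sphere 0 1 \<Longrightarrow> a \<le> g v"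
      and d': "\<And>v. v \<in> sphere 0 1 \<Longrightarrow> \<bar>f v - g v\<bar> \<le> d" for f g
  proof -
    have fle: "f v \<le> (1 + d / a) * g v" if v: "v \<in> sphere 0 1" for v
    proof -
      have "f v \<le> g v + d" using d'[OF v] by linarith
      also have "d \<le> d / a * g v"
        using mult_left_mono[OF ag[OF v], of "d / a"] a(1) d(1) by simp
      finally show ?thesis by (simp add: algebra_simps)
    qed
    have "wulff_gauge g u \<le> (1 + d / a) * wulff_gauge f u"
      by (rule wulff_gauge_mono[OF f g u fle])
    also have "\<dots> \<le> wulff_gauge f u + d / a * (1 / a)"
    proof -
      obtain b where b: "\<And>v. v \<in> sphere 0 1 \<Longrightarrow> f v \<le> b" using positive_on_sphere_bounds[OF f] by metis
      have "wulff_gauge f u \<le> 1 / a" by (rule wulff_gauge_bounds(2)[OF f u a(1) af b])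
      then have "d / a * wulff_gauge f u \<le> d / a * (1 / a)"
        using a(1) d(1) by (intro mult_left_mono) auto
      then show ?thesis by (simp add: algebra_simps)
    qed
    finally show ?thesis by (simp add: power2_eq_square)
  qed
  have d2: "\<bar>g v - f v\<bar> \<le> d" if "v \<in> sphere 0 1" for v
    using d(2)[OF that] by (simp add: abs_minus_commute)
  show ?thesis using *[OF f g a(2,3) d(2)] *[OF g f a(3,2) d2] by (simp add: abs_le_iff)
qed

end

section \<open>Existence of a minimizer\<close>

lemma positive_on_sphereI:
  "continuous_on (sphere 0 1) f \<Longrightarrow> (\<And>v. v \<in> sphere 0 1 \<Longrightarrow> 0 < f v) \<Longrightarrow> positive_on_sphere f"
  by (simp add: positive_on_sphere_def)

context orlicz_minkowski_problem
begin

text \<open>If \<open>h\<^sub>n(v) \<rightarrow> 0\<close>, the radial functions are at most \<open>h\<^sub>n(v) / \<epsilon>\<^sub>0\<close> on the cap around \<open>v\<close>,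
  and since \<open>G\<close> is decreasing in \<open>t\<close> the second term of the energy tends to infinity.\<close>

lemma limit_of_bounded_energy_positive:
  fixes h :: "nat \<Rightarrow> real ^ 'n \<Rightarrow> real"
  assumes h: "\<And>n. positive_on_sphere (h n)" and E: "\<And>n. energy (h n) \<le> C"
    and lim: "(\<lambda>n. h n v) \<longlonglongrightarrow> l" and v: "v \<in> sphere 0 1"
  shows "0 < l"
proof (rule ccontr)
  assume "\<not> 0 < l"
  moreover have hp: "0 < h n v" for n using positive_on_sphereD(2)[OF h v] .
  then have "0 \<le> l" by (intro LIMSEQ_le_const[OF lim]) (auto intro: less_imp_le)
  ultimately have "l = 0" by simp
  let ?A = "{u \<in> sphere 0 1. u \<bullet> v \<ge> \<epsilon>\<^sub>0}"
  define t where "t n = h n v / \<epsilon>\<^sub>0" for n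
  have tp: "0 < t n" for n using hp eps(1) by (simp add: t_def)
  have "t \<longlonglongrightarrow> 0 / \<epsilon>\<^sub>0"
    unfolding t_def using lim \<open>l = 0\<close> eps(1) by (intro tendsto_intros) auto
  then have "filterlim t (at_right 0) sequentially"
    using tp by (auto simp: filterlim_at less_imp_neq[THEN not_sym])
  with G_lim[OF v] have "filterlim (\<lambda>n. LINT u : ?A | hausdorff_measure (CARD('n) - 1). G (t n) u) at_top sequentially"
    by (rule filterlim_compose)
  then have "eventually (\<lambda>n. C < (LINT u : ?A | hausdorff_measure (CARD('n) - 1). G (t n) u)) sequentially"
    by (simp add: filterlim_at_top_dense)
  then obtain n where n: "C < (LINT u : ?A | hausdorff_measure (CARD('n) - 1). G (t n) u)"
    by (auto simp: eventually_sequentially)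
  have "(LINT u : ?A | hausdorff_measure (CARD('n) - 1). G (t n) u) = (\<integral>u. indicator ?A u * G (t n) u \<partial>\<omega>)"
    by (rule set_integral_hausdorff_eq) auto
  also have "\<dots> \<le> (\<integral>u. G (1 / wulff_gauge (h n) u) u \<partial>\<omega>)"
  proof (rule integral_mono)
    have "continuous_on (sphere 0 1) (G (t n))" using continuous_on_G(1)[of "\<lambda>_. t n"] tp by simp
    then show "integrable \<omega> (\<lambda>u. indicator ?A u * G (t n) u)"
      using integrable_real_mult_indicator[OF cap_in_sets continuous_on_integrable(2)]
      by (simp add: mult.commute)
    show "integrable \<omega> (\<lambda>u. G (1 / wulff_gauge (h n) u) u)" by (rule energy_integrable(2)[OF h])
    fix u assume "u \<in> space \<omega>"
    then have u: "u \<in> sphere 0 1" by simp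
    note gp = wulff_gauge_pos[OF h[of n] u]
    show "indicator ?A u * G (t n) u \<le> G (1 / wulff_gauge (h n) u) u"
    proof (cases "u \<in> ?A")
      case True
      then have "\<epsilon>\<^sub>0 \<le> wulff_gauge (h n) u * h n v"
        using wulff_gauge_attained(2)[OF h v, of u n] by simp
      then have "1 / wulff_gauge (h n) u \<le> t n"
        using gp eps(1) by (simp add: t_def field_simps)
      then show ?thesis using True gp u by (auto intro!: G_antimono)
    next
      case False
      then show ?thesis using G_pos[OF _ u] gp by (simp add: less_imp_le)
    qed
  qed
  also have "\<dots> \<le> energy (h n)" using energy_parts_nonneg(1)[OF h] by (simp add: energy_def)
  finally show False using n E[of n] by simp
qed

text \<open>By uniform convergence to a positive limit, the \<open>h n\<close> and the radial functions stay in a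
  compact subset of \<open>(0, \<infinity>)\<close> from some index on. There both integrands are dominated and
  converge pointwise.\<close>

lemma energy_tendsto:
  fixes h :: "nat \<Rightarrow> real ^ 'n \<Rightarrow> real"
  assumes h: "\<And>n. positive_on_sphere (h n)" and f: "positive_on_sphere f"
    and lim: "uniform_limit (sphere 0 1) h f sequentially"
  shows "(\<lambda>n. energy (h n)) \<longlonglongrightarrow> energy f"
proof -
  obtain a b where ab: "0 < a" "a \<le> b" "\<And>v. v \<in> sphere 0 1 \<Longrightarrow> a \<le> f v" "\<And>v. v \<in> sphere 0 1 \<Longrightarrow> f v \<le> b"
    using positive_on_sphere_bounds[OF f] by metis
  have ev: "\<exists>N. \<forall>n\<ge>N. \<forall>v\<in>sphere 0 1. \<bar>h n v - f v\<bar> < e" if "0 < e" for e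
    using uniform_limitD[OF lim that] by (simp add: dist_real_def eventually_sequentially)
  obtain N where N: "\<And>n v. N \<le> n \<Longrightarrow> v \<in> sphere 0 1 \<Longrightarrow> \<bar>h n v - f v\<bar> < a / 2"
    using ev[OF half_gt_zero[OF \<open>0 < a\<close>]] by blast
  have low: "a / 2 \<le> h n v" and up: "h n v \<le> b + a / 2" if "N \<le> n" "v \<in> sphere 0 1" for n v
    using N[OF that] ab(3,4)[OF that(2)] by linarith+
  have 1: "(\<lambda>n. \<integral>u. \<phi> (h (n + N) u) \<partial>\<mu>) \<longlonglongrightarrow> (\<integral>u. \<phi> (f u) \<partial>\<mu>)"
  proof (rule integral_dominated_convergence[where w = "\<lambda>_. \<phi> (b + a / 2)"])
    show "(\<lambda>u. \<phi> (f u)) \<in> borel_measurable \<mu>" "(\<lambda>u. \<phi> (h (n + N) u)) \<in> borel_measurable \<mu>" for n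
      by (rule continuous_on_measurable_mu continuous_on_energy_integrands(1) f h)+
    show "AE u in \<mu>. (\<lambda>n. \<phi> (h (n + N) u)) \<longlonglongrightarrow> \<phi> (f u)"
    proof (rule AE_I2)
      fix u assume "u \<in> space \<mu>"
      then have u: "u \<in> sphere 0 1" by (simp add: space_mu)
      have "(\<lambda>n. h (n + N) u) \<longlonglongrightarrow> f u"
        using tendsto_uniform_limitI[OF lim u] by (rule LIMSEQ_ignore_initial_segment)
      moreover have "isCont \<phi> (f u)"
        using phi_deriv[OF positive_on_sphereD(2)[OF f u]] by (rule DERIV_isCont)
      ultimately show "(\<lambda>n. \<phi> (h (n + N) u)) \<longlonglongrightarrow> \<phi> (f u)" by (rule isCont_tendsto_compose[rotated])
    qed
    show "AE u in \<mu>. norm (\<phi> (h (n + N) u)) \<le> \<phi> (b + a / 2)" for n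
    proof (rule AE_I2)
      fix u assume "u \<in> space \<mu>"
      then have u: "u \<in> sphere 0 1" by (simp add: space_mu)
      have p: "0 < h (n + N) u" using positive_on_sphereD(2)[OF h u] .
      then show "norm (\<phi> (h (n + N) u)) \<le> \<phi> (b + a / 2)"
        using phi_mono[OF p up[OF _ u]] phi_nonneg[OF p] by simp
    qed
  qed auto
  have 2: "(\<lambda>n. \<integral>u. G (1 / wulff_gauge (h (n + N)) u) u \<partial>\<omega>) \<longlonglongrightarrow> (\<integral>u. G (1 / wulff_gauge f u) u \<partial>\<omega>)"
  proof (rule integral_dominated_convergence[where w = "\<lambda>u. G (a / 2) u"])
    show "(\<lambda>u. G (1 / wulff_gauge f u) u) \<in> borel_measurable \<omega>"
      "(\<lambda>u. G (1 / wulff_gauge (h (n + N)) u) u) \<in> borel_measurable \<omega>" for n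
      by (rule continuous_on_measurable_sphere_measure continuous_on_energy_integrands(2) f h)+
    show "integrable \<omega> (\<lambda>u. G (a / 2) u)"
      using continuous_on_G(1)[of "\<lambda>_. a / 2"] ab(1) by (intro continuous_on_integrable) simp
    show "AE u in \<omega>. (\<lambda>n. G (1 / wulff_gauge (h (n + N)) u) u) \<longlonglongrightarrow> G (1 / wulff_gauge f u) u"
    proof (rule AE_I2)
      fix u assume "u \<in> space \<omega>"
      then have u: "u \<in> sphere 0 1" by simp
      have "(\<lambda>n. wulff_gauge (h (n + N)) u) \<longlonglongrightarrow> wulff_gauge f u"
      proof (rule LIMSEQ_I)
        fix r :: real assume r: "0 < r"
        define d where "d = r * (a / 2)\<^sup>2 / 2"
        have d: "0 < d" using r ab(1) by (simp add: d_def)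
        obtain M where M: "\<And>n v. M \<le> n \<Longrightarrow> v \<in> sphere 0 1 \<Longrightarrow> \<bar>h n v - f v\<bar> < d"
          using ev[OF d] by blast
        have "norm (wulff_gauge (h (n + N)) u - wulff_gauge f u) < r" if n: "M \<le> n" for n
        proof -
          have "\<bar>wulff_gauge (h (n + N)) u - wulff_gauge f u\<bar> \<le> d / (a / 2)\<^sup>2"
          proof (rule wulff_gauge_diff_le[OF h f u])
            show "\<bar>h (n + N) v - f v\<bar> \<le> d" if "v \<in> sphere 0 1" for v
              using M[OF _ that, of "n + N"] n by simp
            show "a / 2 \<le> f v" if "v \<in> sphere 0 1" for v using ab(1) ab(3)[OF that] by linarith
          qed (use ab(1) d low in auto)
          also have "\<dots> = r / 2" using ab(1) by (simp add: d_def)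
          finally show ?thesis using r by simp
        qed
        then show "\<exists>no. \<forall>n\<ge>no. norm (wulff_gauge (h (n + N)) u - wulff_gauge f u) < r" by blast
      qed
      then have "(\<lambda>n. 1 / wulff_gauge (h (n + N)) u) \<longlonglongrightarrow> 1 / wulff_gauge f u"
        using wulff_gauge_pos[OF f u] by (intro tendsto_intros) auto
      moreover have "isCont (\<lambda>s. G s u) (1 / wulff_gauge f u)"
        using G_deriv[OF _ u, of "1 / wulff_gauge f u"] wulff_gauge_pos[OF f u] by (auto intro: DERIV_isCont)
      ultimately show "(\<lambda>n. G (1 / wulff_gauge (h (n + N)) u) u) \<longlonglongrightarrow> G (1 / wulff_gauge f u) u"
        by (rule isCont_tendsto_compose[rotated])
    qed
    show "AE u in \<omega>. norm (G (1 / wulff_gauge (h (n + N)) u) u) \<le> G (a / 2) u" for n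
    proof (rule AE_I2)
      fix u assume "u \<in> space \<omega>"
      then have u: "u \<in> sphere 0 1" by simp
      note gp = wulff_gauge_pos[OF h[of "n + N"] u]
      have "wulff_gauge (h (n + N)) u \<le> 1 / (a / 2)"
        by (rule wulff_gauge_bounds(2)[OF h u, where b = "b + a / 2"]) (use ab(1) low up in auto)
      then have "a / 2 \<le> 1 / wulff_gauge (h (n + N)) u" using gp ab(1) by (simp add: field_simps)
      then have "G (1 / wulff_gauge (h (n + N)) u) u \<le> G (a / 2) u"
        using ab(1) u by (intro G_antimono) auto
      moreover have "0 < G (1 / wulff_gauge (h (n + N)) u) u" using gp by (intro G_pos u) simp
      ultimately show "norm (G (1 / wulff_gauge (h (n + N)) u) u) \<le> G (a / 2) u" by simp
    qed
  qed
  from tendsto_add[OF 1 2] have "(\<lambda>n. energy (h (n + N))) \<longlonglongrightarrow> energy f" by (simp add: energy_def)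
  then show ?thesis by (rule LIMSEQ_offset)
qed

text \<open>The direct method. The bodies of a minimizing sequence lie in a common ball, so their
  support functions are uniformly bounded and have a common Lipschitz constant, and a
  subsequence converges uniformly to some \<open>f\<close>. This \<open>f\<close> is positive, and its Wulff shape has
  energy at most the limit.\<close>

theorem energy_minimizer_exists:
  assumes nc: "not_concentrated_on_closed_hemisphere \<mu>"
  obtains K where "K \<in> convex_bodies_o"
    "\<And>f. positive_on_sphere f \<Longrightarrow> energy (support_function K) \<le> energy f"
proof -
  let ?J = "\<lambda>K. energy (support_function K)"
  note ps = positive_on_sphere_support_function
  have one: "positive_on_sphere (\<lambda>_ :: real ^ 'n. 1)" by (simp add: positive_on_sphere_def)
  have nonneg: "0 \<le> ?J K" if "K \<in> convex_bodies_o" for K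
    using energy_parts_nonneg[OF ps[OF that]] by (simp add: energy_def)
  define c where "c = (INF K\<in>convex_bodies_o. ?J K)"
  have bdd: "bdd_below (?J ` convex_bodies_o)" using nonneg by (auto intro!: bdd_belowI2[of _ 0])
  have c_le: "c \<le> ?J K" if "K \<in> convex_bodies_o" for K
    unfolding c_def using bdd that by (rule cINF_lower)
  have ne: "?J ` convex_bodies_o \<noteq> {}" using wulff_shape_convex_body[OF one] by blast
  have "\<exists>K\<in>convex_bodies_o. ?J K < c + 1 / (real n + 1)" for n :: nat
    using cInf_lessD[OF ne, of "c + 1 / (real n + 1)"] by (auto simp: c_def add_pos_nonneg)
  then obtain K where K: "\<And>n. K n \<in> convex_bodies_o" "\<And>n. ?J (K n) < c + 1 / (real n + 1)"
    by metis
  obtain R0 where R0: "\<And>K. K \<in> convex_bodies_o \<Longrightarrow> ?J K \<le> c + 1 \<Longrightarrow> K \<subseteq> cball 0 R0"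
    using bounded_energy_imp_bounded_body[OF nc] by blast
  have Kc: "?J (K n) \<le> c + 1" for n
  proof -
    have "1 / (real n + 1) \<le> 1" by simp
    then show ?thesis using K(2)[of n] by linarith
  qed
  define R where "R = max R0 1"
  have KR: "K n \<subseteq> cball 0 R" for n using R0[OF K(1) Kc, of n] by (auto simp: R_def)
  have "0 < R" by (simp add: R_def)
  let ?h = "\<lambda>n. support_function (K n)"
  have bound: "norm (?h n v) \<le> R" if v: "v \<in> sphere 0 1" for n v
  proof -
    have "?h n v \<le> R"
    proof (rule support_function_le[OF convex_body_nonempty[OF K(1)]])
      fix x assume "x \<in> K n"
      then show "v \<bullet> x \<le> R" using KR[of n] inner_unit_le[OF v, of x] by (force simp: inner_commute)
    qed
    then show ?thesis using positive_on_sphereD(2)[OF ps[OF K(1)] v, of n] by simp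
  qed
  obtain f k where f: "continuous_on (sphere 0 1) f" and k: "strict_mono (k :: nat \<Rightarrow> nat)"
    and ul: "\<And>e. 0 < e \<Longrightarrow> \<exists>N. \<forall>n x. n \<ge> N \<and> x \<in> sphere 0 1 \<longrightarrow> norm (?h (k n) x - f x) < e"
  proof (rule Arzela_Ascoli[of "sphere 0 1" ?h R])
    fix x :: "real ^ 'n" and e :: real assume "x \<in> sphere 0 1" "0 < e"
    show "\<exists>d>0. \<forall>n y. y \<in> sphere 0 1 \<and> norm (x - y) < d \<longrightarrow> norm (?h n x - ?h n y) < e"
    proof (intro exI[of _ "e / R"] conjI allI impI)
      show "0 < e / R" using \<open>0 < e\<close> \<open>0 < R\<close> by simp
      fix n and y :: "real ^ 'n" assume y: "y \<in> sphere 0 1 \<and> norm (x - y) < e / R"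
      have "\<bar>?h n x - ?h n y\<bar> \<le> R * norm (x - y)"
        using K(1)[of n] by (intro support_function_lipschitz convex_body_nonempty KR) (auto simp: convex_bodies_o_def)
      also have "\<dots> < e" using y \<open>0 < R\<close> by (simp add: pos_less_divide_eq mult.commute)
      finally show "norm (?h n x - ?h n y) < e" by simp
    qed
  qed (use bound that in auto)
  have unif: "uniform_limit (sphere 0 1) (\<lambda>n. ?h (k n)) f sequentially"
    unfolding uniform_limit_sequentially_iff dist_norm using ul by blast
  have fpos: "positive_on_sphere f"
  proof (rule positive_on_sphereI[OF f])
    fix v :: "real ^ 'n" assume v: "v \<in> sphere 0 1"
    show "0 < f v"
      by (rule limit_of_bounded_energy_positive[OF ps[OF K(1)] Kc tendsto_uniform_limitI[OF unif v] v])
  qed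
  have lim: "(\<lambda>n. ?J (K (k n))) \<longlonglongrightarrow> energy f"
    by (rule energy_tendsto[OF ps[OF K(1)] fpos unif])
  have "energy f \<le> c"
  proof (rule LIMSEQ_le[OF lim])
    have "(\<lambda>n. 1 / (real (k n) + 1)) \<longlonglongrightarrow> 0"
      using LIMSEQ_subseq_LIMSEQ[OF LIMSEQ_inverse_real_of_nat k] by (simp add: o_def inverse_eq_divide add.commute)
    from tendsto_add[OF tendsto_const[of c] this] show "(\<lambda>n. c + 1 / (real (k n) + 1)) \<longlonglongrightarrow> c" by simp
    show "\<exists>N. \<forall>n\<ge>N. ?J (K (k n)) \<le> c + 1 / (real (k n) + 1)" using K(2) less_imp_le by blast
  qed
  then have min: "?J (wulff_shape f) \<le> c"
    using energy_support_function_wulff_shape_le[OF fpos] by simp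
  show thesis
  proof (rule that[OF wulff_shape_convex_body[OF fpos]])
    fix g :: "real ^ 'n \<Rightarrow> real" assume g: "positive_on_sphere g"
    show "?J (wulff_shape f) \<le> energy g"
      using min c_le[OF wulff_shape_convex_body[OF g]] energy_support_function_wulff_shape_le[OF g] by linarith
  qed
qed

end

section \<open>First variation of the energy\<close>

text \<open>The mean value inequality in the logarithmic variable; \<open>t F'(t)\<close> is the derivative of \<open>F\<close>
  with respect to \<open>log t\<close>.\<close>

lemma abs_exp_reparametrized_diff_le:
  fixes F :: "real \<Rightarrow> real"
  assumes lo: "0 < lo" "lo \<le> x" "x \<le> hi" "lo \<le> x * exp L" "x * exp L \<le> hi"
    and F: "\<And>t. lo \<le> t \<Longrightarrow> t \<le> hi \<Longrightarrow> (F has_real_derivative F' t) (at t)"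
    and M: "\<And>t. lo \<le> t \<Longrightarrow> t \<le> hi \<Longrightarrow> \<bar>t * F' t\<bar> \<le> M"
  shows "\<bar>F (x * exp L) - F x\<bar> \<le> M * \<bar>L\<bar>"
proof -
  have x: "0 < x" using lo by simp
  have "norm (F (x * exp L) - F (x * exp 0)) \<le> M * norm (L - 0)"
  proof (rule field_differentiable_bound[where S = "{min 0 L..max 0 L}" and f = "\<lambda>s. F (x * exp s)"
        and f' = "\<lambda>s. x * exp s * F' (x * exp s)"])
    fix s assume s: "s \<in> {min 0 L..max 0 L}"
    have "x * exp (min 0 L) \<le> x * exp s" "x * exp s \<le> x * exp (max 0 L)"
      using s x by (auto intro!: mult_left_mono)
    moreover have "lo \<le> x * exp (min 0 L)" "x * exp (max 0 L) \<le> hi"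
      using lo by (auto simp: min_def max_def)
    ultimately have r: "lo \<le> x * exp s" "x * exp s \<le> hi" by linarith+
    have "((\<lambda>s. F (x * exp s)) has_real_derivative F' (x * exp s) * (x * exp s)) (at s)"
      by (rule DERIV_chain2[where f = F and g = "\<lambda>s. x * exp s", OF F[OF r]])
        (auto intro!: derivative_eq_intros)
    then show "((\<lambda>s. F (x * exp s)) has_real_derivative x * exp s * F' (x * exp s)) (at s within {min 0 L..max 0 L})"
      by (simp add: mult.commute has_field_derivative_at_within)
    show "norm (x * exp s * F' (x * exp s)) \<le> M" using M[OF r] by simp
  qed auto
  then show ?thesis by simp
qed

lemma exp_reparametrized_quotient_tendsto:
  fixes F :: "real \<Rightarrow> real"
  assumes F: "(F has_real_derivative D) (at x)"
    and t: "\<And>k. t k \<noteq> (0::real)" "t \<longlonglongrightarrow> 0" and L: "(\<lambda>k. L k / t k) \<longlonglongrightarrow> l"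
  shows "(\<lambda>k. (F (x * exp (L k)) - F x) / t k) \<longlonglongrightarrow> x * D * l"
proof -
  have "((\<lambda>s. F (x * exp s)) has_real_derivative D * x) (at 0)"
    by (rule DERIV_chain2) (use F in \<open>auto intro!: derivative_eq_intros\<close>)
  then obtain g where g: "\<And>z. F (x * exp z) - F (x * exp 0) = g z * (z - 0)" "isCont g 0" "g 0 = D * x"
    unfolding CARAT_DERIV by blast
  have "(\<lambda>k. L k / t k * t k) \<longlonglongrightarrow> l * 0" by (intro tendsto_mult L t)
  then have L0: "L \<longlonglongrightarrow> 0" using t(1) by simp
  have "(\<lambda>k. g (L k) * (L k / t k)) \<longlonglongrightarrow> g 0 * l"
    by (intro tendsto_mult L isCont_tendsto_compose[OF g(2) L0])
  moreover have "(\<lambda>k. (F (x * exp (L k)) - F x) / t k) = (\<lambda>k. g (L k) * (L k / t k))"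
    using g(1) by (auto simp: fun_eq_iff)
  ultimately show ?thesis by (simp only: g(3) mult.commute[of D x])
qed

lemma positive_on_sphere_perturbation:
  assumes "positive_on_sphere h" "continuous_on (sphere 0 1) g"
  shows "positive_on_sphere (\<lambda>v. h v * exp (t * g v))"
  using assms by (auto simp: positive_on_sphere_def intro!: continuous_intros)

lemma wulff_gauge_perturbation_bounds:
  assumes h: "positive_on_sphere h" and g: "continuous_on (sphere 0 1) g"
    and B: "\<And>v. v \<in> sphere 0 1 \<Longrightarrow> \<bar>g v\<bar> \<le> B" and t: "0 \<le> t" and u: "u \<in> sphere 0 1"
  shows "\<bar>ln (wulff_gauge h u / wulff_gauge (\<lambda>v. h v * exp (t * g v)) u)\<bar> \<le> t * B"
proof -
  let ?f = "\<lambda>v. h v * exp (t * g v)"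
  note f = positive_on_sphere_perturbation[OF h g, of t]
  note q = wulff_gauge_pos[OF h u] wulff_gauge_pos[OF f u]
  have tg: "t * g v \<le> t * B" "- (t * B) \<le> t * g v" if "v \<in> sphere 0 1" for v
    using mult_left_mono[of "g v" B t] mult_left_mono[of "- B" "g v" t] B[OF that] t by (auto simp: abs_le_iff)
  have "wulff_gauge h u \<le> exp (t * B) * wulff_gauge ?f u"
  proof (rule wulff_gauge_mono[OF f h u])
    fix v :: "real ^ 'a" assume v: "v \<in> sphere 0 1"
    show "?f v \<le> exp (t * B) * h v"
      using tg(1)[OF v] positive_on_sphereD(2)[OF h v] by (simp add: mult.commute)
  qed
  moreover have "wulff_gauge ?f u \<le> exp (t * B) * wulff_gauge h u"
  proof (rule wulff_gauge_mono[OF h f u])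
    fix v :: "real ^ 'a" assume v: "v \<in> sphere 0 1"
    have "1 \<le> exp (t * B + t * g v)" using tg(2)[OF v] by simp
    then show "h v \<le> exp (t * B) * ?f v"
      using positive_on_sphereD(2)[OF h v] by (simp add: exp_add mult.left_commute)
  qed
  ultimately have "ln (wulff_gauge h u / wulff_gauge ?f u) \<le> ln (exp (t * B))"
    "ln (wulff_gauge ?f u / wulff_gauge h u) \<le> ln (exp (t * B))"
    using q by (subst ln_le_cancel_iff; simp add: pos_divide_le_eq)+
  moreover have "ln (wulff_gauge ?f u / wulff_gauge h u) = - ln (wulff_gauge h u / wulff_gauge ?f u)"
    using q by (simp add: ln_div)
  ultimately show ?thesis by (simp add: abs_le_iff)
qed

text \<open>The logarithmic derivative of the radial function is the perturbation \<open>g\<close> at the normal. For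
  fixed \<open>k\<close> the quotient lies between \<open>g\<close> at a contact normal of the perturbed function and
  \<open>g\<close> at the contact normal \<open>\<alpha>\<close> of \<open>h\<close>: each of these is a competitor in the maximum that
  defines the other gauge. On the compact set \<open>?W\<close> where \<open>g \<le> g \<alpha> - \<epsilon>\<close>, uniqueness of \<open>\<alpha>\<close>
  leaves a gap \<open>\<eta>\<close> below the maximum for \<open>h\<close>. A small perturbation cannot close that gap, so
  the perturbed contact normals leave \<open>?W\<close>.\<close>

theorem wulff_gauge_log_derivative:
  fixes h g :: "real ^ 'n \<Rightarrow> real"
  assumes h: "positive_on_sphere h" and g: "continuous_on (sphere 0 1) g"
    and u: "u \<in> sphere 0 1" and ex1: "\<exists>!v. v \<in> contact_normals h u"
    and t: "\<And>k. 0 < t k" "t \<longlonglongrightarrow> 0"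
  shows "(\<lambda>k. ln (wulff_gauge h u / wulff_gauge (\<lambda>v. h v * exp (t k * g v)) u) / t k)
    \<longlonglongrightarrow> g (contact_map h u)"
proof (rule LIMSEQ_I)
  fix \<epsilon> :: real assume \<epsilon>: "0 < \<epsilon>"
  define f where "f k v = h v * exp (t k * g v)" for k v
  define q where "q k = wulff_gauge (f k) u" for k
  define Q where "Q = wulff_gauge h u"
  have f: "positive_on_sphere (f k)" for k
    unfolding f_def[abs_def] by (rule positive_on_sphere_perturbation[OF h g])
  have q: "0 < q k" for k unfolding q_def by (rule wulff_gauge_pos[OF f u])
  have Q: "0 < Q" unfolding Q_def by (rule wulff_gauge_pos[OF h u])
  define \<alpha> where "\<alpha> = contact_map h u"
  have \<alpha>: "\<alpha> \<in> sphere 0 1" "u \<bullet> \<alpha> = Q * h \<alpha>"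
    using contact_map_eq(1)[OF ex1, of \<alpha>] by (auto simp: \<alpha>_def contact_normals_def Q_def)
  have uniq: "v = \<alpha>" if "v \<in> sphere 0 1" "u \<bullet> v = Q * h v" for v
    using contact_map_eq(1)[OF ex1, of v] that by (simp add: \<alpha>_def contact_normals_def Q_def)
  obtain B where B: "\<And>v. v \<in> sphere 0 1 \<Longrightarrow> \<bar>g v\<bar> \<le> B"
  proof -
    have "bounded (g ` sphere 0 1)" by (intro compact_imp_bounded compact_continuous_image g compact_sphere)
    then obtain B where "\<forall>y\<in>g ` sphere 0 1. norm y \<le> B" unfolding bounded_iff by blast
    then show thesis by (intro that[of B]) force
  qed
  have hpos: "0 < h v" if "v \<in> sphere 0 1" for v by (rule positive_on_sphereD(2)[OF h that])
  have upper: "ln (Q / q k) / t k \<le> g \<alpha>" for k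
  proof -
    have "Q * h \<alpha> \<le> q k * f k \<alpha>"
      using wulff_gauge_attained(2)[OF f \<alpha>(1), of u k] \<alpha>(2) by (simp add: q_def)
    then have "Q / q k \<le> exp (t k * g \<alpha>)"
      using q hpos[OF \<alpha>(1)] by (simp add: f_def pos_divide_le_eq mult.left_commute mult.commute)
    then have "ln (Q / q k) \<le> t k * g \<alpha>"
      using Q q by (metis divide_pos_pos ln_exp ln_le_cancel_iff exp_gt_zero)
    then show ?thesis using t(1) by (simp add: pos_divide_le_eq mult.commute)
  qed
  have lower: "g v \<le> ln (Q / q k) / t k" if v: "v \<in> sphere 0 1" "u \<bullet> v = q k * f k v" for v k
  proof -
    have "q k * f k v \<le> Q * h v" using wulff_gauge_attained(2)[OF h v(1), of u] v(2) by (simp add: Q_def)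
    then have "exp (t k * g v) \<le> Q / q k"
      using q hpos[OF v(1)] by (simp add: f_def pos_le_divide_eq mult.left_commute mult.commute)
    then have "t k * g v \<le> ln (Q / q k)"
      using Q q by (metis divide_pos_pos ln_exp ln_le_cancel_iff exp_gt_zero)
    then show ?thesis using t(1) by (simp add: pos_le_divide_eq mult.commute)
  qed
  let ?W = "sphere 0 1 \<inter> {v\<in>sphere 0 1. g v \<le> g \<alpha> - \<epsilon>}"
  have "closed {v\<in>sphere 0 1. g v \<le> g \<alpha> - \<epsilon>}"
    using continuous_closed_preimage[OF g closed_sphere closed_atMost[of "g \<alpha> - \<epsilon>"]]
    by (simp add: vimage_def Int_def)
  then have W: "compact ?W" by (intro compact_Int_closed compact_sphere)
  have "\<exists>\<eta>>0. \<forall>v\<in>?W. u \<bullet> v \<le> Q * h v - \<eta>"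
  proof (cases "?W = {}")
    case True
    then show ?thesis by (intro exI[of _ 1]) auto
  next
    case False
    have "continuous_on ?W (\<lambda>v. Q * h v - u \<bullet> v)"
      using positive_on_sphereD(1)[OF h] by (intro continuous_intros) (auto intro: continuous_on_subset)
    then obtain w where w: "w \<in> ?W" "\<And>v. v \<in> ?W \<Longrightarrow> Q * h w - u \<bullet> w \<le> Q * h v - u \<bullet> v"
      using continuous_attains_inf[OF W False] by blast
    have "u \<bullet> w \<le> Q * h w" using wulff_gauge_attained(2)[OF h, of w u] w(1) by (simp add: Q_def)
    moreover have "u \<bullet> w \<noteq> Q * h w" using uniq[of w] w(1) \<epsilon> by auto
    ultimately have "0 < Q * h w - u \<bullet> w" by simp
    then show ?thesis using w(2) by (intro exI[of _ "Q * h w - u \<bullet> w"]) force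
  qed
  then obtain \<eta> where \<eta>: "0 < \<eta>" "\<And>v. v \<in> ?W \<Longrightarrow> u \<bullet> v \<le> Q * h v - \<eta>" by blast
  obtain b where b: "\<And>v. v \<in> sphere 0 1 \<Longrightarrow> h v \<le> b" using positive_on_sphere_bounds[OF h] by metis
  have "(\<lambda>k. Q * b * (1 - exp (- (2 * (t k * B))))) \<longlonglongrightarrow> Q * b * (1 - exp (- (2 * (0 * B))))"
    by (intro tendsto_intros t)
  then have "eventually (\<lambda>k. Q * b * (1 - exp (- (2 * (t k * B)))) < \<eta>) sequentially"
    using \<eta>(1) by (intro order_tendstoD) simp_all
  then obtain N where N: "\<And>k. N \<le> k \<Longrightarrow> Q * b * (1 - exp (- (2 * (t k * B)))) < \<eta>"
    unfolding eventually_sequentially by blast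
  have near: "g \<alpha> - \<epsilon> < g v" if k: "N \<le> k" and v: "v \<in> sphere 0 1" "u \<bullet> v = q k * f k v" for k v
  proof (rule ccontr)
    assume "\<not> ?thesis"
    then have "u \<bullet> v \<le> Q * h v - \<eta>" using \<eta>(2)[of v] v(1) by simp
    have "ln (Q / q k) \<le> t k * B"
      using wulff_gauge_perturbation_bounds[OF h g B less_imp_le[OF t(1)] u, of k]
      unfolding Q_def q_def f_def[abs_def] by (simp add: abs_le_iff)
    then have "Q / q k \<le> exp (t k * B)" using Q q by (metis divide_pos_pos exp_le_cancel_iff exp_ln)
    then have "Q * exp (- (t k * B)) \<le> q k" using q by (simp add: exp_minus field_simps)
    moreover have "exp (- (t k * B)) \<le> exp (t k * g v)"
      using mult_left_mono[of "- B" "g v" "t k"] B[OF v(1)] t(1)[of k] by (auto simp: abs_le_iff)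
    ultimately have "(Q * exp (- (t k * B))) * exp (- (t k * B)) \<le> q k * exp (t k * g v)"
      using Q q[of k] by (intro mult_mono) auto
    moreover have "exp (- (2 * (t k * B))) = exp (- (t k * B)) * exp (- (t k * B))"
      by (simp only: mult_exp_exp) simp
    ultimately have "Q * exp (- (2 * (t k * B))) * h v \<le> q k * exp (t k * g v) * h v"
      using hpos[OF v(1)] by (intro mult_right_mono) (simp_all only: mult.assoc less_imp_le)
    also have "\<dots> = u \<bullet> v" using v(2) by (simp add: f_def mult_ac)
    also have "\<dots> \<le> Q * h v - \<eta>" by fact
    finally have "\<eta> \<le> Q * h v * (1 - exp (- (2 * (t k * B))))" by (simp add: algebra_simps)
    also have "\<dots> \<le> Q * b * (1 - exp (- (2 * (t k * B))))"
    proof -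
      have "0 \<le> B" using B[OF \<alpha>(1)] by linarith
      then have "exp (- (2 * (t k * B))) \<le> 1" using t(1)[of k] by simp
      then show ?thesis using b[OF v(1)] Q by (intro mult_right_mono mult_left_mono) auto
    qed
    finally show False using N[OF k] by simp
  qed
  have "norm (ln (Q / q k) / t k - g \<alpha>) < \<epsilon>" if k: "N \<le> k" for k
  proof -
    obtain v where v: "v \<in> sphere 0 1" "u \<bullet> v = q k * f k v"
      using wulff_gauge_attained(1)[OF f, of u k] by (auto simp: q_def)
    show ?thesis using near[OF k v] lower[OF v] upper[of k] by simp
  qed
  then show "\<exists>no. \<forall>k\<ge>no. norm (ln (wulff_gauge h u / wulff_gauge (\<lambda>v. h v * exp (t k * g v)) u) / t k - g (contact_map h u)) < \<epsilon>"
    unfolding Q_def q_def f_def[abs_def] \<alpha>_def by blast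
qed

context orlicz_minkowski_problem
begin

text \<open>The difference quotients of the energy along \<open>f k = h exp (t k g)\<close> are nonnegative.
  On a compact range \<open>[lo, hi]\<close> that contains all values in question they are bounded, so
  dominated convergence applies to both integrals.\<close>

lemma energy_variation_nonneg:
  assumes h: "positive_on_sphere h" and min: "\<And>f. positive_on_sphere f \<Longrightarrow> energy h \<le> energy f"
    and g: "continuous_on (sphere 0 1) g" and gm: "g \<in> borel_measurable borel"
  shows "0 \<le> (\<integral>u. \<psi> (h u) * g u \<partial>\<mu>) +
    (\<integral>u. 1 / wulff_gauge h u * G_t G (1 / wulff_gauge h u) u * g (contact_map h u) \<partial>\<omega>)"
    (is "0 \<le> ?I1 + ?I2")
proof -
  define t where "t k = inverse (real (Suc k))" for k
  have t: "\<And>k. 0 < t k" "\<And>k. t k \<le> 1" "t \<longlonglongrightarrow> 0" "\<And>k. t k \<noteq> 0"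
    using LIMSEQ_inverse_real_of_nat by (auto simp: t_def[abs_def] inverse_le_1_iff)
  define f where "f k v = h v * exp (t k * g v)" for k v
  have f: "positive_on_sphere (f k)" for k
    unfolding f_def[abs_def] by (rule positive_on_sphere_perturbation[OF h g])
  obtain B where B: "\<And>v. v \<in> sphere 0 1 \<Longrightarrow> \<bar>g v\<bar> \<le> B"
  proof -
    have "bounded (g ` sphere 0 1)" by (intro compact_imp_bounded compact_continuous_image g compact_sphere)
    then obtain B where "\<forall>y\<in>g ` sphere 0 1. norm y \<le> B" unfolding bounded_iff by blast
    then show thesis by (intro that[of B]) force
  qed
  have B0: "0 \<le> B"
  proof -
    obtain v :: "real ^ 'n" where "v \<in> sphere 0 1" using sphere_nonempty by blast
    from B[OF this] show ?thesis by linarith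
  qed
  obtain a b where ab: "0 < a" "a \<le> b" "\<And>v. v \<in> sphere 0 1 \<Longrightarrow> a \<le> h v" "\<And>v. v \<in> sphere 0 1 \<Longrightarrow> h v \<le> b"
    using positive_on_sphere_bounds[OF h] by metis
  define lo hi where "lo = a * exp (- B)" and "hi = b * exp B"
  have lo: "0 < lo" using ab(1) by (simp add: lo_def)
  have range: "lo \<le> x * exp L \<and> x * exp L \<le> hi" if "a \<le> x" "x \<le> b" "\<bar>L\<bar> \<le> B" for x L
    unfolding lo_def hi_def using that ab(1) by (auto intro!: mult_mono)
  have range0: "lo \<le> x \<and> x \<le> hi" if "a \<le> x" "x \<le> b" for x
    using range[OF that, of 0] B0 by simp
  have tB: "t k * B \<le> B" for k using mult_right_mono[OF t(2) B0, of k] by simp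
  have tg: "\<bar>t k * g v\<bar> \<le> t k * B" if "v \<in> sphere 0 1" for k v
    using mult_left_mono[OF B[OF that] less_imp_le[OF t(1)], of k] t(1)[of k] by (simp add: abs_mult)
  obtain M1 where M1: "\<And>s. lo \<le> s \<Longrightarrow> s \<le> hi \<Longrightarrow> \<bar>\<psi> s\<bar> \<le> M1"
  proof -
    have "continuous_on {lo..hi} \<psi>" using lo by (intro continuous_on_subset[OF psi_cont]) auto
    then have "bounded (\<psi> ` {lo..hi})" by (intro compact_imp_bounded compact_continuous_image) auto
    then obtain M1 where "\<forall>y\<in>\<psi> ` {lo..hi}. norm y \<le> M1" unfolding bounded_iff by blast
    then show thesis by (intro that[of M1]) force
  qed
  obtain M2 where M2: "\<And>s u. lo \<le> s \<Longrightarrow> s \<le> hi \<Longrightarrow> u \<in> sphere 0 1 \<Longrightarrow> \<bar>s * G_t G s u\<bar> \<le> M2"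
  proof -
    let ?P = "{lo..hi} \<times> (sphere 0 1 :: (real ^ 'n) set)"
    have "continuous_on ?P (\<lambda>(s, u). G_t G s u)" using lo by (intro continuous_on_subset[OF G_t_cont]) auto
    then have "continuous_on ?P (\<lambda>p. fst p * (case p of (s, u) \<Rightarrow> G_t G s u))"
      by (intro continuous_intros)
    then have "bounded ((\<lambda>p. fst p * (case p of (s, u) \<Rightarrow> G_t G s u)) ` ?P)"
      by (intro compact_imp_bounded compact_continuous_image compact_Times) auto
    then obtain M2 where "\<forall>y\<in>(\<lambda>p. fst p * (case p of (s, u) \<Rightarrow> G_t G s u)) ` ?P. norm y \<le> M2"
      unfolding bounded_iff by blast
    then show thesis by (intro that[of M2]) force
  qed
  have 1: "(\<lambda>k. \<integral>u. (\<phi> (f k u) - \<phi> (h u)) / t k \<partial>\<mu>) \<longlonglongrightarrow> ?I1"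
  proof (rule integral_dominated_convergence[where w = "\<lambda>_. M1 * B"])
    have "continuous_on (sphere 0 1) (\<lambda>u. \<psi> (h u))"
      using positive_on_sphereD[OF h] by (intro continuous_on_compose2[OF psi_cont]) auto
    then show "(\<lambda>u. \<psi> (h u) * g u) \<in> borel_measurable \<mu>"
      by (intro continuous_on_measurable_mu continuous_on_mult g)
    show "(\<lambda>u. (\<phi> (f k u) - \<phi> (h u)) / t k) \<in> borel_measurable \<mu>" for k
      using t(4) by (intro continuous_on_measurable_mu continuous_on_divide continuous_on_diff
          continuous_on_energy_integrands(1) f h continuous_on_const) auto
    show "AE u in \<mu>. (\<lambda>k. (\<phi> (f k u) - \<phi> (h u)) / t k) \<longlonglongrightarrow> \<psi> (h u) * g u"
    proof (rule AE_I2)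
      fix u assume "u \<in> space \<mu>"
      then have hu: "0 < h u" using positive_on_sphereD(2)[OF h] by (simp add: space_mu)
      have "(\<lambda>k. (\<phi> (h u * exp (t k * g u)) - \<phi> (h u)) / t k) \<longlonglongrightarrow> h u * (\<psi> (h u) / h u) * g u"
        by (rule exp_reparametrized_quotient_tendsto[OF phi_deriv[OF hu] t(4,3)]) (use t(4) in simp)
      then show "(\<lambda>k. (\<phi> (f k u) - \<phi> (h u)) / t k) \<longlonglongrightarrow> \<psi> (h u) * g u" using hu by (simp add: f_def)
    qed
    show "AE u in \<mu>. norm ((\<phi> (f k u) - \<phi> (h u)) / t k) \<le> M1 * B" for k
    proof (rule AE_I2)
      fix u assume "u \<in> space \<mu>"
      then have u: "u \<in> sphere 0 1" by (simp add: space_mu)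
      have tgB: "\<bar>t k * g u\<bar> \<le> B" using tg[OF u, of k] tB[of k] by linarith
      note r = range[OF ab(3,4)[OF u] tgB] range0[OF ab(3,4)[OF u]]
      have M10: "0 \<le> M1" using M1[of "h u"] r(2) by linarith
      have "\<bar>\<phi> (h u * exp (t k * g u)) - \<phi> (h u)\<bar> \<le> M1 * \<bar>t k * g u\<bar>"
      proof (rule abs_exp_reparametrized_diff_le[where F' = "\<lambda>s. \<psi> s / s"])
        fix s assume s: "lo \<le> s" "s \<le> hi"
        then have "0 < s" using lo by simp
        then show "(\<phi> has_real_derivative \<psi> s / s) (at s)" "\<bar>s * (\<psi> s / s)\<bar> \<le> M1"
          using M1[OF s] by (auto intro: phi_deriv)
      qed (use r lo in auto)
      also have "\<dots> \<le> M1 * (t k * B)" using tg[OF u] M10 by (intro mult_left_mono)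
      finally show "norm ((\<phi> (f k u) - \<phi> (h u)) / t k) \<le> M1 * B"
        using t(1)[of k] by (simp add: f_def abs_divide pos_divide_le_eq mult_ac)
    qed
  qed auto
  let ?r = "\<lambda>u. 1 / wulff_gauge h u"
  have rc: "continuous_on (sphere 0 1) ?r" by (rule continuous_on_energy_integrands(3)[OF h])
  have rp: "0 < ?r u" if "u \<in> sphere 0 1" for u using wulff_gauge_pos[OF h that] by simp
  let ?L = "\<lambda>k u. ln (wulff_gauge h u / wulff_gauge (f k) u)"
  have rk: "1 / wulff_gauge (f k) u = ?r u * exp (?L k u)" if u: "u \<in> sphere 0 1" for k u
    using wulff_gauge_pos[OF h u] wulff_gauge_pos[OF f u, of k] by simp
  have LB: "\<bar>?L k u\<bar> \<le> t k * B" if u: "u \<in> sphere 0 1" for k u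
    unfolding f_def[abs_def] by (rule wulff_gauge_perturbation_bounds[OF h g B less_imp_le[OF t(1)] u])
  have 2: "(\<lambda>k. \<integral>u. (G (1 / wulff_gauge (f k) u) u - G (?r u) u) / t k \<partial>\<omega>) \<longlonglongrightarrow> ?I2"
  proof (rule integral_dominated_convergence[where w = "\<lambda>_. M2 * B"])
    have "(\<lambda>u. g (contact_map h u)) \<in> borel_measurable \<omega>"
      using measurable_compose[OF measurable_contact_map[OF sphere_measure_finite h] gm] .
    moreover have "(\<lambda>u. ?r u * G_t G (?r u) u) \<in> borel_measurable \<omega>"
      by (intro continuous_on_measurable_sphere_measure continuous_on_mult rc continuous_on_G(2) rp)
    ultimately show "(\<lambda>u. ?r u * G_t G (?r u) u * g (contact_map h u)) \<in> borel_measurable \<omega>"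
      by (rule borel_measurable_times[rotated])
    show "(\<lambda>u. (G (1 / wulff_gauge (f k) u) u - G (?r u) u) / t k) \<in> borel_measurable \<omega>" for k
      using t(4) by (intro continuous_on_measurable_sphere_measure continuous_on_divide continuous_on_diff
          continuous_on_energy_integrands(2) f h continuous_on_const) auto
    show "AE u in \<omega>. (\<lambda>k. (G (1 / wulff_gauge (f k) u) u - G (?r u) u) / t k)
        \<longlonglongrightarrow> ?r u * G_t G (?r u) u * g (contact_map h u)"
      using AE_unique_contact_normal[OF sphere_measure_finite h] AE_space
    proof eventually_elim
      case (elim u)
      then have u: "u \<in> sphere 0 1" by simp
      have "(\<lambda>k. ?L k u / t k) \<longlonglongrightarrow> g (contact_map h u)"
        unfolding f_def[abs_def] by (rule wulff_gauge_log_derivative[OF h g u elim(1) t(1,3)])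
      from exp_reparametrized_quotient_tendsto[OF G_deriv[OF rp[OF u] u] t(4,3) this]
      show ?case by (simp only: rk[OF u])
    qed
    show "AE u in \<omega>. norm ((G (1 / wulff_gauge (f k) u) u - G (?r u) u) / t k) \<le> M2 * B" for k
    proof (rule AE_I2)
      fix u assume "u \<in> space \<omega>"
      then have u: "u \<in> sphere 0 1" by simp
      have LB': "\<bar>?L k u\<bar> \<le> B" using LB[OF u, of k] tB[of k] by linarith
      have "1 / b \<le> wulff_gauge h u" "wulff_gauge h u \<le> 1 / a"
        using wulff_gauge_bounds[OF h u ab(1,3,4)] by auto
      then have ra: "a \<le> ?r u" "?r u \<le> b"
        using wulff_gauge_pos[OF h u] ab(1,2) by (auto simp: field_simps)
      note r = range[OF ra LB'] range0[OF ra]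
      have M20: "0 \<le> M2" using M2[of "?r u" u] r(2) u by linarith
      have "\<bar>G (?r u * exp (?L k u)) u - G (?r u) u\<bar> \<le> M2 * \<bar>?L k u\<bar>"
      proof (rule abs_exp_reparametrized_diff_le[where F = "\<lambda>s. G s u" and F' = "\<lambda>s. G_t G s u"])
        fix s assume s: "lo \<le> s" "s \<le> hi"
        then have "0 < s" using lo by simp
        then show "((\<lambda>s. G s u) has_real_derivative G_t G s u) (at s)" by (rule G_deriv[OF _ u])
        show "\<bar>s * G_t G s u\<bar> \<le> M2" by (rule M2[OF s u])
      qed (use r lo in auto)
      also have "\<dots> \<le> M2 * (t k * B)" using LB[OF u] M20 by (intro mult_left_mono)
      finally show "norm ((G (1 / wulff_gauge (f k) u) u - G (?r u) u) / t k) \<le> M2 * B"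
        unfolding rk[OF u] using t(1)[of k] by (simp add: abs_divide pos_divide_le_eq mult_ac)
    qed
  qed auto
  show ?thesis
  proof (rule LIMSEQ_le_const[OF tendsto_add[OF 1 2]], intro exI allI impI)
    fix k
    have "(\<integral>u. (\<phi> (f k u) - \<phi> (h u)) / t k \<partial>\<mu>) + (\<integral>u. (G (1 / wulff_gauge (f k) u) u - G (?r u) u) / t k \<partial>\<omega>)
        = (energy (f k) - energy h) / t k"
      by (simp add: energy_def energy_integrable f h diff_divide_distrib add_divide_distrib)
    also have "0 \<le> \<dots>" using min[OF f, of k] t(1)[of k] by simp
    finally show "0 \<le> (\<integral>u. (\<phi> (f k u) - \<phi> (h u)) / t k \<partial>\<mu>) + (\<integral>u. (G (1 / wulff_gauge (f k) u) u - G (?r u) u) / t k \<partial>\<omega>)"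
      by simp
  qed
qed

text \<open>The one-sided inequality, applied to \<open>g\<close> and to \<open>-g\<close>.\<close>

theorem euler_lagrange:
  assumes h: "positive_on_sphere h" and min: "\<And>f. positive_on_sphere f \<Longrightarrow> energy h \<le> energy f"
    and g: "continuous_on (sphere 0 1) g" and gm: "g \<in> borel_measurable borel"
  shows "(\<integral>u. \<psi> (h u) * g u \<partial>\<mu>) =
    - (\<integral>u. 1 / wulff_gauge h u * G_t G (1 / wulff_gauge h u) u * g (contact_map h u) \<partial>\<omega>)"
  using energy_variation_nonneg[OF h min g gm]
    energy_variation_nonneg[OF h min continuous_on_minus[OF g] borel_measurable_uminus[OF gm]]
  by simp

end

section \<open>The curvature measure of the minimizer\<close>

text \<open>The indicator of a closed set \<open>C\<close> is the pointwise limit of the functions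
  \<open>max 0 (1 - k dist(x, C))\<close>, and closed sets form a generator stable under
  intersections.\<close>

lemma finite_borel_measure_eqI:
  fixes M N :: "'a::metric_space measure"
  assumes M: "finite_measure M" "sets M = sets borel" and N: "finite_measure N" "sets N = sets borel"
    and eq: "\<And>e :: 'a \<Rightarrow> real. continuous_on UNIV e \<Longrightarrow> (\<And>x. 0 \<le> e x \<and> e x \<le> 1)
      \<Longrightarrow> integral\<^sup>L M e = integral\<^sup>L N e"
  shows "M = N"
proof (rule measure_eqI_generator_eq[where E = "Collect closed" and \<Omega> = UNIV and A = "\<lambda>_. UNIV"])
  show "Int_stable (Collect closed :: 'a set set)" by (auto simp: Int_stable_def)
  show "sets M = sigma_sets UNIV (Collect closed)" "sets N = sigma_sets UNIV (Collect closed)"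
    unfolding M(2) N(2) borel_eq_closed by simp_all
  show "emeasure M UNIV \<noteq> \<infinity>" using finite_measure.emeasure_finite[OF M(1)] by simp
  fix C :: "'a set" assume "C \<in> Collect closed"
  then have C: "closed C" by simp
  show "emeasure M C = emeasure N C"
  proof (cases "C = {}")
    case False
    define e where "e k x = max 0 (1 - real k * infdist x C)" for k x
    have ec: "continuous_on UNIV (e k)" for k
      unfolding e_def[abs_def] by (intro continuous_intros)
    have e01: "0 \<le> e k x" "e k x \<le> 1" for k x
      using infdist_nonneg[of x C] by (auto simp: e_def)
    have pt: "(\<lambda>k. e k x) \<longlonglongrightarrow> indicator C x" for x
    proof (cases "x \<in> C")
      case True
      then have "infdist x C = 0" by simp
      then show ?thesis using True by (simp add: e_def)
    next
      case out: False
      have d: "0 < infdist x C" using infdist_pos_not_in_closed[OF C False out] .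
      obtain n where n: "1 < real n * infdist x C" using reals_Archimedean3[OF d] by blast
      have "e k x = 0" if "n \<le> k" for k
      proof -
        have "real n * infdist x C \<le> real k * infdist x C" using that d by (intro mult_right_mono) auto
        then show ?thesis using n by (simp add: e_def)
      qed
      then have "eventually (\<lambda>k. e k x = indicator C x) sequentially"
        using out by (auto simp: eventually_sequentially)
      then show ?thesis by (rule tendsto_eventually)
    qed
    have conv: "(\<lambda>k. integral\<^sup>L P (e k)) \<longlonglongrightarrow> measure P C"
      if P: "finite_measure P" "sets P = sets borel" for P :: "'a measure"
    proof -
      interpret finite_measure P by fact
      have "(\<lambda>k. integral\<^sup>L P (e k)) \<longlonglongrightarrow> integral\<^sup>L P (indicator C)"
      proof (rule integral_dominated_convergence[where w = "\<lambda>_. 1"])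
        show "(indicator C :: 'a \<Rightarrow> real) \<in> borel_measurable P"
          using C P(2) by (intro borel_measurable_indicator) auto
        show "e k \<in> borel_measurable P" for k
          using borel_measurable_continuous_onI[OF ec] by (subst measurable_cong_sets[OF P(2) refl])
      qed (use e01 pt in auto)
      also have "integral\<^sup>L P (indicator C) = measure P C"
        using C P(2) sets_eq_imp_space_eq[OF P(2)] by simp
      finally show ?thesis .
    qed
    have "integral\<^sup>L M (e k) = integral\<^sup>L N (e k)" for k using eq[OF ec] e01 by simp
    then have "measure M C = measure N C"
      using conv[OF M] conv[OF N] by (simp add: LIMSEQ_unique)
    then show ?thesis
      by (simp add: finite_measure.emeasure_eq_measure[OF M(1)] finite_measure.emeasure_eq_measure[OF N(1)])
  qed simp
qed auto

lemma borel_measurable_sphere_measure_AE_cong: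
  fixes f g :: "real ^ 'n \<Rightarrow> 'b::topological_space"
  assumes f: "f \<in> borel_measurable sphere_measure" and ae: "AE u in sphere_measure. f u = g u"
  shows "g \<in> borel_measurable sphere_measure"
proof (rule borel_measurableI)
  fix U :: "'b set" assume "open U"
  then have B: "f -` U \<inter> space sphere_measure \<in> sets sphere_measure"
    using measurable_sets[OF f] by auto
  have "AE u in sphere_measure. u \<in> g -` U \<inter> space sphere_measure \<longleftrightarrow> u \<in> f -` U \<inter> space sphere_measure"
    using ae by eventually_elim simp
  then show "g -` U \<inter> space sphere_measure \<in> sets sphere_measure"
    by (rule sets_sphere_measure_AE_cong[OF _ B]) auto
qed

text \<open>A quantitative form of the fact that a ray from an interior point leaves a convex body
  transversally; for a body between balls of radii \<open>a\<close> and \<open>b\<close> the cosine of the angle between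
  direction and normal is at least \<open>a / b\<close>.\<close>

lemma contact_normal_inner_ge:
  assumes h: "positive_on_sphere h" and u: "u \<in> sphere 0 1" and \<alpha>: "\<alpha> \<in> contact_normals h u"
    and a: "0 < a" "\<And>v. v \<in> sphere 0 1 \<Longrightarrow> a \<le> h v" and b: "\<And>v. v \<in> sphere 0 1 \<Longrightarrow> h v \<le> b"
  shows "a / b \<le> u \<bullet> \<alpha>"
proof -
  have "a / b = 1 / b * a" by simp
  also have "\<dots> \<le> wulff_gauge h u * h \<alpha>"
    using wulff_gauge_bounds(1)[OF h u a b] wulff_gauge_pos[OF h u] \<alpha> a
    by (intro mult_mono) (auto simp: contact_normals_def)
  finally show ?thesis using \<alpha> by (simp add: contact_normals_def)
qed

context orlicz_minkowski_problem
begin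

text \<open>The integrand of the dual Orlicz curvature measure, written through the gauge of the support
  function.\<close>

definition curvature_density :: "(real ^ 'n) set \<Rightarrow> real ^ 'n \<Rightarrow> real" where
  "curvature_density K u = 1 / wulff_gauge (support_function K) u
     * G_t G (1 / wulff_gauge (support_function K) u) u
     / \<psi> (support_function K (contact_map (support_function K) u))"

lemma AE_contact_map_sphere:
  assumes "positive_on_sphere h" shows "AE u in \<omega>. contact_map h u \<in> sphere 0 1"
  using AE_unique_contact_normal[OF sphere_measure_finite assms]
  by eventually_elim (rule contact_map_eq(2))

lemma curvature_density_neg:
  assumes K: "K \<in> convex_bodies_o" shows "AE u in \<omega>. curvature_density K u < 0"
proof -
  note h = positive_on_sphere_support_function[OF K]
  show ?thesis
    using AE_contact_map_sphere[OF h] AE_space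
  proof eventually_elim
    case (elim u)
    have "0 < 1 / wulff_gauge (support_function K) u" using wulff_gauge_pos[OF h] elim by simp
    moreover have "0 < \<psi> (support_function K (contact_map (support_function K) u))"
      using positive_on_sphereD(2)[OF h elim(1)] by (rule psi_pos)
    ultimately show ?case
      using G_t_neg[of "1 / wulff_gauge (support_function K) u" u] elim(2)
      by (simp add: curvature_density_def divide_neg_pos mult_pos_neg)
  qed
qed

text \<open>The function \<open>\<psi>\<close> is controlled only on \<open>(0, \<infinity>)\<close>, so quotients by \<open>\<psi> \<circ> h\<close> are cut off
  outside the sphere to become Borel on the whole space and composable with the normal map.\<close>

lemma psi_of_function_measurable:
  fixes h :: "real ^ 'n \<Rightarrow> real"
  assumes h: "positive_on_sphere h"
  shows "continuous_on (sphere 0 1) (\<lambda>v. \<psi> (h v))"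
    and "continuous_on (sphere 0 1) e \<Longrightarrow> (\<lambda>v. indicator (sphere 0 1) v * (e v / \<psi> (h v))) \<in> borel_measurable borel"
proof -
  show c: "continuous_on (sphere 0 1) (\<lambda>v. \<psi> (h v))"
    using positive_on_sphereD[OF h] by (intro continuous_on_compose2[OF psi_cont]) auto
  have "\<psi> (h v) \<noteq> 0" if "v \<in> sphere 0 1" for v
    using psi_pos[OF positive_on_sphereD(2)[OF h that]] by simp
  then have "continuous_on (sphere 0 1) (\<lambda>v. e v / \<psi> (h v))" if "continuous_on (sphere 0 1) e"
    using c that by (intro continuous_on_divide) auto
  then show "(\<lambda>v. indicator (sphere 0 1) v * (e v / \<psi> (h v))) \<in> borel_measurable borel"
    if "continuous_on (sphere 0 1) e"
    using borel_measurable_continuous_on_indicator[of "sphere 0 1" "\<lambda>v. e v / \<psi> (h v)"] that by simp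
qed

lemma curvature_density_integrable:
  assumes K: "K \<in> convex_bodies_o" shows "integrable \<omega> (curvature_density K)"
proof -
  define h where "h = support_function K"
  have h: "positive_on_sphere h" unfolding h_def by (rule positive_on_sphere_support_function[OF K])
  define r where "r u = 1 / wulff_gauge h u" for u
  have rc: "continuous_on (sphere 0 1) r"
    unfolding r_def[abs_def] by (rule continuous_on_energy_integrands(3)[OF h])
  have rp: "0 < r u" if "u \<in> sphere 0 1" for u using wulff_gauge_pos[OF h that] by (simp add: r_def)
  have w: "continuous_on (sphere 0 1) (\<lambda>u. r u * G_t G (r u) u)"
    by (intro continuous_on_mult rc continuous_on_G(2) rp)
  define i where "i v = indicator (sphere 0 1) v * (1 / \<psi> (h v))" for v
  have "i \<in> borel_measurable borel"
    unfolding i_def[abs_def] by (rule psi_of_function_measurable(2)[OF h continuous_on_const])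
  then have im: "(\<lambda>u. i (contact_map h u)) \<in> borel_measurable \<omega>"
    using measurable_compose[OF measurable_contact_map[OF sphere_measure_finite h]] by blast
  obtain w1 where "w1 \<in> sphere 0 1" "\<And>v. v \<in> sphere 0 1 \<Longrightarrow> \<psi> (h w1) \<le> \<psi> (h v)"
    using continuous_attains_inf[OF compact_sphere sphere_nonempty psi_of_function_measurable(1)[OF h]] by blast
  note w1 = this
  have p: "0 < \<psi> (h w1)" using psi_pos[OF positive_on_sphereD(2)[OF h w1(1)]] .
  have ib: "norm (i v) \<le> 1 / \<psi> (h w1)" for v
  proof (cases "v \<in> sphere 0 1")
    case True
    with w1(2)[OF True] p show ?thesis by (simp add: i_def frac_le)
  qed (use p in \<open>simp add: i_def\<close>)
  have "integrable \<omega> (\<lambda>u. r u * G_t G (r u) u * (1 / \<psi> (h w1)))"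
    by (intro integrable_mult_left continuous_on_integrable(2) w)
  then have int: "integrable \<omega> (\<lambda>u. r u * G_t G (r u) u * i (contact_map h u))"
  proof (rule Bochner_Integration.integrable_bound)
    show "(\<lambda>u. r u * G_t G (r u) u * i (contact_map h u)) \<in> borel_measurable \<omega>"
      by (rule borel_measurable_times[OF continuous_on_measurable_sphere_measure[OF w] im])
    have "norm (r u * G_t G (r u) u * i (contact_map h u)) \<le> norm (r u * G_t G (r u) u * (1 / \<psi> (h w1)))" for u
      unfolding norm_mult using ib[of "contact_map h u"] p by (intro mult_left_mono) auto
    then show "AE u in \<omega>. norm (r u * G_t G (r u) u * i (contact_map h u)) \<le> norm (r u * G_t G (r u) u * (1 / \<psi> (h w1)))"
      by simp
  qed
  have ae: "AE u in \<omega>. r u * G_t G (r u) u * i (contact_map h u) = curvature_density K u"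
    using AE_contact_map_sphere[OF h]
    by eventually_elim (simp add: curvature_density_def r_def i_def h_def[symmetric])
  have "curvature_density K \<in> borel_measurable \<omega>"
    by (rule borel_measurable_sphere_measure_AE_cong[OF borel_measurable_integrable[OF int] ae])
  with ae int show ?thesis
    using integrable_cong_AE[OF borel_measurable_integrable[OF int] _ ae] by blast
qed

lemma indicator_contact_map_measurable:
  assumes h: "positive_on_sphere h" and E: "E \<in> sets borel"
  shows "(\<lambda>u. indicator E (contact_map h u) :: real) \<in> borel_measurable \<omega>"
  by (rule measurable_compose[OF measurable_contact_map[OF sphere_measure_finite h] borel_measurable_indicator[OF E]])

text \<open>Where the contact normal is unique, \<open>u\<close> belongs to the reverse radial Gauss image of \<open>E\<close>
  exactly if its normal belongs to \<open>E\<close>. Thus the curvature measure is the image under the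
  normal map of a measure with a density.\<close>

lemma dual_orlicz_curvature_eq:
  assumes K: "K \<in> convex_bodies_o" and E: "E \<in> sets borel" "E \<subseteq> sphere 0 1"
  shows "dual_orlicz_curvature G \<psi> K E
    = 1 / real CARD('n) * (\<integral>u. indicator E (contact_map (support_function K) u) * curvature_density K u \<partial>\<omega>)"
proof -
  let ?h = "support_function K"
  note h = positive_on_sphere_support_function[OF K]
  let ?A = "reverse_radial_gauss_image K E"
  let ?w = "\<lambda>u. radial_function K u * G_t G (radial_function K u) u / \<psi> (?h (radial_gauss_map K u))"
  have m: "(\<lambda>u. indicator E (contact_map ?h u) * curvature_density K u) \<in> borel_measurable \<omega>"
    by (intro borel_measurable_times indicator_contact_map_measurable h E
        borel_measurable_integrable curvature_density_integrable K)
  have ae: "AE u in \<omega>. indicator E (contact_map ?h u) * curvature_density K u = indicator ?A u * ?w u"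
    using AE_unique_contact_normal[OF sphere_measure_finite h] AE_space
  proof eventually_elim
    case (elim u)
    then have u: "u \<in> sphere 0 1" by simp
    note c = contact_map_eq(1)[OF elim(1)]
    have "radial_gauss_map K u = contact_map ?h u"
      by (simp add: radial_gauss_map_def contact_map_def outer_normal_iff_contact[OF K u])
    moreover have "u \<in> ?A \<longleftrightarrow> contact_map ?h u \<in> E"
      using u by (auto simp: reverse_radial_gauss_image_def outer_normal_iff_contact[OF K u] c)
    ultimately show ?case
      by (simp add: curvature_density_def radial_function_eq[OF K u] split: split_indicator)
  qed
  have "(LINT u : ?A | hausdorff_measure (CARD('n) - 1). ?w u) = (\<integral>u. indicator ?A u * ?w u \<partial>\<omega>)"
    by (rule set_integral_hausdorff_eq) (auto simp: reverse_radial_gauss_image_def)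
  also have "\<dots> = (\<integral>u. indicator E (contact_map ?h u) * curvature_density K u \<partial>\<omega>)"
    by (rule integral_cong_AE[OF borel_measurable_sphere_measure_AE_cong[OF m ae] m])
      (use ae in \<open>eventually_elim, simp\<close>)
  finally show ?thesis by (simp add: dual_orlicz_curvature_def)
qed

text \<open>The Euler--Lagrange equation with \<open>g = e / \<psi>(h)\<close> says that \<open>\<mu>\<close> and the image of
  \<open>- curvature_density K\<close> under the normal map integrate every continuous \<open>e\<close> to the same
  value.\<close>

theorem curvature_measure_exists:
  assumes nc: "not_concentrated_on_closed_hemisphere \<mu>"
  obtains K where "K \<in> convex_bodies_o"
    "\<And>E. E \<in> sets borel \<Longrightarrow> E \<subseteq> sphere 0 1
      \<Longrightarrow> measure \<mu> E = - real CARD('n) * dual_orlicz_curvature G \<psi> K E"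
proof -
  obtain K where K: "K \<in> convex_bodies_o"
    and min: "\<And>f. positive_on_sphere f \<Longrightarrow> energy (support_function K) \<le> energy f"
    using energy_minimizer_exists[OF nc] by blast
  define h where "h = support_function K"
  have h: "positive_on_sphere h" unfolding h_def by (rule positive_on_sphere_support_function[OF K])
  let ?w = "curvature_density K"
  have wi: "integrable \<omega> ?w" by (rule curvature_density_integrable[OF K])
  have neg: "AE u in \<omega>. 0 \<le> - ?w u"
    using curvature_density_neg[OF K] by eventually_elim simp
  have cm: "contact_map h \<in> measurable \<omega> borel" by (rule measurable_contact_map[OF sphere_measure_finite h])
  have idm: "(\<lambda>u. u) \<in> measurable \<mu> borel"
    unfolding measurable_cong_sets[OF mu_sets refl] by (rule measurable_restrict_space1) simp
  define M where "M = distr \<mu> borel (\<lambda>u. u)"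
  define D where "D = density \<omega> (\<lambda>u. ennreal (- ?w u))"
  define N where "N = distr D borel (contact_map h)"
  have cmD: "contact_map h \<in> measurable D borel" using cm by (simp add: D_def)
  have wm: "?w \<in> borel_measurable \<omega>" using wi by (rule borel_measurable_integrable)
  have "finite_measure M" unfolding M_def by (rule mu.finite_measure_distr[OF idm])
  moreover have "finite_measure D"
  proof (rule finite_measureI)
    have "(\<integral>\<^sup>+u. ennreal (- ?w u) \<partial>\<omega>) < \<infinity>"
      using nn_integral_eq_integral[OF Bochner_Integration.integrable_minus[OF wi] neg] by simp
    moreover have "emeasure D (space D) = (\<integral>\<^sup>+u. ennreal (- ?w u) \<partial>\<omega>)"
      unfolding D_def using wm sets.top[of \<omega>] by (subst emeasure_density) (auto intro!: nn_integral_cong)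
    ultimately show "emeasure D (space D) \<noteq> \<infinity>" by simp
  qed
  then have "finite_measure N" unfolding N_def using cmD by (rule finite_measure.finite_measure_distr)
  have intN: "integral\<^sup>L N e = - (\<integral>u. ?w u * e (contact_map h u) \<partial>\<omega>)"
    if e: "e \<in> borel_measurable borel" for e :: "real ^ 'n \<Rightarrow> real"
  proof -
    have "integral\<^sup>L N e = (\<integral>u. e (contact_map h u) \<partial>D)"
      unfolding N_def by (rule integral_distr[OF cmD e])
    also have "\<dots> = (\<integral>u. (- ?w u) *\<^sub>R e (contact_map h u) \<partial>\<omega>)"
      unfolding D_def
      by (rule integral_density) (use measurable_compose[OF cm e] wm neg in auto)
    also have "\<dots> = - (\<integral>u. ?w u * e (contact_map h u) \<partial>\<omega>)" by simp
    finally show ?thesis .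
  qed
  have "M = N"
  proof (rule finite_borel_measure_eqI)
    fix e :: "real ^ 'n \<Rightarrow> real" assume e: "continuous_on UNIV e"
    have em: "e \<in> borel_measurable borel" using e by (rule borel_measurable_continuous_onI)
    have eS: "continuous_on (sphere 0 1) e" using e by (rule continuous_on_subset) simp
    define g where "g v = indicator (sphere 0 1) v * (e v / \<psi> (h v))" for v
    have psi: "0 < \<psi> (h v)" if "v \<in> sphere 0 1" for v
      using psi_pos[OF positive_on_sphereD(2)[OF h that]] .
    have "continuous_on (sphere 0 1) (\<lambda>v. e v / \<psi> (h v))"
      using psi by (intro continuous_on_divide eS psi_of_function_measurable(1)[OF h]) (auto simp: less_imp_neq[THEN not_sym])
    then have gc: "continuous_on (sphere 0 1) g"
      by (rule continuous_on_eq) (simp add: g_def)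
    have gm: "g \<in> borel_measurable borel"
      unfolding g_def[abs_def] by (rule psi_of_function_measurable(2)[OF h eS])
    have "integral\<^sup>L M e = (\<integral>u. e u \<partial>\<mu>)" unfolding M_def by (rule integral_distr[OF idm em])
    also have "\<dots> = (\<integral>u. \<psi> (h u) * g u \<partial>\<mu>)"
      by (rule Bochner_Integration.integral_cong) (use psi in \<open>force simp: space_mu g_def\<close>)+
    also have "\<dots> = - (\<integral>u. 1 / wulff_gauge h u * G_t G (1 / wulff_gauge h u) u * g (contact_map h u) \<partial>\<omega>)"
      by (rule euler_lagrange[OF h min[folded h_def] gc gm])
    also have "(\<integral>u. 1 / wulff_gauge h u * G_t G (1 / wulff_gauge h u) u * g (contact_map h u) \<partial>\<omega>)
        = (\<integral>u. ?w u * e (contact_map h u) \<partial>\<omega>)"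
    proof (rule integral_cong_AE)
      show m: "(\<lambda>u. ?w u * e (contact_map h u)) \<in> borel_measurable \<omega>"
        by (rule borel_measurable_times[OF wm measurable_compose[OF cm em]])
      have ae: "AE u in \<omega>. ?w u * e (contact_map h u)
          = 1 / wulff_gauge h u * G_t G (1 / wulff_gauge h u) u * g (contact_map h u)"
        using AE_contact_map_sphere[OF h]
        by eventually_elim (simp add: g_def curvature_density_def h_def[symmetric])
      then show "(\<lambda>u. 1 / wulff_gauge h u * G_t G (1 / wulff_gauge h u) u * g (contact_map h u)) \<in> borel_measurable \<omega>"
        by (rule borel_measurable_sphere_measure_AE_cong[OF m])
      show "AE u in \<omega>. 1 / wulff_gauge h u * G_t G (1 / wulff_gauge h u) u * g (contact_map h u)
          = ?w u * e (contact_map h u)"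
        using ae by eventually_elim simp
    qed
    also have "- (\<integral>u. ?w u * e (contact_map h u) \<partial>\<omega>) = integral\<^sup>L N e" using intN[OF em] by simp
    finally show "integral\<^sup>L M e = integral\<^sup>L N e" .
  qed (use \<open>finite_measure M\<close> \<open>finite_measure N\<close> in \<open>auto simp: M_def N_def\<close>)
  have "measure \<mu> E = - real CARD('n) * dual_orlicz_curvature G \<psi> K E"
    if E: "E \<in> sets borel" "E \<subseteq> sphere 0 1" for E
  proof -
    have "measure \<mu> E = measure M E"
      unfolding M_def using E(2) by (subst measure_distr[OF idm E(1)]) (simp add: space_mu Int_absorb2)
    also have "\<dots> = integral\<^sup>L N (indicator E)"
      unfolding \<open>M = N\<close> by (simp add: N_def)
    also have "\<dots> = - (\<integral>u. ?w u * indicator E (contact_map h u) \<partial>\<omega>)"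
      by (rule intN[OF borel_measurable_indicator[OF E(1)]])
    also have "\<dots> = - real CARD('n) * dual_orlicz_curvature G \<psi> K E"
      unfolding dual_orlicz_curvature_eq[OF K E] h_def by (simp add: mult.commute)
    finally show ?thesis .
  qed
  with K show thesis by (rule that)
qed

text \<open>If the integral over the open hemisphere around \<open>v\<close> vanishes, the curvature measure of that
  hemisphere is \<open>0\<close>. As its density is negative, almost every \<open>u\<close> has its normal outside the
  hemisphere, which fails on a cap around \<open>v\<close>.\<close>

theorem curvature_measure_not_concentrated:
  assumes K: "K \<in> convex_bodies_o" and \<tau>: "\<tau> \<noteq> 0"
    and eq: "\<And>E. E \<in> sets borel \<Longrightarrow> E \<subseteq> sphere 0 1 \<Longrightarrow> measure \<mu> E = \<tau> * dual_orlicz_curvature G \<psi> K E"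
  shows "not_concentrated_on_closed_hemisphere \<mu>"
  unfolding not_concentrated_on_closed_hemisphere_def
proof (intro ballI, rule ccontr)
  fix v :: "real ^ 'n" assume v: "v \<in> sphere 0 1" and neg: "\<not> 0 < (\<integral>u. max (u \<bullet> v) 0 \<partial>\<mu>)"
  define h where "h = support_function K"
  have h: "positive_on_sphere h" unfolding h_def by (rule positive_on_sphere_support_function[OF K])
  define E where "E = {u \<in> sphere 0 1. 0 < u \<bullet> v}"
  have "E = sphere 0 1 \<inter> {u. v \<bullet> u > 0}" by (auto simp: E_def inner_commute)
  then have E: "E \<in> sets borel" using open_halfspace_gt[of 0 v] by auto
  have int: "integrable \<mu> (\<lambda>u. max (u \<bullet> v) 0)"
    by (intro continuous_on_integrable continuous_intros)
  have "0 \<le> (\<integral>u. max (u \<bullet> v) 0 \<partial>\<mu>)" by (rule Bochner_Integration.integral_nonneg) simp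
  with neg have "(\<integral>u. max (u \<bullet> v) 0 \<partial>\<mu>) = 0" by simp
  then have "AE u in \<mu>. max (u \<bullet> v) 0 = 0"
    by (subst (asm) integral_nonneg_eq_0_iff_AE[OF int]) auto
  then have "AE u in \<mu>. u \<notin> E" by eventually_elim (auto simp: E_def max_def split: if_splits)
  moreover have sub: "E \<subseteq> sphere 0 1" by (auto simp: E_def)
  moreover have "E \<in> sets \<mu>"
    unfolding mu_sets sets_restrict_space using E sub by (intro image_eqI[of _ _ E]) auto
  ultimately have "emeasure \<mu> E = 0" using AE_iff_null_sets by (intro null_setsD1) blast
  then have "measure \<mu> E = 0" by (simp add: measure_def)
  then have "dual_orlicz_curvature G \<psi> K E = 0" using eq[OF E sub] \<tau> by simp
  then have int0: "(\<integral>u. - (indicator E (contact_map h u) * curvature_density K u) \<partial>\<omega>) = 0"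
    using dual_orlicz_curvature_eq[OF K E sub] by (simp add: h_def)
  have "integrable \<omega> (\<lambda>u. - (indicator E (contact_map h u) * curvature_density K u))"
  proof (rule Bochner_Integration.integrable_bound[OF curvature_density_integrable[OF K]])
    show "(\<lambda>u. - (indicator E (contact_map h u) * curvature_density K u)) \<in> borel_measurable \<omega>"
      by (intro borel_measurable_uminus borel_measurable_times indicator_contact_map_measurable h E
          borel_measurable_integrable curvature_density_integrable K)
    show "AE u in \<omega>. norm (- (indicator E (contact_map h u) * curvature_density K u)) \<le> norm (curvature_density K u)"
      by (intro AE_I2) (simp split: split_indicator)
  qed
  moreover have "AE u in \<omega>. 0 \<le> - (indicator E (contact_map h u) * curvature_density K u)"
    using curvature_density_neg[OF K] by eventually_elim (simp split: split_indicator)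
  ultimately have "AE u in \<omega>. - (indicator E (contact_map h u) * curvature_density K u) = 0"
    using int0 integral_nonneg_eq_0_iff_AE by blast
  then have out: "AE u in \<omega>. contact_map h u \<notin> E"
    using curvature_density_neg[OF K] by eventually_elim (rule notI, simp)
  obtain a b where ab: "0 < a" "a \<le> b" "\<And>v. v \<in> sphere 0 1 \<Longrightarrow> a \<le> h v" "\<And>v. v \<in> sphere 0 1 \<Longrightarrow> h v \<le> b"
    using positive_on_sphere_bounds[OF h] by metis
  define \<kappa> where "\<kappa> = a / b"
  have \<kappa>: "0 < \<kappa>" using ab by (simp add: \<kappa>_def)
  \<comment> \<open>On this cap \<open>norm (u - v) < \<kappa>\<close>, while \<open>\<kappa> \<le> u \<bullet> \<alpha>\<close> for every contact normal \<open>\<alpha>\<close> at \<open>u\<close>; hence \<open>v \<bullet> \<alpha> > 0\<close>.\<close>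
  let ?A = "{u \<in> sphere 0 1. u \<bullet> v \<ge> 1 - \<kappa>\<^sup>2 / 4}"
  have "AE u in \<omega>. u \<notin> ?A"
    using out AE_unique_contact_normal[OF sphere_measure_finite h]
  proof eventually_elim
    case (elim u)
    show ?case
    proof
      assume uA: "u \<in> ?A"
      then have u: "u \<in> sphere 0 1" by simp
      let ?\<alpha> = "contact_map h u"
      have \<alpha>: "?\<alpha> \<in> contact_normals h u" "?\<alpha> \<in> sphere 0 1" using contact_map_eq[OF elim(2)] by auto
      have "(norm (u - v))\<^sup>2 = 2 - 2 * (u \<bullet> v)"
      proof -
        have "u \<bullet> u = 1" "v \<bullet> v = 1" using u v by (simp_all add: dot_square_norm)
        then show ?thesis
          by (simp add: power2_norm_eq_inner inner_diff_left inner_diff_right inner_commute[of v u])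
      qed
      also have "\<dots> < \<kappa>\<^sup>2"
      proof -
        have "0 < \<kappa>\<^sup>2" using \<kappa> by simp
        moreover have "1 - \<kappa>\<^sup>2 / 4 \<le> u \<bullet> v" using uA by simp
        ultimately show ?thesis by linarith
      qed
      finally have "norm (u - v) < \<kappa>" by (rule power2_less_imp_less) (use \<kappa> in simp)
      moreover have "\<kappa> \<le> u \<bullet> ?\<alpha>"
        unfolding \<kappa>_def by (rule contact_normal_inner_ge[OF h u \<alpha>(1) ab(1,3,4)])
      moreover have "(u - v) \<bullet> ?\<alpha> \<le> norm (u - v)" by (rule inner_unit_le[OF \<alpha>(2)])
      ultimately have "0 < v \<bullet> ?\<alpha>" by (simp add: inner_diff_left)
      with elim(1) \<alpha>(2) show False by (simp add: E_def inner_commute[of v])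
    qed
  qed
  then have "emeasure \<omega> ?A = 0" using AE_iff_null_sets[OF cap_in_sets] by (intro null_setsD1) blast
  moreover have "1 - \<kappa>\<^sup>2 / 4 < 1" using \<kappa> by simp
  ultimately show False using cap_measure_nonzero[OF sphere_measure_nonzero _ v] by blast
qed

lemma measure_sphere_pos:
  assumes nc: "not_concentrated_on_closed_hemisphere \<mu>" shows "0 < measure \<mu> (sphere 0 1)"
proof -
  obtain a m where am: "0 < m" "\<And>v :: real ^ 'n. v \<in> sphere 0 1 \<Longrightarrow> m \<le> measure \<mu> {u \<in> sphere 0 1. u \<bullet> v \<ge> a}"
    using hemisphere_mass_lower_bound[OF nc] by blast
  obtain v :: "real ^ 'n" where "v \<in> sphere 0 1" using sphere_nonempty by blast
  from am(2)[OF this] am(1) have "0 < measure \<mu> {u \<in> sphere 0 1. u \<bullet> v \<ge> a}" by linarith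
  also have "\<dots> \<le> measure \<mu> (space \<mu>)" by (rule mu.bounded_measure)
  finally show ?thesis by (simp add: space_mu)
qed

end

section \<open>The general dual Orlicz Minkowski problem\<close>

theorem theorem6p4:
  fixes G :: "real \<Rightarrow> real ^ 'n \<Rightarrow> real" and \<psi> :: "real \<Rightarrow> real"
    and \<epsilon>\<^sub>0 :: real and \<mu> :: "(real ^ 'n) measure"
  assumes n: "CARD('n) \<ge> 2"
    and G_pos: "\<And>t u. t > 0 \<Longrightarrow> u \<in> sphere 0 1 \<Longrightarrow> G t u > 0"
    and G_cont: "continuous_on ({0<..} \<times> sphere 0 1) (\<lambda>(t, u). G t u)"
    and G_diff: "\<And>t u. t > 0 \<Longrightarrow> u \<in> sphere 0 1 \<Longrightarrow> (\<lambda>s. G s u) differentiable (at t)"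
    and G_t_cont: "continuous_on ({0<..} \<times> sphere 0 1) (\<lambda>(t, u). G_t G t u)"
    and G_t_neg: "\<And>t u. t > 0 \<Longrightarrow> u \<in> sphere 0 1 \<Longrightarrow> G_t G t u < 0"
    and eps: "0 < \<epsilon>\<^sub>0" "\<epsilon>\<^sub>0 < 1"
    and G_lim: "\<And>v. v \<in> sphere 0 1 \<Longrightarrow>
          filterlim
            (\<lambda>t. LINT u : {u \<in> sphere 0 1. u \<bullet> v \<ge> \<epsilon>\<^sub>0} | hausdorff_measure (CARD('n) - 1). G t u)
            at_top (at_right 0)"
    and psi_pos: "\<And>s. s > 0 \<Longrightarrow> \<psi> s > 0"
    and psi_cont: "continuous_on {0<..} \<psi>"
    and psi_inf: "(\<integral>\<^sup>+ s \<in> {1..}. ennreal (\<psi> s / s) \<partial>lborel) = \<infinity>"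
    and phi_finite: "\<And>t. t > 0 \<Longrightarrow> (\<integral>\<^sup>+ s \<in> {0<..t}. ennreal (\<psi> s / s) \<partial>lborel) < \<infinity>"
    and mu_sets: "sets \<mu> = sets (restrict_space borel (sphere 0 1))"
    and mu_finite: "finite_measure \<mu>"
  shows "not_concentrated_on_closed_hemisphere \<mu> \<longleftrightarrow>
    (\<exists>K \<tau>. K \<in> convex_bodies_o \<and> \<tau> < 0
       \<and> \<tau> = measure \<mu> (sphere 0 1) / dual_orlicz_curvature G \<psi> K (sphere 0 1)
       \<and> (\<forall>E. E \<in> sets borel \<and> E \<subseteq> sphere 0 1 \<longrightarrow>
             measure \<mu> E = \<tau> * dual_orlicz_curvature G \<psi> K E))"
proof (rule antiderivative_of_quotient[OF psi_pos psi_cont psi_inf phi_finite[OF zero_less_one]])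
  fix \<phi> :: "real \<Rightarrow> real"
  assume \<phi>: "\<And>t. t > 0 \<Longrightarrow> (\<phi> has_real_derivative \<psi> t / t) (at t)"
    "\<And>t. t > 0 \<Longrightarrow> 0 \<le> \<phi> t" "\<And>C. \<exists>t>0. C < \<phi> t"
  interpret orlicz_minkowski_problem G \<psi> \<phi> \<epsilon>\<^sub>0 \<mu>
    by (rule orlicz_minkowski_problem.intro)
      (fact G_pos G_cont G_diff G_t_cont G_t_neg eps G_lim psi_pos psi_cont \<phi> mu_sets mu_finite)+
  show ?thesis
  proof
    assume nc: "not_concentrated_on_closed_hemisphere \<mu>"
    obtain K where K: "K \<in> convex_bodies_o" "\<And>E. E \<in> sets borel \<Longrightarrow> E \<subseteq> sphere 0 1
        \<Longrightarrow> measure \<mu> E = - real CARD('n) * dual_orlicz_curvature G \<psi> K E"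
      using curvature_measure_exists[OF nc] by blast
    have S: "measure \<mu> (sphere 0 1) = - real CARD('n) * dual_orlicz_curvature G \<psi> K (sphere 0 1)"
      by (rule K(2)) auto
    have "dual_orlicz_curvature G \<psi> K (sphere 0 1) \<noteq> 0" using measure_sphere_pos[OF nc] S by auto
    then have \<tau>: "- real CARD('n) = measure \<mu> (sphere 0 1) / dual_orlicz_curvature G \<psi> K (sphere 0 1)"
      unfolding S by simp
    show "\<exists>K \<tau>. K \<in> convex_bodies_o \<and> \<tau> < 0
       \<and> \<tau> = measure \<mu> (sphere 0 1) / dual_orlicz_curvature G \<psi> K (sphere 0 1)
       \<and> (\<forall>E. E \<in> sets borel \<and> E \<subseteq> sphere 0 1 \<longrightarrow>
             measure \<mu> E = \<tau> * dual_orlicz_curvature G \<psi> K E)"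
      by (rule exI[of _ K], rule exI[of _ "- real CARD('n)"])
        (intro conjI allI impI K \<tau>; simp)
  next
    assume "\<exists>K \<tau>. K \<in> convex_bodies_o \<and> \<tau> < 0
       \<and> \<tau> = measure \<mu> (sphere 0 1) / dual_orlicz_curvature G \<psi> K (sphere 0 1)
       \<and> (\<forall>E. E \<in> sets borel \<and> E \<subseteq> sphere 0 1 \<longrightarrow>
             measure \<mu> E = \<tau> * dual_orlicz_curvature G \<psi> K E)"
    then obtain K \<tau> where K: "K \<in> convex_bodies_o" "\<tau> < 0" "\<And>E. E \<in> sets borel \<Longrightarrow> E \<subseteq> sphere 0 1 \<Longrightarrow> measure \<mu> E = \<tau> * dual_orlicz_curvature G \<psi> K E"
      by blast
    from K(2) have "\<tau> \<noteq> 0" by simp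
    from curvature_measure_not_concentrated[OF K(1) this K(3)]
    show "not_concentrated_on_closed_hemisphere \<mu>" .
  qed
qed

end
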